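(* Suppose that $\kappa$ satisfies Assumption A and Assumption B (see context). Let $\{Z(t,x);t\ge0,x\in\mathbb{R}\}$ be an adapted random field such that, for any $t\ge0$, $\{Z(t,x)\}_{x\in\mathbb{R}}$ is strictly stationary and $Z(t,x)\in\mathrm{dom}(D)$ for any $x\in\mathbb{R}$. Assume that for any $0<r<t$, $x,y\in\mathbb{R}$ and $z\in\mathbb{R}_0$, $$\|D_{r,y,z}Z(t,x)\|_2\le C_t|z|\int_{\mathbb{R}}G_{t-r}(x-y')\kappa(y-y')\,dy',$$ where $C_t>0$ is a constant depending on $t$. Then, for any $t>0$, $\{Z(t,x)\}_{x\in\mathbb{R}}$ is ergodic.
   Context: **Noise.** $\mathbb{R}_0=\mathbb{R}\setminus\{0\}$ with distance $d(x,y)=|x^{-1}-y^{-1}|$ (so bounded sets are those bounded away from $0$). $\nu$ is a measure on $\mathbb{R}_0$ with $m_2:=\int_{\mathbb{R}_0}|z|^2\nu(dz)<\infty$. $N$ is a Poisson random measure on $\mathbf{Z}=\mathbb{R}_+\times\mathbb{R}\times\mathbb{R}_0$ with intensity $\mathfrak{m}(dt,dx,dz)=dt\,dx\,\nu(dz)$ on a complete probability space, and $\widehat N=N-\mathfrak{m}$. $\mathcal{F}_t$ is the $\sigma$-field generated by $N([0,s]\times A\times B)$, $s\le t$, $A\subset\mathbb{R}$ and $B\subset\mathbb{R}_0$ bounded Borel, and the null sets; adapted means that $Z(t,x)$ is $\mathcal{F}_t$-measurable for all $t,x$. $\|\cdot\|_2$ is the $L^2(\Omega)$ norm, and $G_t(x)=\frac12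 1_{\{|x|<t\}}$. **Assumption A.** $\kappa:\mathbb{R}\to[0,\infty]$ is continuous, symmetric and tempered (a measurable function $g$ is tempered if $\int|g(x)|(1+|x|^2)^{-k}dx<\infty$ for some $k>0$), and: (a) its Fourier transform in $\mathcal{S}'(\mathbb{R})$ is a tempered non-negative function $h$, with $h^2$ tempered; (b) $f=\kappa*\tilde\kappa$, $\tilde\kappa(x)=\kappa(-x)$, is a continuous, symmetric, tempered function (with Fourier transform $h^2$); (c) $\kappa(x)<\infty$ and $f(x)<\infty$ for all $x\ne0$. **Assumption B.** Either (i) $\kappa\in L^1(\mathbb{R})$; or (ii) $\kappa=R_{1,\alpha/2}$ for some $\alpha\in(0,1)$, where for $a\in(0,1)$, $R_{1,a}(x)=C_{1,a}|x|^{-(1-a)}$, $C_{1,a}=\pi^{-1/2}2^{-a}\Gamma(\frac{1-a}{2})/\Gamma(\frac a2)$. **Malliavin derivative.** $\mathcal{H}=L^2(\mathbf{Z},\mathfrak{m})$; $I_n$ is the multiple integral of order $n$ with respect to $\widehat N$. Any $F\in L^2(\Omega)$ measurable with respect to $N$ has a unique expansion $F=\mathbb{E}(F)+\sum_{n\ge1}I_n(f_n)$ with $f_n\in\mathcal{H}^{\otimes n}$ symmetric. $F\in\mathrm{dom}(D)$ means $\sum_{n\ge1}n\,n!\|f_n\|^2_{\mathcal{H}^{\otimes n}}<\infty$, in which case $D_\xi F=\sum_{n\ge1}nI_{n-1}(f_n(\cdot,\xi))$, $\xi\in\mathbf{Z}$. *)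

theory Defs
  imports "HOL-Probability.Probability"
begin

(* The L2 norm takes the value \<infinity> on functions that are not square-integrable; a Bochner
   integral would silently be 0 there. *)
definition l2norm :: "'a measure \<Rightarrow> ('a \<Rightarrow> real) \<Rightarrow> ennreal" where
  "l2norm M X =
    (let I = (\<integral>\<^sup>+\<omega>. ennreal ((X \<omega>)\<^sup>2) \<partial>M) in if I = \<infinity> then \<infinity> else ennreal (sqrt (enn2real I)))"

definition square_integrable :: "'a measure \<Rightarrow> ('a \<Rightarrow> real) \<Rightarrow> bool" where
  "square_integrable M X \<longleftrightarrow> X \<in> borel_measurable M \<and> l2norm M X < \<infinity>"

text \<open>
  A measure on \<open>\<real> \<setminus> {0}\<close> is a measure \<open>\<nu>\<close> over the trace of the Borel \<open>\<sigma>\<close>-field on \<open>- {0}\<close>.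
  Points of the space \<open>\<real>\<^sub>+ \<times> \<real> \<times> (\<real> \<setminus> {0})\<close> are triples \<open>(t, x, z)\<close>.
\<close>

definition noise_intensity :: "real measure \<Rightarrow> (real \<times> real \<times> real) measure" where
  "noise_intensity \<nu> = restrict_space lborel {0..} \<Otimes>\<^sub>M (lborel \<Otimes>\<^sub>M \<nu>)"

definition poisson_random_measure :: "'w measure \<Rightarrow> 'a measure \<Rightarrow> ('w \<Rightarrow> 'a measure) \<Rightarrow> bool" where
  "poisson_random_measure M \<mu> N \<longleftrightarrow>
     (\<forall>\<omega>\<in>space M. sets (N \<omega>) = sets \<mu>) \<and>
     (\<forall>A\<in>sets \<mu>. (\<lambda>\<omega>. emeasure (N \<omega>) A) \<in> borel_measurable M) \<and>
     (\<forall>A\<in>sets \<mu>. emeasure \<mu> A < \<infinity> \<longrightarrow>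
        (\<forall>k::nat. measure M {\<omega>\<in>space M. emeasure (N \<omega>) A = of_nat k} =
                  measure \<mu> A ^ k / fact k * exp (- measure \<mu> A))) \<and>
     (\<forall>A\<in>sets \<mu>. emeasure \<mu> A = \<infinity> \<longrightarrow> (AE \<omega> in M. emeasure (N \<omega>) A = \<infinity>)) \<and>
     (\<forall>(n::nat) A. (\<forall>i<n. A i \<in> sets \<mu>) \<and> disjoint_family_on A {..<n} \<longrightarrow>
        prob_space.indep_vars M (\<lambda>_. borel) (\<lambda>i \<omega>. emeasure (N \<omega>) (A i)) {..<n})"

(* A set B of non-zero reals is bounded for the distance |1/x - 1/y| iff its image under
   inversion is bounded in the usual sense. *)
definition noise_filtration ::
  "'w measure \<Rightarrow> ('w \<Rightarrow> (real \<times> real \<times> real) measure) \<Rightarrow> real \<Rightarrow> 'w measure" where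
  "noise_filtration M N t = sigma (space M)
     ({{\<omega>\<in>space M. emeasure (N \<omega>) ({0..s} \<times> A \<times> B) \<in> E} | s A B E.
         0 \<le> s \<and> s \<le> t \<and> A \<in> sets borel \<and> bounded A \<and>
         B \<in> sets borel \<and> B \<subseteq> - {0} \<and> bounded (inverse ` B) \<and> E \<in> sets (borel :: ennreal measure)}
      \<union> null_sets M)"

text \<open>
  Elements of the \<open>n\<close>-th tensor power of \<open>L\<^sup>2(\<mu>)\<close> are square-integrable functions for the product
  measure on \<open>{..<n} \<rightarrow>\<^sub>E space \<mu>\<close>.  As usual, the multiple integral is given explicitly on step
  functions \<open>\<Sum>\<^sub>j c\<^sub>j 1(A\<^sub>j\<^sub>0 \<times> \<dots>)\<close> that vanish on the diagonals, with pairwise disjoint sets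
  \<open>A\<^sub>i\<close> of finite measure and \<open>j\<close> ranging over the injective multi-indices, and is extended by
  \<open>L\<^sup>2\<close>-continuity.  The operators take values in \<open>L\<^sup>2(\<Omega>)\<close>, so they are formalized as relations
  between a kernel and the random variables representing its image.
\<close>

abbreviation tensor_measure :: "'a measure \<Rightarrow> nat \<Rightarrow> (nat \<Rightarrow> 'a) measure" where
  "tensor_measure \<mu> n \<equiv> PiM {..<n} (\<lambda>_. \<mu>)"

definition injective_indices :: "nat \<Rightarrow> nat \<Rightarrow> (nat \<Rightarrow> nat) set" where
  "injective_indices n p = {j \<in> {..<n} \<rightarrow>\<^sub>E {..<p}. inj_on j {..<n}}"

definition step_kernel ::
  "nat \<Rightarrow> nat \<Rightarrow> (nat \<Rightarrow> 'a set) \<Rightarrow> ((nat \<Rightarrow> nat) \<Rightarrow> real) \<Rightarrow> (nat \<Rightarrow> 'a) \<Rightarrow> real" where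
  "step_kernel n p A c x = (\<Sum>j\<in>injective_indices n p. c j * (\<Prod>i<n. indicator (A (j i)) (x i)))"

definition compensated :: "'a measure \<Rightarrow> ('w \<Rightarrow> 'a measure) \<Rightarrow> 'a set \<Rightarrow> 'w \<Rightarrow> real" where
  "compensated \<mu> N A \<omega> = measure (N \<omega>) A - measure \<mu> A"

definition step_integral ::
  "'a measure \<Rightarrow> ('w \<Rightarrow> 'a measure) \<Rightarrow> nat \<Rightarrow> nat \<Rightarrow> (nat \<Rightarrow> 'a set) \<Rightarrow> ((nat \<Rightarrow> nat) \<Rightarrow> real) \<Rightarrow> 'w \<Rightarrow> real"
  where
  "step_integral \<mu> N n p A c \<omega> =
     (\<Sum>j\<in>injective_indices n p. c j * (\<Prod>i<n. compensated \<mu> N (A (j i)) \<omega>))"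

definition is_multiple_integral ::
  "'w measure \<Rightarrow> 'a measure \<Rightarrow> ('w \<Rightarrow> 'a measure) \<Rightarrow> nat \<Rightarrow> ((nat \<Rightarrow> 'a) \<Rightarrow> real) \<Rightarrow> ('w \<Rightarrow> real) \<Rightarrow> bool"
  where
  "is_multiple_integral M \<mu> N n f X \<longleftrightarrow>
     square_integrable (tensor_measure \<mu> n) f \<and> square_integrable M X \<and>
     (\<exists>p A c.
        (\<forall>k. (\<forall>i<p k. A k i \<in> sets \<mu> \<and> emeasure \<mu> (A k i) < \<infinity>) \<and>
             disjoint_family_on (A k) {..<p k}) \<and>
        (\<lambda>k. l2norm (tensor_measure \<mu> n) (\<lambda>x. f x - step_kernel n (p k) (A k) (c k) x)) \<longlonglongrightarrow> 0 \<and>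
        (\<lambda>k. l2norm M (\<lambda>\<omega>. X \<omega> - step_integral \<mu> N n (p k) (A k) (c k) \<omega>)) \<longlonglongrightarrow> 0)"

definition symmetric_kernel :: "'a measure \<Rightarrow> nat \<Rightarrow> ((nat \<Rightarrow> 'a) \<Rightarrow> real) \<Rightarrow> bool" where
  "symmetric_kernel \<mu> n f \<longleftrightarrow>
     (\<forall>\<pi>. \<pi> permutes {..<n} \<longrightarrow>
        (AE x in tensor_measure \<mu> n. f (\<lambda>i\<in>{..<n}. x (\<pi> i)) = f x))"

definition chaos_expansion ::
  "'w measure \<Rightarrow> 'a measure \<Rightarrow> ('w \<Rightarrow> 'a measure) \<Rightarrow> ('w \<Rightarrow> real) \<Rightarrow> (nat \<Rightarrow> (nat \<Rightarrow> 'a) \<Rightarrow> real) \<Rightarrow> bool"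
  where
  "chaos_expansion M \<mu> N F f \<longleftrightarrow>
     (\<forall>n\<ge>1. square_integrable (tensor_measure \<mu> n) (f n) \<and> symmetric_kernel \<mu> n (f n)) \<and>
     (\<exists>J. (\<forall>n\<ge>1. is_multiple_integral M \<mu> N n (f n) (J n)) \<and>
          (\<lambda>m. l2norm M (\<lambda>\<omega>. F \<omega> - (integral\<^sup>L M F + (\<Sum>n=1..m. J n \<omega>)))) \<longlonglongrightarrow> 0)"

definition dom_kernels ::
  "'w measure \<Rightarrow> 'a measure \<Rightarrow> ('w \<Rightarrow> 'a measure) \<Rightarrow> ('w \<Rightarrow> real) \<Rightarrow> (nat \<Rightarrow> (nat \<Rightarrow> 'a) \<Rightarrow> real) \<Rightarrow> bool"
  where
  "dom_kernels M \<mu> N F f \<longleftrightarrow>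
     square_integrable M F \<and> chaos_expansion M \<mu> N F f \<and>
     (\<Sum>n. of_nat (n * fact n) * (l2norm (tensor_measure \<mu> n) (f n))\<^sup>2) < (\<infinity>::ennreal)"

(* Measurability of F with respect to N, up to null sets, is implied by the expansion. *)
definition malliavin_dom ::
  "'w measure \<Rightarrow> 'a measure \<Rightarrow> ('w \<Rightarrow> 'a measure) \<Rightarrow> ('w \<Rightarrow> real) set" where
  "malliavin_dom M \<mu> N = {F. \<exists>f. dom_kernels M \<mu> N F f}"

text \<open>
  \<open>D\<close> is a version of the Malliavin derivative of \<open>F\<close>: the kernels \<open>f n\<close> are determined only up to
  null sets, hence so is \<open>\<xi> \<mapsto> D \<xi>\<close>.  The slice \<open>f\<^sub>n(\<cdot>, \<xi>)\<close> fixes the last coordinate, which has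
  index \<open>n - 1\<close>.
\<close>

definition is_malliavin_derivative ::
  "'w measure \<Rightarrow> 'a measure \<Rightarrow> ('w \<Rightarrow> 'a measure) \<Rightarrow> ('w \<Rightarrow> real) \<Rightarrow> ('a \<Rightarrow> 'w \<Rightarrow> real) \<Rightarrow> bool" where
  "is_malliavin_derivative M \<mu> N F D \<longleftrightarrow>
     (\<exists>f. dom_kernels M \<mu> N F f \<and>
       (AE \<xi> in \<mu>. square_integrable M (D \<xi>) \<and>
          (\<exists>J. (\<forall>n\<ge>1. is_multiple_integral M \<mu> N (n - 1) (\<lambda>x. f n (x(n - 1 := \<xi>))) (J n)) \<and>
               (\<lambda>m. l2norm M (\<lambda>\<omega>. D \<xi> \<omega> - (\<Sum>n=1..m. real n * J n \<omega>))) \<longlonglongrightarrow> 0)))"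

text \<open>
  The Fourier transform of \<open>\<phi>\<close> is \<open>\<integral> e\<^sup>-\<^sup>i\<^sup>\<xi>\<^sup>x \<phi>(x) dx\<close>, the convention for which \<open>R\<^sub>1\<^sub>,\<^sub>a\<close> below has
  Fourier transform \<open>\<bar>\<xi>\<bar> powr (-a)\<close>.
\<close>

definition schwartz :: "(real \<Rightarrow> complex) \<Rightarrow> bool" where
  "schwartz \<phi> \<longleftrightarrow>
     (\<exists>\<psi> :: nat \<Rightarrow> real \<Rightarrow> complex. \<psi> 0 = \<phi> \<and>
        (\<forall>j x. (\<psi> j has_vector_derivative \<psi> (Suc j) x) (at x)) \<and>
        (\<forall>j k. \<exists>B. \<forall>x. \<bar>x\<bar> ^ k * norm (\<psi> j x) \<le> B))"

definition fourier :: "(real \<Rightarrow> complex) \<Rightarrow> real \<Rightarrow> complex" where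
  "fourier \<phi> \<xi> = (\<integral>x. cis (- (\<xi> * x)) * \<phi> x \<partial>lborel)"

definition tempered :: "(real \<Rightarrow> ennreal) \<Rightarrow> bool" where
  "tempered g \<longleftrightarrow> g \<in> borel_measurable borel \<and>
     (\<exists>k>0. (\<integral>\<^sup>+x. g x * ennreal ((1 + x\<^sup>2) powr (- k)) \<partial>lborel) < \<infinity>)"

(* For tempered g the distribution is phi |-> integral of g * phi; such a g is finite almost
   everywhere, so enn2real only changes it on a null set. *)
definition has_fourier_transform :: "(real \<Rightarrow> ennreal) \<Rightarrow> (real \<Rightarrow> real) \<Rightarrow> bool" where
  "has_fourier_transform g h \<longleftrightarrow>
     (\<forall>\<phi>. schwartz \<phi> \<longrightarrow>
        (\<integral>x. enn2real (g x) *\<^sub>R fourier \<phi> x \<partial>lborel) = (\<integral>\<xi>. h \<xi> *\<^sub>R \<phi> \<xi> \<partial>lborel))"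

definition self_convolution :: "(real \<Rightarrow> ennreal) \<Rightarrow> real \<Rightarrow> ennreal" where
  "self_convolution \<kappa> x = (\<integral>\<^sup>+y. \<kappa> (x - y) * \<kappa> (- y) \<partial>lborel)"

definition assumption_A :: "(real \<Rightarrow> ennreal) \<Rightarrow> bool" where
  "assumption_A \<kappa> \<longleftrightarrow>
     continuous_on UNIV \<kappa> \<and> (\<forall>x. \<kappa> (- x) = \<kappa> x) \<and> tempered \<kappa> \<and>
     (\<exists>h :: real \<Rightarrow> real.
        (\<forall>\<xi>. 0 \<le> h \<xi>) \<and> tempered (\<lambda>\<xi>. ennreal (h \<xi>)) \<and> tempered (\<lambda>\<xi>. ennreal ((h \<xi>)\<^sup>2)) \<and>
        has_fourier_transform \<kappa> h \<and>
        has_fourier_transform (self_convolution \<kappa>) (\<lambda>\<xi>. (h \<xi>)\<^sup>2)) \<and>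
     continuous_on UNIV (self_convolution \<kappa>) \<and>
     (\<forall>x. self_convolution \<kappa> (- x) = self_convolution \<kappa> x) \<and>
     tempered (self_convolution \<kappa>) \<and>
     (\<forall>x. x \<noteq> 0 \<longrightarrow> \<kappa> x < \<infinity> \<and> self_convolution \<kappa> x < \<infinity>)"

(* The value at 0 is \<infinity>, where powr would give 0. *)
definition riesz_kernel :: "real \<Rightarrow> real \<Rightarrow> ennreal" where
  "riesz_kernel a x =
     (if x = 0 then \<infinity>
      else ennreal (pi powr (- 1/2) * 2 powr (- a) * Gamma ((1 - a) / 2) / Gamma (a / 2)
                    * \<bar>x\<bar> powr (- (1 - a))))"

definition assumption_B :: "(real \<Rightarrow> ennreal) \<Rightarrow> bool" where
  "assumption_B \<kappa> \<longleftrightarrow>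
     (\<kappa> \<in> borel_measurable borel \<and> (\<integral>\<^sup>+x. \<kappa> x \<partial>lborel) < \<infinity>) \<or>
     (\<exists>\<alpha>. 0 < \<alpha> \<and> \<alpha> < 1 \<and> \<kappa> = riesz_kernel (\<alpha> / 2))"

definition wave_kernel :: "real \<Rightarrow> real \<Rightarrow> real" where
  "wave_kernel t x = (if \<bar>x\<bar> < t then 1/2 else 0)"

definition strictly_stationary :: "'w measure \<Rightarrow> (real \<Rightarrow> 'w \<Rightarrow> real) \<Rightarrow> bool" where
  "strictly_stationary M X \<longleftrightarrow>
     (\<forall>I y. finite I \<longrightarrow>
        distr M (PiM I (\<lambda>_. borel)) (\<lambda>\<omega>. \<lambda>x\<in>I. X (x + y) \<omega>) =
        distr M (PiM I (\<lambda>_. borel)) (\<lambda>\<omega>. \<lambda>x\<in>I. X x \<omega>))"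

text \<open>
  Triviality of the \<open>\<sigma>\<close>-field of shift-invariant path events.  Invariance has to be understood up
  to null sets: an event of the product \<open>\<sigma>\<close>-field depends on countably many coordinates only, so
  the only such events that are pointwise invariant under all real shifts are the empty set and
  the whole space.
\<close>

definition ergodic_field :: "'w measure \<Rightarrow> (real \<Rightarrow> 'w \<Rightarrow> real) \<Rightarrow> bool" where
  "ergodic_field M X \<longleftrightarrow>
     (\<forall>B\<in>sets (PiM (UNIV :: real set) (\<lambda>_. borel :: real measure)).
        (\<forall>y. AE \<omega> in M. (\<lambda>x. X (x + y) \<omega>) \<in> B \<longleftrightarrow> (\<lambda>x. X x \<omega>) \<in> B) \<longrightarrow>
        measure M {\<omega>\<in>space M. (\<lambda>x. X x \<omega>) \<in> B} \<in> {0, 1})"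

end

theory Submission
  imports Defs
begin

text \<open>
  The chain rule for the Malliavin derivative is avoided: the field is approximated in \<open>L\<^sup>2\<close> by
  functionals of the noise near a point.  Let \<open>F = Z(t, x)\<close> have kernels \<open>f\<^sub>n\<close>, let \<open>V = [0, t] \<times> \<real> \<times> \<real>\<^sub>0\<close>
  and let \<open>W \<subseteq> V\<close> be the window \<open>\<bar>y - x\<bar> \<le> R\<close>.  Restricting the kernels to \<open>W\<close> changes \<open>F\<close> by at most
  \<open>\<Sum> n! \<parallel>f\<^sub>n (1\<^sub>V\<^sup>\<otimes>\<^sup>n - 1\<^sub>W\<^sup>\<otimes>\<^sup>n)\<parallel>\<^sup>2 \<le> \<Sum> n n! \<integral>\<^bsub>V-W\<^esub> \<parallel>f\<^sub>n(\<cdot>, \<xi>)\<parallel>\<^sup>2 d\<xi> = \<integral>\<^bsub>V-W\<^esub> \<parallel>D\<^sub>\<xi> F\<parallel>\<^sup>2 d\<xi>\<close>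
  in squared norm, and the bound on the derivative makes this tend to \<open>0\<close> as \<open>R \<rightarrow> \<infinity>\<close>, uniformly in \<open>x\<close>,
  because \<open>G\<^sub>t * \<kappa>\<close> is in \<open>L\<^sup>2\<close> when \<open>\<kappa> * \<kappa>\<close> is locally integrable.  Noise in disjoint windows is
  independent, so by stationarity every path event is asymptotically independent of its far shifts; an
  invariant event thus satisfies \<open>P(E) = P(E)\<^sup>2\<close>.

  Only the limit matters, hence the crude constants: \<open>\<parallel>X + Y\<parallel>\<^sup>2 \<le> 2 \<parallel>X\<parallel>\<^sup>2 + 2 \<parallel>Y\<parallel>\<^sup>2\<close>
  replaces Minkowski's inequality.
\<close>

section \<open>Moments and independence of the Poisson counts\<close>

text \<open>Two obstacles shape the proof. The derivative bound says nothing about times after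
  \<open>t\<close>, so it gives no control of the kernels there. But \<open>F\<close> is measurable
  for the noise in \<open>V\<close>, and restricting an approximating chaos to \<open>V\<close>
  amounts to conditioning on that noise: this fixes \<open>F\<close> and cannot increase the error.
  Only the passage from \<open>V\<close> to \<open>W\<close> uses the derivative. Secondly, a
  multiple integral is known only through approximating step kernels, which need not be symmetric,
  while the exact isometry with factor \<open>n!\<close> requires symmetry. All estimates are
  therefore made for elementary kernels \<open>g\<close>, whose second moments are finite sums over
  permutations. The upper bound with \<open>n!\<close> holds for every \<open>g\<close>; in the
  lower bound the loss is the failure of \<open>g\<close> to be invariant under permutations, which
  is small because \<open>g\<close> is close to a symmetric kernel. The weights fit together because
  \<open>n * n! = n^2 * (n - 1)!\<close>: one factor \<open>n\<close> counts the coordinates that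
  may lie in \<open>V - W\<close>, and \<open>n^2 * (n - 1)!\<close> is the weight with which the
  slice of \<open>f n\<close> enters the squared norm of the derivative.\<close>

lemma poisson_weights_sums:
  fixes m :: real
  shows "(\<lambda>k. m ^ k / fact k * exp (- m)) sums 1"
    and "(\<lambda>k. real k * (m ^ k / fact k * exp (- m))) sums m"
    and "(\<lambda>k. (real k)\<^sup>2 * (m ^ k / fact k * exp (- m))) sums (m\<^sup>2 + m)"
proof -
  define w where "w k = m ^ k / fact k * exp (- m)" for k :: nat
  have "(\<lambda>k. m ^ k / fact k) sums exp m"
    using exp_converges[of m] by (simp add: divide_inverse mult.commute)
  from sums_mult2[OF this, of "exp (- m)"] have w: "w sums 1"
    by (simp add: w_def[abs_def] exp_minus)
  \<comment> \<open>This recursion reduces each moment to the preceding one by an index shift: the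
    mean to the total mass, the second moment to the mean and the mass.\<close>
  have w_Suc: "real (Suc k) * w (Suc k) = m * w k" for k
    by (simp add: w_def del: of_nat_Suc)
  have "(\<lambda>k. real (Suc k) * w (Suc k)) sums m"
    unfolding w_Suc using sums_mult[OF w, of m] by simp
  then have w1: "(\<lambda>k. real k * w k) sums m"
    by (subst sums_Suc_iff[where f = "\<lambda>k. real k * w k", simplified, symmetric]) simp
  have "(real (Suc k))\<^sup>2 * w (Suc k) = m * (real k * w k) + m * w k" for k
    unfolding power2_eq_square mult.assoc w_Suc by (simp add: algebra_simps)
  moreover have "(\<lambda>k. m * (real k * w k) + m * w k) sums (m * m + m * 1)"
    by (intro sums_add sums_mult w w1)
  ultimately have "(\<lambda>k. (real (Suc k))\<^sup>2 * w (Suc k)) sums (m\<^sup>2 + m)"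
    by (simp add: power2_eq_square)
  then have w2: "(\<lambda>k. (real k)\<^sup>2 * w k) sums (m\<^sup>2 + m)"
    by (subst sums_Suc_iff[where f = "\<lambda>k. (real k)\<^sup>2 * w k", simplified, symmetric]) simp
  show "(\<lambda>k. m ^ k / fact k * exp (- m)) sums 1"
    "(\<lambda>k. real k * (m ^ k / fact k * exp (- m))) sums m"
    "(\<lambda>k. (real k)\<^sup>2 * (m ^ k / fact k * exp (- m))) sums (m\<^sup>2 + m)"
    using w w1 w2 unfolding w_def[abs_def] by simp_all
qed

text \<open>The chaos estimates use no structure of the underlying space beyond sigma-finiteness,
  which provides tensor powers and Tonelli's theorem. The measure is specialized to
  \<open>noise_intensity \<nu>\<close> only in the last section.\<close>

locale poisson_noise = prob_space M + mu: sigma_finite_measure \<mu>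
  for M :: "'w measure" and \<mu> :: "'a measure" +
  fixes N :: "'w \<Rightarrow> 'a measure"
  assumes prm: "poisson_random_measure M \<mu> N"
begin

lemma sets_N: "\<omega> \<in> space M \<Longrightarrow> sets (N \<omega>) = sets \<mu>"
  using prm by (simp add: poisson_random_measure_def)

lemma measurable_N [measurable (raw)]:
  "A \<in> sets \<mu> \<Longrightarrow> (\<lambda>\<omega>. emeasure (N \<omega>) A) \<in> borel_measurable M"
  using prm by (simp add: poisson_random_measure_def)

lemma measurable_compensated [measurable (raw)]:
  "A \<in> sets \<mu> \<Longrightarrow> compensated \<mu> N A \<in> borel_measurable M"
  unfolding compensated_def[abs_def] measure_def
  by (intro borel_measurable_diff measurable_compose[OF measurable_N] borel_measurable_const) auto

lemma indep_vars_N_nat: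
  fixes A :: "nat \<Rightarrow> 'a set"
  assumes "\<forall>i<n. A i \<in> sets \<mu>" "disjoint_family_on A {..<n}"
  shows "indep_vars (\<lambda>_. borel) (\<lambda>i \<omega>. emeasure (N \<omega>) (A i)) {..<n}"
  using prm assms by (simp add: poisson_random_measure_def)

lemma prob_N_eq:
  assumes "A \<in> sets \<mu>" "emeasure \<mu> A < \<infinity>"
  shows "prob {\<omega>\<in>space M. emeasure (N \<omega>) A = of_nat k} =
    measure \<mu> A ^ k / fact k * exp (- measure \<mu> A)"
  using prm assms by (simp add: poisson_random_measure_def)

text \<open>Only the probabilities of the values \<open>k\<close> are prescribed. Since they sum to
  1, every other value, infinity included, is excluded almost surely.\<close>

lemma AE_N_nat:
  assumes A[measurable]: "A \<in> sets \<mu>" and fin: "emeasure \<mu> A < \<infinity>"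
  shows "AE \<omega> in M. \<exists>k::nat. emeasure (N \<omega>) A = of_nat k"
proof -
  let ?E = "\<lambda>k::nat. {\<omega>\<in>space M. emeasure (N \<omega>) A = of_nat k}"
  have "(\<lambda>k. prob (?E k)) sums prob (\<Union>k. ?E k)"
    by (rule finite_measure_UNION) (auto simp: disjoint_family_on_def)
  moreover have "(\<lambda>k. prob (?E k)) sums 1"
    using poisson_weights_sums(1) by (simp add: prob_N_eq[OF A fin])
  ultimately have "prob (\<Union>k. ?E k) = 1"
    by (rule sums_unique2)
  then have "AE \<omega> in M. \<omega> \<in> (\<Union>k. ?E k)"
    by (subst (asm) prob_eq_1) auto
  then show ?thesis by eventually_elim auto
qed

lemma AE_N_finite:
  assumes A: "A \<in> sets \<mu>" and fin: "emeasure \<mu> A < \<infinity>"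
  shows "AE \<omega> in M. emeasure (N \<omega>) A < \<infinity>"
  using AE_N_nat[OF assms] by eventually_elim (auto simp: of_nat_less_top)

text \<open>Nonnegativity of \<open>g\<close> lets the integral be evaluated as a series before any
  integrability is known; integrability of the moments is then read off from the finite
  value.\<close>

lemma nn_integral_N:
  fixes g :: "real \<Rightarrow> real"
  assumes A[measurable]: "A \<in> sets \<mu>" and fin: "emeasure \<mu> A < \<infinity>"
    and g: "\<And>x. 0 \<le> g x"
    and s: "(\<lambda>k. g (real k) * (measure \<mu> A ^ k / fact k * exp (- measure \<mu> A))) sums s"
  shows "(\<integral>\<^sup>+\<omega>. ennreal (g (measure (N \<omega>) A)) \<partial>M) = ennreal s"
proof -
  let ?E = "\<lambda>k::nat. {\<omega>\<in>space M. emeasure (N \<omega>) A = of_nat k}"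
  let ?w = "\<lambda>k. measure \<mu> A ^ k / fact k * exp (- measure \<mu> A)"
  have "(\<integral>\<^sup>+\<omega>. ennreal (g (measure (N \<omega>) A)) \<partial>M) =
      (\<integral>\<^sup>+\<omega>. (\<Sum>k. ennreal (g (real k)) * indicator (?E k) \<omega>) \<partial>M)"
  proof (intro nn_integral_cong_AE)
    show "AE \<omega> in M. ennreal (g (measure (N \<omega>) A)) =
      (\<Sum>k. ennreal (g (real k)) * indicator (?E k) \<omega>)"
      using AE_N_nat[OF A fin] AE_space
    proof eventually_elim
      case (elim \<omega>)
      then obtain k where k: "emeasure (N \<omega>) A = of_nat k" by auto
      have "(\<Sum>j. ennreal (g (real j)) * indicator (?E j) \<omega>) =
        (\<Sum>j. if j = k then ennreal (g (real k)) else 0)"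
        using k elim by (intro suminf_cong) (auto simp: indicator_def)
      also have "\<dots> = ennreal (g (real k))"
        by (subst suminf_finite[of "{k}"]) auto
      also have "real k = measure (N \<omega>) A"
        by (simp add: measure_def k)
      finally show ?case by simp
    qed
  qed
  also have "\<dots> = (\<Sum>k. ennreal (g (real k)) * emeasure M (?E k))"
    by (subst nn_integral_suminf) (auto simp: nn_integral_cmult_indicator)
  also have "\<dots> = (\<Sum>k. ennreal (g (real k) * ?w k))"
    by (simp only: emeasure_eq_measure prob_N_eq[OF A fin] ennreal_mult' g)
  also have "\<dots> = ennreal s"
    using s g by (intro suminf_ennreal_eq) auto
  finally show ?thesis .
qed

lemma compensated_moments:
  assumes A[measurable]: "A \<in> sets \<mu>" and fin: "emeasure \<mu> A < \<infinity>"
  shows "integrable M (compensated \<mu> N A)"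
    and "integrable M (\<lambda>\<omega>. (compensated \<mu> N A \<omega>)\<^sup>2)"
    and "expectation (compensated \<mu> N A) = 0"
    and "expectation (\<lambda>\<omega>. (compensated \<mu> N A \<omega>)\<^sup>2) = measure \<mu> A"
proof -
  let ?m = "measure \<mu> A"
  have [measurable]: "(\<lambda>\<omega>. measure (N \<omega>) A) \<in> borel_measurable M"
    unfolding measure_def by (rule measurable_compose[OF measurable_N]) auto
  \<comment> \<open>\<open>nn_integral_N\<close> wants \<open>g\<close> nonnegative on all reals,
    hence the absolute value, which is the identity on counts.\<close>
  have 1: "(\<integral>\<^sup>+\<omega>. ennreal (measure (N \<omega>) A) \<partial>M) = ennreal ?m"
    using nn_integral_N[OF A fin, where g = "\<lambda>x. \<bar>x\<bar>" and s = ?m] poisson_weights_sums(2)[of ?m]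
    by simp
  have 2: "(\<integral>\<^sup>+\<omega>. ennreal ((measure (N \<omega>) A)\<^sup>2) \<partial>M) = ennreal (?m\<^sup>2 + ?m)"
    using nn_integral_N[OF A fin, where g = "\<lambda>x. x\<^sup>2" and s = "?m\<^sup>2 + ?m"]
      poisson_weights_sums(3)[of ?m] by simp
  have i1: "integrable M (\<lambda>\<omega>. measure (N \<omega>) A)" and e1: "expectation (\<lambda>\<omega>. measure (N \<omega>) A) = ?m"
    using 1 by (auto intro!: integrableI_nn_integral_finite integral_eq_nn_integral[THEN trans])
  have i2: "integrable M (\<lambda>\<omega>. (measure (N \<omega>) A)\<^sup>2)"
    and e2: "expectation (\<lambda>\<omega>. (measure (N \<omega>) A)\<^sup>2) = ?m\<^sup>2 + ?m"
    using 2 by (auto intro!: integrableI_nn_integral_finite[OF _ _ 2] integral_eq_nn_integral[THEN trans] simp del: ennreal_plus)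
  show "integrable M (compensated \<mu> N A)" "expectation (compensated \<mu> N A) = 0"
    using i1 e1 by (simp_all add: compensated_def [abs_def] prob_space)
  have sq: "(compensated \<mu> N A \<omega>)\<^sup>2 = (measure (N \<omega>) A)\<^sup>2 - 2 * ?m * measure (N \<omega>) A + ?m\<^sup>2" for \<omega>
    by (simp add: compensated_def power2_eq_square algebra_simps)
  show "integrable M (\<lambda>\<omega>. (compensated \<mu> N A \<omega>)\<^sup>2)"
    unfolding sq using i1 i2 by simp
  show "expectation (\<lambda>\<omega>. (compensated \<mu> N A \<omega>)\<^sup>2) = ?m"
    unfolding sq using i1 i2 e1 e2 by (simp add: prob_space power2_eq_square)
qed

text \<open>The definition indexes disjoint families by initial segments of the naturals. A
  bijection carries independence over to any finite index set, such as the pairs of indices and the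
  sets of sets used below.\<close>

lemma indep_vars_N:
  assumes "finite I" "\<And>i. i \<in> I \<Longrightarrow> B i \<in> sets \<mu>" "disjoint_family_on B I"
  shows "indep_vars (\<lambda>_. borel) (\<lambda>i \<omega>. emeasure (N \<omega>) (B i)) I"
proof -
  obtain h where h: "bij_betw h {..<card I} I"
    using ex_bij_betw_nat_finite[OF assms(1)] by (auto simp: atLeast0LessThan)
  let ?g = "the_inv_into {..<card I} h"
  have g: "bij_betw ?g I {..<card I}"
    by (rule bij_betw_the_inv_into[OF h])
  have hg: "h (?g i) = i" if "i \<in> I" for i
    using h that by (metis bij_betw_def f_the_inv_into_f)
  have "disjoint_family_on (\<lambda>i. B (h i)) {..<card I}"
    using assms(3) h unfolding disjoint_family_on_def bij_betw_def inj_on_def by blast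
  moreover have "\<forall>i<card I. B (h i) \<in> sets \<mu>"
    using assms(2) h by (auto simp: bij_betw_def)
  ultimately have ind: "indep_vars (\<lambda>_. borel) (\<lambda>i \<omega>. emeasure (N \<omega>) (B (h i))) {..<card I}"
    by (intro indep_vars_N_nat) auto
  show ?thesis
    unfolding indep_vars_def2
  proof (intro conjI ballI indep_setsI)
    show "(\<lambda>\<omega>. emeasure (N \<omega>) (B i)) \<in> borel_measurable M" if "i \<in> I" for i
      using assms(2) that by measurable
    then show "{(\<lambda>\<omega>. emeasure (N \<omega>) (B i)) -` A \<inter> space M |A. A \<in> sets borel} \<subseteq> events"
      if "i \<in> I" for i using that by (auto intro: measurable_sets)
    fix A J
    assume J: "J \<noteq> {}" "J \<subseteq> I" "finite J"
      and A: "\<forall>j\<in>J. A j \<in> {(\<lambda>\<omega>. emeasure (N \<omega>) (B j)) -` A \<inter> space M |A. A \<in> sets borel}"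
    have inj: "inj_on ?g J"
      using g J(2) by (auto simp: bij_betw_def intro: inj_on_subset)
    have "prob (\<Inter>k\<in>?g ` J. A (h k)) = (\<Prod>k\<in>?g ` J. prob (A (h k)))"
      using ind unfolding indep_vars_def2
    proof (elim conjE, intro indep_setsD)
      show "?g ` J \<subseteq> {..<card I}" using g J(2) by (auto simp: bij_betw_def)
      show "\<forall>j\<in>?g ` J. A (h j) \<in>
        {(\<lambda>\<omega>. emeasure (N \<omega>) (B (h j))) -` A \<inter> space M |A. A \<in> sets borel}"
        using A J(2) hg by (auto simp: subset_iff)
    qed (use J in auto)
    moreover have "(\<Inter>k\<in>?g ` J. A (h k)) = (\<Inter>j\<in>J. A j)"
      using hg J(2) by (auto simp: subset_iff)
    moreover have "(\<Prod>k\<in>?g ` J. prob (A (h k))) = (\<Prod>j\<in>J. prob (A j))"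
      using hg J(2) by (subst prod.reindex[OF inj]) (auto intro!: prod.cong simp: subset_iff)
    ultimately show "prob (\<Inter>j\<in>J. A j) = (\<Prod>j\<in>J. prob (A j))" by simp
  qed
qed

lemma indep_vars_compensated:
  assumes "finite I" "\<And>i. i \<in> I \<Longrightarrow> B i \<in> sets \<mu>" "disjoint_family_on B I"
  shows "indep_vars (\<lambda>_. borel) (\<lambda>i. compensated \<mu> N (B i)) I"
proof -
  have "indep_vars (\<lambda>_. borel)
      (\<lambda>i \<omega>. (\<lambda>x. enn2real x - measure \<mu> (B i)) (emeasure (N \<omega>) (B i))) I"
    by (rule indep_vars_compose2[OF indep_vars_N[OF assms]]) measurable
  then show ?thesis
    by (simp add: compensated_def[abs_def] measure_def)
qed

text \<open>In the merged product each factor has exponent 1 or 2, according to the number of the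
  sets \<open>T\<close>, \<open>T'\<close> that contain its index. By independence a single exponent
  1 makes the mean vanish; if all exponents are 2, the variances multiply.\<close>

lemma expectation_prod_compensated:
  assumes fin: "finite T" "finite T'"
    and B: "\<And>i. i \<in> T \<union> T' \<Longrightarrow> B i \<in> sets \<mu> \<and> emeasure \<mu> (B i) < \<infinity>"
    and disj: "disjoint_family_on B (T \<union> T')"
  shows "integrable M (\<lambda>\<omega>. (\<Prod>i\<in>T. compensated \<mu> N (B i) \<omega>) * (\<Prod>i\<in>T'. compensated \<mu> N (B i) \<omega>))"
    and "expectation (\<lambda>\<omega>. (\<Prod>i\<in>T. compensated \<mu> N (B i) \<omega>) * (\<Prod>i\<in>T'. compensated \<mu> N (B i) \<omega>)) =
      (if T = T' then (\<Prod>i\<in>T. measure \<mu> (B i)) else 0)"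
proof -
  let ?X = "\<lambda>i. compensated \<mu> N (B i)"
  let ?p = "\<lambda>i. of_bool (i \<in> T) + of_bool (i \<in> T') :: nat"
  have ind: "indep_vars (\<lambda>_. borel) (\<lambda>i \<omega>. ?X i \<omega> ^ ?p i) (T \<union> T')"
    by (rule indep_vars_compose2[OF indep_vars_compensated, where Y = "\<lambda>i x. x ^ ?p i"])
      (use assms in auto)
  have int: "integrable M (\<lambda>\<omega>. ?X i \<omega> ^ ?p i)" if "i \<in> T \<union> T'" for i
    using that B[OF that] compensated_moments(1,2)[of "B i"] by (auto simp: of_bool_def power2_eq_square)
  have eq: "(\<Prod>i\<in>T. ?X i \<omega>) * (\<Prod>i\<in>T'. ?X i \<omega>) = (\<Prod>i\<in>T \<union> T'. ?X i \<omega> ^ ?p i)" for \<omega>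
  proof -
    have "(\<Prod>i\<in>T. ?X i \<omega>) = (\<Prod>i\<in>T \<union> T'. ?X i \<omega> ^ of_bool (i \<in> T))"
      using fin by (intro prod.mono_neutral_cong_left) auto
    moreover have "(\<Prod>i\<in>T'. ?X i \<omega>) = (\<Prod>i\<in>T \<union> T'. ?X i \<omega> ^ of_bool (i \<in> T'))"
      using fin by (intro prod.mono_neutral_cong_left) auto
    ultimately show ?thesis
      by (simp only: prod.distrib[symmetric] power_add)
  qed
  show "integrable M (\<lambda>\<omega>. (\<Prod>i\<in>T. ?X i \<omega>) * (\<Prod>i\<in>T'. ?X i \<omega>))"
    unfolding eq by (rule indep_vars_integrable[OF _ ind int]) (use fin in auto)
  have "expectation (\<lambda>\<omega>. (\<Prod>i\<in>T. ?X i \<omega>) * (\<Prod>i\<in>T'. ?X i \<omega>)) =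
      (\<Prod>i\<in>T \<union> T'. expectation (\<lambda>\<omega>. ?X i \<omega> ^ ?p i))"
    unfolding eq by (rule indep_vars_lebesgue_integral[OF _ ind int]) (use fin in auto)
  also have "\<dots> = (if T = T' then (\<Prod>i\<in>T. measure \<mu> (B i)) else 0)"
  proof (cases "T = T'")
    case True
    have "expectation (\<lambda>\<omega>. ?X i \<omega> ^ ?p i) = measure \<mu> (B i)" if "i \<in> T'" for i
      using B[of i] that True compensated_moments(4)[of "B i"] by (simp add: power2_eq_square)
    then show ?thesis using True by simp
  next
    case False
    then obtain i where i: "i \<in> T \<union> T'" "\<not> (i \<in> T \<and> i \<in> T')" by blast
    then have "expectation (\<lambda>\<omega>. ?X i \<omega> ^ ?p i) = 0"
      using B[OF i(1)] compensated_moments(3)[of "B i"] by auto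
    then show ?thesis
      using prod_zero[OF finite_UnI[OF fin] bexI[OF _ i(1)]] False by simp
  qed
  finally show "expectation (\<lambda>\<omega>. (\<Prod>i\<in>T. ?X i \<omega>) * (\<Prod>i\<in>T'. ?X i \<omega>)) =
      (if T = T' then (\<Prod>i\<in>T. measure \<mu> (B i)) else 0)" .
qed

end

section \<open>Covariances of products of compensated counts\<close>

lemma permutes_restrict_eq_iff:
  assumes "\<pi> permutes S" "\<rho> permutes S"
  shows "restrict \<pi> S = restrict \<rho> S \<longleftrightarrow> \<pi> = \<rho>"
proof
  assume *: "restrict \<pi> S = restrict \<rho> S"
  show "\<pi> = \<rho>"
  proof
    fix x show "\<pi> x = \<rho> x"
      using fun_cong[OF *, of x] assms by (cases "x \<in> S") (auto simp: permutes_not_in)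
  qed
qed simp

text \<open>The maps record choices of atoms in the expansion of two products; the values
  \<open>n'\<close> and \<open>n\<close> are the extra indices for the complements. Equality of the
  two sets of pairs makes \<open>\<phi>\<close> and \<open>\<psi>\<close> inverse to each other, so
  the extra values are never taken.\<close>

lemma graph_eq_transposed_graph_permutes:
  fixes \<phi> \<psi> :: "nat \<Rightarrow> nat"
  assumes \<phi>: "\<phi> \<in> {..<n} \<rightarrow>\<^sub>E {..n'}" and \<psi>: "\<psi> \<in> {..<n'} \<rightarrow>\<^sub>E {..n}"
    and eq: "(\<lambda>i. (i, \<phi> i)) ` {..<n} = (\<lambda>k. (\<psi> k, k)) ` {..<n'}"
  shows "n = n'" and "\<exists>\<pi>. \<pi> permutes {..<n} \<and> \<phi> = restrict \<pi> {..<n} \<and> \<psi> = restrict (inv \<pi>) {..<n}"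
proof -
  have 1: "\<phi> i < n' \<and> \<psi> (\<phi> i) = i" if "i < n" for i
  proof -
    have "(i, \<phi> i) \<in> (\<lambda>k. (\<psi> k, k)) ` {..<n'}" using that eq by blast
    then show ?thesis by auto
  qed
  have 2: "\<psi> k < n \<and> \<phi> (\<psi> k) = k" if "k < n'" for k
  proof -
    have "(\<psi> k, k) \<in> (\<lambda>i. (i, \<phi> i)) ` {..<n}" using that eq by blast
    then show ?thesis by auto
  qed
  have bij: "bij_betw \<phi> {..<n} {..<n'}"
    by (rule bij_betw_byWitness[where f' = \<psi>]) (use 1 2 in auto)
  then show nn: "n = n'" using bij_betw_same_card by fastforce
  define \<pi> where "\<pi> i = (if i < n then \<phi> i else i)" for i
  have "bij_betw \<pi> {..<n} {..<n}"
    using bij by (subst bij_betw_cong[where g = \<phi>]) (auto simp: \<pi>_def nn)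
  then have p: "\<pi> permutes {..<n}"
    by (rule bij_imp_permutes) (auto simp: \<pi>_def)
  moreover have "\<phi> = restrict \<pi> {..<n}"
    using \<phi> by (auto simp: \<pi>_def fun_eq_iff restrict_def PiE_def extensional_def)
  moreover have "\<psi> k = restrict (inv \<pi>) {..<n} k" for k
  proof (cases "k < n")
    case True
    then have "inv \<pi> k = \<psi> k"
      unfolding permutes_inv_eq[OF p] using 2[of k] nn by (simp add: \<pi>_def)
    with True show ?thesis by simp
  qed (use \<psi> nn in \<open>auto simp: PiE_def extensional_def\<close>)
  ultimately show "\<exists>\<pi>. \<pi> permutes {..<n} \<and> \<phi> = restrict \<pi> {..<n} \<and> \<psi> = restrict (inv \<pi>) {..<n}"
    by blast
qed

text \<open>By the preceding lemma only the pairs formed by a permutation and its inverse survive.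
  This turns the orthogonality of products over atoms into the sum over permutations in the
  isometry.\<close>

lemma sum_transposed_graphs:
  fixes m :: "nat \<times> nat \<Rightarrow> real"
  shows "(\<Sum>\<phi>\<in>{..<n} \<rightarrow>\<^sub>E {..n'}. \<Sum>\<psi>\<in>{..<n'} \<rightarrow>\<^sub>E {..n}.
      if (\<lambda>i. (i, \<phi> i)) ` {..<n} = (\<lambda>k. (\<psi> k, k)) ` {..<n'}
      then \<Prod>p\<in>(\<lambda>i. (i, \<phi> i)) ` {..<n}. m p else 0) =
    (if n = n' then \<Sum>\<pi> | \<pi> permutes {..<n}. \<Prod>i<n. m (i, \<pi> i) else 0)"
    (is "(\<Sum>\<phi>\<in>?A. \<Sum>\<psi>\<in>?B. ?f \<phi> \<psi>) = _")
proof -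
  have fin: "finite (?A \<times> ?B)" by (intro finite_cartesian_product finite_PiE) auto
  have lhs: "(\<Sum>\<phi>\<in>?A. \<Sum>\<psi>\<in>?B. ?f \<phi> \<psi>) = (\<Sum>p\<in>?A \<times> ?B. ?f (fst p) (snd p))"
    by (simp add: sum.cartesian_product split_beta)
  show ?thesis
  proof (cases "n = n'")
    case False
    have "?f \<phi> \<psi> = 0" if "\<phi> \<in> ?A" "\<psi> \<in> ?B" for \<phi> \<psi>
      using graph_eq_transposed_graph_permutes(1)[OF that] False by auto
    then show ?thesis using False by simp
  next
    case True
    let ?P = "{\<pi>. \<pi> permutes {..<n}}"
    let ?h = "\<lambda>\<pi>. (restrict \<pi> {..<n}, restrict (inv \<pi>) {..<n})"
    have inj: "inj_on ?h ?P"
      by (auto intro!: inj_onI simp: permutes_restrict_eq_iff)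
    have sub: "?h ` ?P \<subseteq> ?A \<times> ?B"
    proof (intro image_subsetI SigmaI)
      fix \<pi> assume "\<pi> \<in> ?P"
      then have p: "\<pi> permutes {..<n}" by simp
      show "restrict \<pi> {..<n} \<in> ?A"
        using permutes_in_image[OF p] True by (auto intro!: restrict_PiE_iff[THEN iffD2] less_imp_le)
      show "restrict (inv \<pi>) {..<n} \<in> ?B"
        using permutes_in_image[OF permutes_inv[OF p]] True
        by (auto intro!: restrict_PiE_iff[THEN iffD2] less_imp_le)
    qed
    have "(\<Sum>p\<in>?A \<times> ?B. ?f (fst p) (snd p)) = (\<Sum>p\<in>?h ` ?P. ?f (fst p) (snd p))"
    proof (rule sum.mono_neutral_right[OF fin sub], safe)
      fix \<phi> \<psi> assume *: "\<phi> \<in> ?A" "\<psi> \<in> ?B" "(\<phi>, \<psi>) \<notin> ?h ` ?P"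
      show "?f (fst (\<phi>, \<psi>)) (snd (\<phi>, \<psi>)) = 0"
        using graph_eq_transposed_graph_permutes(2)[OF *(1,2)] *(3) by auto
    qed
    also have "\<dots> = (\<Sum>\<pi>\<in>?P. ?f (restrict \<pi> {..<n}) (restrict (inv \<pi>) {..<n}))"
      by (simp only: sum.reindex[OF inj] comp_def fst_conv snd_conv)
    also have "\<dots> = (\<Sum>\<pi>\<in>?P. \<Prod>i<n. m (i, \<pi> i))"
    proof (rule sum.cong[OF refl], clarify)
      fix \<pi> assume p: "\<pi> permutes {..<n}"
      have "(\<lambda>i. (i, restrict \<pi> {..<n} i)) ` {..<n} = (\<lambda>k. (restrict (inv \<pi>) {..<n} k, k)) ` {..<n'}"
      proof (intro equalityI subsetI)
        fix q assume "q \<in> (\<lambda>i. (i, restrict \<pi> {..<n} i)) ` {..<n}"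
        then obtain i where "i < n" "q = (i, \<pi> i)" by auto
        then show "q \<in> (\<lambda>k. (restrict (inv \<pi>) {..<n} k, k)) ` {..<n'}"
          using permutes_in_image[OF p] permutes_inverses[OF p] True
          by (intro image_eqI[of _ _ "\<pi> i"]) auto
      next
        fix q assume "q \<in> (\<lambda>k. (restrict (inv \<pi>) {..<n} k, k)) ` {..<n'}"
        then obtain i where "i < n" "q = (inv \<pi> i, i)" using True by auto
        then show "q \<in> (\<lambda>i. (i, restrict \<pi> {..<n} i)) ` {..<n}"
          using permutes_in_image[OF permutes_inv[OF p]] permutes_inverses[OF p]
          by (intro image_eqI[of _ _ "inv \<pi> i"]) auto
      qed
      moreover have "(\<Prod>q\<in>(\<lambda>i. (i, restrict \<pi> {..<n} i)) ` {..<n}. m q) = (\<Prod>i<n. m (i, \<pi> i))"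
        by (subst prod.reindex) (auto intro!: inj_onI)
      ultimately show "?f (restrict \<pi> {..<n}) (restrict (inv \<pi>) {..<n}) = (\<Prod>i<n. m (i, \<pi> i))"
        by simp
    qed
    finally show ?thesis using True unfolding lhs by simp
  qed
qed

context poisson_noise
begin

text \<open>Additivity holds only almost surely, because \<open>measure\<close> is additive only
  where the counts are finite.\<close>

lemma compensated_UN:
  assumes "finite S" and B: "\<And>i. i \<in> S \<Longrightarrow> B i \<in> sets \<mu> \<and> emeasure \<mu> (B i) < \<infinity>"
    and disj: "disjoint_family_on B S"
  shows "AE \<omega> in M. compensated \<mu> N (\<Union>i\<in>S. B i) \<omega> = (\<Sum>i\<in>S. compensated \<mu> N (B i) \<omega>)"
proof -
  have "AE \<omega> in M. \<forall>i\<in>S. emeasure (N \<omega>) (B i) < \<infinity>"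
    using B assms(1) by (intro AE_finite_allI AE_N_finite) auto
  then show ?thesis
    using AE_space
  proof eventually_elim
    case (elim \<omega>)
    have "measure (N \<omega>) (\<Union>i\<in>S. B i) = (\<Sum>i\<in>S. measure (N \<omega>) (B i))"
      using elim B disj assms(1) by (intro measure_finite_Union) (auto simp: sets_N)
    moreover have "measure \<mu> (\<Union>i\<in>S. B i) = (\<Sum>i\<in>S. measure \<mu> (B i))"
      using B disj assms(1) by (intro measure_finite_Union) (auto simp: less_top)
    ultimately show ?case
      by (simp add: compensated_def sum_subtractf)
  qed
qed

text \<open>
  The sets are decomposed into the atoms \<open>A\<^sub>i \<inter> A'\<^sub>k\<close>, indexed by pairs \<open>(i, k)\<close>, where the extra
  indices \<open>n\<close> and \<open>n'\<close> stand for the complements of the unions.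
\<close>

lemma expectation_elementary:
  fixes n n' :: nat
  assumes A: "\<And>i. i < n \<Longrightarrow> A i \<in> sets \<mu> \<and> emeasure \<mu> (A i) < \<infinity>" "disjoint_family_on A {..<n}"
    and A': "\<And>i. i < n' \<Longrightarrow> A' i \<in> sets \<mu> \<and> emeasure \<mu> (A' i) < \<infinity>" "disjoint_family_on A' {..<n'}"
  shows "integrable M (\<lambda>\<omega>. (\<Prod>i<n. compensated \<mu> N (A i) \<omega>) * (\<Prod>i<n'. compensated \<mu> N (A' i) \<omega>))"
    and "expectation (\<lambda>\<omega>. (\<Prod>i<n. compensated \<mu> N (A i) \<omega>) * (\<Prod>i<n'. compensated \<mu> N (A' i) \<omega>)) =
      (if n = n' then \<Sum>\<pi> | \<pi> permutes {..<n}. \<Prod>i<n. measure \<mu> (A i \<inter> A' (\<pi> i)) else 0)"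
proof -
  define E where "E i = (if i < n then A i else space \<mu> - (\<Union>i<n. A i))" for i
  define E' where "E' k = (if k < n' then A' k else space \<mu> - (\<Union>k<n'. A' k))" for k
  define B where "B p = E (fst p) \<inter> E' (snd p)" for p
  \<comment> \<open>The atom \<open>(n, n')\<close> lies outside all the given sets and may have
    infinite measure. It is left out, and it never occurs in the expansion.\<close>
  define J where "J = {..n} \<times> {..n'} - {(n, n')}"
  let ?X = "compensated \<mu> N"
  let ?\<Phi> = "{..<n} \<rightarrow>\<^sub>E {..n'}" and ?\<Psi> = "{..<n'} \<rightarrow>\<^sub>E {..n}"
  let ?PQ = "\<lambda>\<phi> \<psi> \<omega>. (\<Prod>p\<in>(\<lambda>i. (i, \<phi> i)) ` {..<n}. ?X (B p) \<omega>) * (\<Prod>p\<in>(\<lambda>k. (\<psi> k, k)) ` {..<n'}. ?X (B p) \<omega>)"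
  have E_sets: "E i \<in> sets \<mu>" and E'_sets: "E' i \<in> sets \<mu>" for i
    unfolding E_def E'_def using A(1) A'(1) by (auto intro!: sets.Diff sets.finite_UN finite_lessThan)
  have fin_mono: "emeasure \<mu> S < \<infinity>" if "S \<subseteq> T" "T \<in> sets \<mu>" "emeasure \<mu> T < \<infinity>" for S T
    using emeasure_mono[OF that(1,2)] that(3) by (rule le_less_trans)
  have B: "B p \<in> sets \<mu> \<and> emeasure \<mu> (B p) < \<infinity>" if "p \<in> J" for p
  proof
    show "B p \<in> sets \<mu>" using E_sets E'_sets by (simp add: B_def)
    have "fst p < n \<or> snd p < n'" using that by (cases p) (auto simp: J_def)
    then show "emeasure \<mu> (B p) < \<infinity>"
    proof
      assume "fst p < n"
      then show ?thesis using A(1)[of "fst p"]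
        by (intro fin_mono[of "B p" "A (fst p)"]) (auto simp: B_def E_def)
    next
      assume "snd p < n'"
      then show ?thesis using A'(1)[of "snd p"]
        by (intro fin_mono[of "B p" "A' (snd p)"]) (auto simp: B_def E'_def)
    qed
  qed
  have disjE: "E i \<inter> E k = {}" if "i \<noteq> k" "i \<le> n" "k \<le> n" for i k
    using that A(2) by (auto simp: E_def disjoint_family_on_def)
  have disjE': "E' i \<inter> E' k = {}" if "i \<noteq> k" "i \<le> n'" "k \<le> n'" for i k
    using that A'(2) by (auto simp: E'_def disjoint_family_on_def)
  have disj: "disjoint_family_on B J"
    unfolding disjoint_family_on_def B_def
  proof (intro ballI impI)
    fix p q assume "p \<in> J" "q \<in> J" "p \<noteq> q"
    then show "E (fst p) \<inter> E' (snd p) \<inter> (E (fst q) \<inter> E' (snd q)) = {}"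
    proof (cases "fst p = fst q")
      case True
      with \<open>p \<noteq> q\<close> have "snd p \<noteq> snd q" by (simp add: prod_eq_iff)
      then have "E' (snd p) \<inter> E' (snd q) = {}"
        using \<open>p \<in> J\<close> \<open>q \<in> J\<close> by (intro disjE') (auto simp: J_def)
      then show ?thesis by blast
    next
      case False
      then have "E (fst p) \<inter> E (fst q) = {}"
        using \<open>p \<in> J\<close> \<open>q \<in> J\<close> by (intro disjE) (auto simp: J_def)
      then show ?thesis by blast
    qed
  qed
  have cover: "\<exists>k\<le>n'. x \<in> E' k" if "x \<in> space \<mu>" for x
  proof (cases "\<exists>k<n'. x \<in> A' k")
    case True
    then obtain k where "k < n'" "x \<in> A' k" by blast
    then show ?thesis by (intro exI[of _ k]) (simp add: E'_def)
  qed (use that in \<open>auto simp: E'_def intro!: exI[of _ n']\<close>)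
  have cover': "\<exists>i\<le>n. x \<in> E i" if "x \<in> space \<mu>" for x
  proof (cases "\<exists>i<n. x \<in> A i")
    case True
    then obtain i where "i < n" "x \<in> A i" by blast
    then show ?thesis by (intro exI[of _ i]) (simp add: E_def)
  qed (use that in \<open>auto simp: E_def intro!: exI[of _ n]\<close>)
  have split1: "A i = (\<Union>k\<le>n'. B (i, k))" if "i < n" for i
    using cover sets.sets_into_space[of "A i" \<mu>] A(1)[OF that] that
    unfolding B_def E_def by fastforce
  have split2: "A' k = (\<Union>i\<le>n. B (i, k))" if "k < n'" for k
    using cover' sets.sets_into_space[of "A' k" \<mu>] A'(1)[OF that] that
    unfolding B_def E'_def by fastforce
  have "AE \<omega> in M. \<forall>i\<in>{..<n}. ?X (A i) \<omega> = (\<Sum>k\<le>n'. ?X (B (i, k)) \<omega>)"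
  proof (intro AE_finite_allI)
    fix i assume i: "i \<in> {..<n}"
    show "AE \<omega> in M. ?X (A i) \<omega> = (\<Sum>k\<le>n'. ?X (B (i, k)) \<omega>)"
      unfolding split1[OF i[simplified]] using i disj
      by (intro compensated_UN B) (auto simp: J_def disjoint_family_on_def)
  qed simp
  moreover have "AE \<omega> in M. \<forall>k\<in>{..<n'}. ?X (A' k) \<omega> = (\<Sum>i\<le>n. ?X (B (i, k)) \<omega>)"
  proof (intro AE_finite_allI)
    fix k assume k: "k \<in> {..<n'}"
    show "AE \<omega> in M. ?X (A' k) \<omega> = (\<Sum>i\<le>n. ?X (B (i, k)) \<omega>)"
      unfolding split2[OF k[simplified]] using k disj
      by (intro compensated_UN B) (auto simp: J_def disjoint_family_on_def)
  qed simp
  ultimately have AE_eq: "AE \<omega> in M. (\<Prod>i<n. ?X (A i) \<omega>) * (\<Prod>i<n'. ?X (A' i) \<omega>) =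
      (\<Sum>\<phi>\<in>?\<Phi>. \<Sum>\<psi>\<in>?\<Psi>.
         ?PQ \<phi> \<psi> \<omega>)"
  proof eventually_elim
    case (elim \<omega>)
    have "(\<Prod>i<n. ?X (A i) \<omega>) * (\<Prod>i<n'. ?X (A' i) \<omega>) =
        (\<Prod>i<n. \<Sum>k\<le>n'. ?X (B (i, k)) \<omega>) * (\<Prod>k<n'. \<Sum>i\<le>n. ?X (B (i, k)) \<omega>)"
      using elim by simp
    \<comment> \<open>Expanding the products of sums: \<open>\<phi> i\<close> is the atom chosen
      inside \<open>A i\<close>, and \<open>\<psi> k\<close> the one chosen inside
      \<open>A' k\<close>.\<close>
    also have "\<dots> = (\<Sum>\<phi>\<in>?\<Phi>. \<Prod>i<n. ?X (B (i, \<phi> i)) \<omega>) *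
        (\<Sum>\<psi>\<in>?\<Psi>. \<Prod>k<n'. ?X (B (\<psi> k, k)) \<omega>)"
      by (subst (1 2) prod_sum_PiE) auto
    also have "\<dots> = (\<Sum>\<phi>\<in>?\<Phi>. \<Sum>\<psi>\<in>?\<Psi>.
         ?PQ \<phi> \<psi> \<omega>)"
      unfolding sum_product
      by (intro sum.cong refl arg_cong2[where f = "(*)"]) (subst prod.reindex, auto intro!: inj_onI)+
    finally show ?case .
  qed
  \<comment> \<open>Each such pair has a first component below \<open>n\<close> or a second one
    below \<open>n'\<close>, so the excluded pair is avoided.\<close>
  have graphs: "(\<lambda>i. (i, \<phi> i)) ` {..<n} \<union> (\<lambda>k. (\<psi> k, k)) ` {..<n'} \<subseteq> J"
    if "\<phi> \<in> ?\<Phi>" "\<psi> \<in> ?\<Psi>" for \<phi> \<psi>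
    using that by (auto simp: J_def PiE_def Pi_def)
  have disj': "disjoint_family_on B S" if "S \<subseteq> J" for S
    using disj that by (rule disjoint_family_on_mono[rotated])
  have terms:
    "integrable M (\<lambda>\<omega>. ?PQ \<phi> \<psi> \<omega>)"
    "expectation (\<lambda>\<omega>. ?PQ \<phi> \<psi> \<omega>) =
      (if (\<lambda>i. (i, \<phi> i)) ` {..<n} = (\<lambda>k. (\<psi> k, k)) ` {..<n'}
       then \<Prod>p\<in>(\<lambda>i. (i, \<phi> i)) ` {..<n}. measure \<mu> (B p) else 0)"
    if "\<phi> \<in> ?\<Phi>" "\<psi> \<in> ?\<Psi>" for \<phi> \<psi>
    using B graphs[OF that] disj'[OF graphs[OF that]]
    by (intro expectation_prod_compensated; blast)+
  have meas: "(\<lambda>\<omega>. (\<Prod>i<n. ?X (A i) \<omega>) * (\<Prod>i<n'. ?X (A' i) \<omega>)) \<in> borel_measurable M"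
    using A(1) A'(1) by (intro borel_measurable_times borel_measurable_prod measurable_compensated) auto
  have int: "integrable M (\<lambda>\<omega>. \<Sum>\<phi>\<in>?\<Phi>. \<Sum>\<psi>\<in>?\<Psi>.
         ?PQ \<phi> \<psi> \<omega>)"
    by (intro Bochner_Integration.integrable_sum terms)
  show "integrable M (\<lambda>\<omega>. (\<Prod>i<n. ?X (A i) \<omega>) * (\<Prod>i<n'. ?X (A' i) \<omega>))"
    using integrable_cong_AE[OF meas borel_measurable_integrable[OF int] AE_eq] int by simp
  have "expectation (\<lambda>\<omega>. (\<Prod>i<n. ?X (A i) \<omega>) * (\<Prod>i<n'. ?X (A' i) \<omega>)) =
    expectation (\<lambda>\<omega>. \<Sum>\<phi>\<in>?\<Phi>. \<Sum>\<psi>\<in>?\<Psi>.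
         ?PQ \<phi> \<psi> \<omega>)"
    by (rule integral_cong_AE[OF meas borel_measurable_integrable[OF int] AE_eq])
  also have "\<dots> = (\<Sum>\<phi>\<in>?\<Phi>. \<Sum>\<psi>\<in>?\<Psi>.
      if (\<lambda>i. (i, \<phi> i)) ` {..<n} = (\<lambda>k. (\<psi> k, k)) ` {..<n'}
       then \<Prod>p\<in>(\<lambda>i. (i, \<phi> i)) ` {..<n}. measure \<mu> (B p) else 0)"
    using terms by (simp add: Bochner_Integration.integral_sum Bochner_Integration.integrable_sum)
  also have "\<dots> = (if n = n' then \<Sum>\<pi> | \<pi> permutes {..<n}. \<Prod>i<n. measure \<mu> (B (i, \<pi> i)) else 0)"
    by (rule sum_transposed_graphs)
  also have "\<dots> = (if n = n' then \<Sum>\<pi> | \<pi> permutes {..<n}. \<Prod>i<n. measure \<mu> (A i \<inter> A' (\<pi> i)) else 0)"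
  proof (rule if_cong[OF refl _ refl], intro sum.cong prod.cong refl)
    fix \<pi> i assume "n = n'" "\<pi> \<in> {\<pi>. \<pi> permutes {..<n}}" "i \<in> {..<n}"
    then show "measure \<mu> (B (i, \<pi> i)) = measure \<mu> (A i \<inter> A' (\<pi> i))"
      using permutes_in_image[of \<pi> "{..<n}" i] by (simp add: B_def E_def E'_def)
  qed
  finally show "expectation (\<lambda>\<omega>. (\<Prod>i<n. ?X (A i) \<omega>) * (\<Prod>i<n'. ?X (A' i) \<omega>)) =
      (if n = n' then \<Sum>\<pi> | \<pi> permutes {..<n}. \<Prod>i<n. measure \<mu> (A i \<inter> A' (\<pi> i)) else 0)" .
qed

end

section \<open>Sigma-fields generated by the noise in a region\<close>

lemma measurable_Collect_mem:
  assumes "f \<in> measurable M S" "A \<in> sets S"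
  shows "{x \<in> space M. f x \<in> A} \<in> sets M"
proof -
  have "{x \<in> space M. f x \<in> A} = f -` A \<inter> space M" by blast
  then show ?thesis using measurable_sets[OF assms] by simp
qed

text \<open>Independence is given for disjoint sets only, so overlapping sets have to be expressed
  through atoms: \<open>atom T\<close> consists of the points that belong to the members of
  \<open>T\<close> and to no other member of \<open>\<B>\<close>. Empty atoms are discarded, so that
  atoms from disjoint regions are different sets.\<close>

lemma finite_disjoint_refinement:
  assumes "finite \<B>" "\<B> \<subseteq> sets \<mu>" "\<And>B. B \<in> \<B> \<Longrightarrow> B \<subseteq> V"
  shows "\<exists>\<D>. finite \<D> \<and> \<D> \<subseteq> sets \<mu> \<and> disjoint \<D> \<and> (\<forall>D\<in>\<D>. D \<subseteq> V \<and> D \<noteq> {}) \<and>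
    (\<forall>B\<in>\<B>. \<Union>{D \<in> \<D>. D \<subseteq> B} = B)"
proof -
  define atom where "atom T = \<Inter>T - \<Union>(\<B> - T)" for T
  let ?D = "atom ` (Pow \<B> - {{}}) - {{}}"
  have "finite ?D" using assms(1) by simp
  moreover have "?D \<subseteq> sets \<mu>"
  proof
    fix D assume "D \<in> ?D"
    then obtain T where T: "T \<subseteq> \<B>" "T \<noteq> {}" "D = atom T" by blast
    then have "finite T" using assms(1) finite_subset by auto
    then show "D \<in> sets \<mu>"
      unfolding T(3) atom_def using T(1,2) assms sets.finite_INT[of T "\<lambda>B. B" \<mu>]
      by (intro sets.Diff sets.finite_Union) auto
  qed
  moreover have "disjoint ?D"
  proof (rule disjointI)
    fix a b assume "a \<in> ?D" "b \<in> ?D" "a \<noteq> b"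
    then obtain S T where ST: "a = atom S" "b = atom T" "S \<subseteq> \<B>" "T \<subseteq> \<B>" "S \<noteq> T"
      by blast
    then consider B where "B \<in> S" "B \<in> \<B> - T" | B where "B \<in> T" "B \<in> \<B> - S"
      by blast
    then show "a \<inter> b = {}"
      unfolding ST(1,2) atom_def by cases blast+
  qed
  moreover have "\<forall>D\<in>?D. D \<subseteq> V \<and> D \<noteq> {}"
    using assms(3) unfolding atom_def by blast
  moreover have "\<forall>B\<in>\<B>. \<Union>{D \<in> ?D. D \<subseteq> B} = B"
  proof (intro ballI equalityI subsetI)
    fix B x assume B: "B \<in> \<B>" and x: "x \<in> B"
    let ?T = "{B \<in> \<B>. x \<in> B}"
    have "x \<in> atom ?T" "?T \<subseteq> \<B>" "?T \<noteq> {}" "atom ?T \<subseteq> B"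
      using x B by (auto simp: atom_def)
    then show "x \<in> \<Union>{D \<in> ?D. D \<subseteq> B}" by blast
  qed auto
  ultimately show ?thesis by (intro exI[of _ ?D] conjI)
qed

context poisson_noise
begin

text \<open>The null sets are included so that, for \<open>V\<close> the strip of times up to
  \<open>t\<close>, this field contains the filtration at time \<open>t\<close>.\<close>

definition noise_on :: "'a set \<Rightarrow> 'w measure" where
  "noise_on V = sigma (space M)
     ({{\<omega>\<in>space M. emeasure (N \<omega>) B \<in> E} | B E. B \<in> sets \<mu> \<and> B \<subseteq> V \<and> E \<in> sets borel} \<union> null_sets M)"

text \<open>Finite intersections of the generators: together with the null sets they are stable
  under intersection, as is required to extend independence to the generated fields.\<close>

definition noise_cylinders :: "'a set \<Rightarrow> 'w set set" where
  "noise_cylinders V =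
     {{\<omega>\<in>space M. \<forall>B\<in>\<B>. emeasure (N \<omega>) B \<in> E B} | \<B> E.
        finite \<B> \<and> \<B> \<subseteq> sets \<mu> \<and> (\<forall>B\<in>\<B>. B \<subseteq> V \<and> E B \<in> sets borel)}"

lemma noise_generators_subset:
  "{{\<omega>\<in>space M. emeasure (N \<omega>) B \<in> E} | B E. B \<in> sets \<mu> \<and> B \<subseteq> V \<and> E \<in> sets borel} \<union> null_sets M
    \<subseteq> events"
  using measurable_Collect_mem[OF measurable_N] by blast

lemma space_noise_on [simp]: "space (noise_on V) = space M"
  unfolding noise_on_def by (rule space_measure_of) (use noise_generators_subset sets.space_closed in blast)

lemma sets_noise_on:
  "sets (noise_on V) = sigma_sets (space M)
     ({{\<omega>\<in>space M. emeasure (N \<omega>) B \<in> E} | B E. B \<in> sets \<mu> \<and> B \<subseteq> V \<and> E \<in> sets borel} \<union> null_sets M)"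
  unfolding noise_on_def
  by (rule sets_measure_of) (use noise_generators_subset sets.space_closed in blast)

lemma sets_noise_on_subset: "sets (noise_on V) \<subseteq> events"
  unfolding sets_noise_on by (rule sets.sigma_sets_subset[OF noise_generators_subset])

lemma subalgebra_noise_on: "subalgebra M (noise_on V)"
  by (simp add: subalgebra_def sets_noise_on_subset)

lemmas measurable_noise_onD = measurable_from_subalg[OF subalgebra_noise_on]

lemma noise_on_mono: "V \<subseteq> V' \<Longrightarrow> sets (noise_on V) \<subseteq> sets (noise_on V')"
  unfolding sets_noise_on by (intro sigma_sets_mono') blast

lemma measurable_emeasure_N_noise_on:
  assumes "B \<in> sets \<mu>" "B \<subseteq> V"
  shows "(\<lambda>\<omega>. emeasure (N \<omega>) B) \<in> borel_measurable (noise_on V)"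
proof (rule measurableI)
  fix E :: "ennreal set" assume "E \<in> sets borel"
  then show "(\<lambda>\<omega>. emeasure (N \<omega>) B) -` E \<inter> space (noise_on V) \<in> sets (noise_on V)"
    unfolding sets_noise_on using assms
    by (intro sigma_sets.Basic UnI1 CollectI exI[of _ B] exI[of _ E]) auto
qed simp

lemma measurable_compensated_noise_on:
  assumes "B \<in> sets \<mu>" "B \<subseteq> V"
  shows "compensated \<mu> N B \<in> borel_measurable (noise_on V)"
  unfolding compensated_def[abs_def] measure_def
  by (intro borel_measurable_diff measurable_compose[OF measurable_emeasure_N_noise_on[OF assms]]
      borel_measurable_const) auto

lemma noise_cylinders_events: "noise_cylinders V \<subseteq> events"
proof
  fix A assume "A \<in> noise_cylinders V"
  then obtain \<B> E where *: "A = {\<omega>\<in>space M. \<forall>B\<in>\<B>. emeasure (N \<omega>) B \<in> E B}"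
    "finite \<B>" "\<B> \<subseteq> sets \<mu>" "\<forall>B\<in>\<B>. B \<subseteq> V \<and> E B \<in> sets borel"
    unfolding noise_cylinders_def by blast
  show "A \<in> events"
    unfolding *(1) using *(2-4)
    by (intro sets.sets_Collect_finite_All measurable_Collect_mem[OF measurable_N]) auto
qed

lemma Int_stable_noise_cylinders: "Int_stable (noise_cylinders V \<union> null_sets M)"
proof (rule Int_stableI)
  fix a b assume a: "a \<in> noise_cylinders V \<union> null_sets M" and b: "b \<in> noise_cylinders V \<union> null_sets M"
  show "a \<inter> b \<in> noise_cylinders V \<union> null_sets M"
  proof (cases "a \<in> null_sets M \<or> b \<in> null_sets M")
    case True
    then show ?thesis
      using a b noise_cylinders_events null_set_Int1 null_set_Int2 by blast
  next
    case False
    then obtain \<B> E \<B>' E' where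
      *: "a = {\<omega>\<in>space M. \<forall>B\<in>\<B>. emeasure (N \<omega>) B \<in> E B}"
        "finite \<B>" "\<B> \<subseteq> sets \<mu>" "\<forall>B\<in>\<B>. B \<subseteq> V \<and> E B \<in> sets borel"
        "b = {\<omega>\<in>space M. \<forall>B\<in>\<B>'. emeasure (N \<omega>) B \<in> E' B}"
        "finite \<B>'" "\<B>' \<subseteq> sets \<mu>" "\<forall>B\<in>\<B>'. B \<subseteq> V \<and> E' B \<in> sets borel"
      using a b unfolding noise_cylinders_def by blast
    \<comment> \<open>The two families may share sets, so constraints are intersected; a set absent
      from one family gets the void constraint \<open>UNIV\<close> from it.\<close>
    let ?E = "\<lambda>B. (if B \<in> \<B> then E B else UNIV) \<inter> (if B \<in> \<B>' then E' B else UNIV)"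
    have "a \<inter> b = {\<omega>\<in>space M. \<forall>B\<in>\<B> \<union> \<B>'. emeasure (N \<omega>) B \<in> ?E B}"
      unfolding * by auto
    moreover have "\<forall>B\<in>\<B> \<union> \<B>'. B \<subseteq> V \<and> ?E B \<in> sets borel"
      using * by auto
    ultimately have "a \<inter> b \<in> noise_cylinders V"
      unfolding noise_cylinders_def using *(2,3,6,7)
      by (intro CollectI exI[of _ "\<B> \<union> \<B>'"] exI[of _ ?E]) simp
    then show ?thesis by blast
  qed
qed

text \<open>The count on a set is the sum of the counts on its atoms. A cylinder thus becomes a
  measurable condition on the vector of counts of disjoint sets, to which independence
  applies.\<close>

lemma noise_cylinder_vimage:
  assumes "A \<in> noise_cylinders V"
  obtains \<D> S where "finite \<D>" "\<D> \<subseteq> sets \<mu>" "disjoint \<D>" "\<forall>D\<in>\<D>. D \<subseteq> V \<and> D \<noteq> {}"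
    "S \<in> sets (PiM \<D> (\<lambda>_. borel :: ennreal measure))"
    "A = (\<lambda>\<omega>. \<lambda>D\<in>\<D>. emeasure (N \<omega>) D) -` S \<inter> space M"
proof -
  obtain \<B> E where *: "A = {\<omega>\<in>space M. \<forall>B\<in>\<B>. emeasure (N \<omega>) B \<in> E B}"
    "finite \<B>" "\<B> \<subseteq> sets \<mu>" "\<And>B. B \<in> \<B> \<Longrightarrow> B \<subseteq> V" "\<And>B. B \<in> \<B> \<Longrightarrow> E B \<in> sets borel"
    using assms unfolding noise_cylinders_def by blast
  obtain \<D> where D: "finite \<D>" "\<D> \<subseteq> sets \<mu>" "disjoint \<D>"
    "\<forall>D\<in>\<D>. D \<subseteq> V \<and> D \<noteq> {}" "\<forall>B\<in>\<B>. \<Union>{D \<in> \<D>. D \<subseteq> B} = B"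
    using finite_disjoint_refinement[OF *(2-4)] by metis
  let ?P = "PiM \<D> (\<lambda>_. borel :: ennreal measure)"
  let ?S = "{f \<in> space ?P. \<forall>B\<in>\<B>. (\<Sum>D\<in>{D \<in> \<D>. D \<subseteq> B}. f D) \<in> E B}"
  have meas: "(\<lambda>f. \<Sum>D\<in>{D \<in> \<D>. D \<subseteq> B}. f D) \<in> borel_measurable ?P" for B
    by (intro borel_measurable_sum measurable_component_singleton) auto
  have "?S \<in> sets ?P"
    using *(2,5) by (intro sets.sets_Collect_finite_All measurable_Collect_mem[OF meas]) auto
  moreover have "emeasure (N \<omega>) B = (\<Sum>D\<in>{D \<in> \<D>. D \<subseteq> B}. emeasure (N \<omega>) D)"
    if "\<omega> \<in> space M" "B \<in> \<B>" for \<omega> B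
  proof -
    have "(\<Sum>D\<in>{D \<in> \<D>. D \<subseteq> B}. emeasure (N \<omega>) D) = emeasure (N \<omega>) (\<Union>D\<in>{D \<in> \<D>. D \<subseteq> B}. D)"
      using D(1-3) that by (intro sum_emeasure) (auto simp: sets_N disjoint_family_on_def disjoint_def)
    then show ?thesis using D(5) that(2) by simp
  qed
  then have "A = (\<lambda>\<omega>. \<lambda>D\<in>\<D>. emeasure (N \<omega>) D) -` ?S \<inter> space M"
    unfolding *(1) by (auto simp: space_PiM)
  ultimately show ?thesis
    using that[OF D(1-4)] by blast
qed

text \<open>The atoms inside \<open>V\<close> and those inside \<open>V'\<close> form one disjoint
  family, so the two vectors of counts are independent. Null sets satisfy the product formula
  trivially, and stability under intersection extends it to the generated fields.\<close>

lemma noise_on_indep: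
  assumes VV: "V \<inter> V' = {}" and A: "A \<in> sets (noise_on V)" and A': "A' \<in> sets (noise_on V')"
  shows "prob (A \<inter> A') = prob A * prob A'"
proof -
  have cyl: "prob (a \<inter> b) = prob a * prob b"
    if a: "a \<in> noise_cylinders V" and b: "b \<in> noise_cylinders V'" for a b
  proof -
    from a obtain \<D> S where D: "finite \<D>" "\<D> \<subseteq> sets \<mu>" "disjoint \<D>" "\<forall>D\<in>\<D>. D \<subseteq> V \<and> D \<noteq> {}"
      "S \<in> sets (PiM \<D> (\<lambda>_. borel :: ennreal measure))"
      "a = (\<lambda>\<omega>. \<lambda>D\<in>\<D>. emeasure (N \<omega>) D) -` S \<inter> space M"
      by (rule noise_cylinder_vimage)
    from b obtain \<D>' S' where D': "finite \<D>'" "\<D>' \<subseteq> sets \<mu>" "disjoint \<D>'" "\<forall>D\<in>\<D>'. D \<subseteq> V' \<and> D \<noteq> {}"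
      "S' \<in> sets (PiM \<D>' (\<lambda>_. borel :: ennreal measure))"
      "b = (\<lambda>\<omega>. \<lambda>D\<in>\<D>'. emeasure (N \<omega>) D) -` S' \<inter> space M"
      by (rule noise_cylinder_vimage)
    \<comment> \<open>A common atom would be a nonempty subset of the empty set
      \<open>V \<inter> V'\<close>.\<close>
    have DD: "\<D> \<inter> \<D>' = {}"
    proof (rule ccontr)
      assume "\<D> \<inter> \<D>' \<noteq> {}"
      then obtain d where "d \<in> \<D>" "d \<in> \<D>'" by blast
      with D(4) D'(4) have "d \<subseteq> V \<inter> V'" "d \<noteq> {}" by auto
      with VV show False by blast
    qed
    have "disjoint_family_on (\<lambda>D. D) (\<D> \<union> \<D>')"
      unfolding disjoint_family_on_def
    proof (intro ballI impI)
      fix a b assume "a \<in> \<D> \<union> \<D>'" "b \<in> \<D> \<union> \<D>'" "a \<noteq> b"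
      then show "a \<inter> b = {}"
      proof (elim UnE)
        assume "a \<in> \<D>" "b \<in> \<D>"
        with \<open>a \<noteq> b\<close> show ?thesis using disjointD[OF D(3)] by simp
      next
        assume "a \<in> \<D>'" "b \<in> \<D>'"
        with \<open>a \<noteq> b\<close> show ?thesis using disjointD[OF D'(3)] by simp
      next
        assume "a \<in> \<D>" "b \<in> \<D>'"
        then have "a \<subseteq> V" "b \<subseteq> V'" using D(4) D'(4) by auto
        with VV show ?thesis by blast
      next
        assume "a \<in> \<D>'" "b \<in> \<D>"
        then have "a \<subseteq> V'" "b \<subseteq> V" using D(4) D'(4) by auto
        with VV show ?thesis by blast
      qed
    qed
    then have "indep_vars (\<lambda>_. borel) (\<lambda>D \<omega>. emeasure (N \<omega>) D) (\<D> \<union> \<D>')"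
      using D(1,2) D'(1,2) by (intro indep_vars_N[where B = "\<lambda>D. D"]) auto
    from indep_varD[OF indep_var_restrict[OF this DD] D(5) D'(5)]
    have "prob ((\<lambda>\<omega>. (\<lambda>D\<in>\<D>. emeasure (N \<omega>) D, \<lambda>D\<in>\<D>'. emeasure (N \<omega>) D)) -` (S \<times> S') \<inter> space M) =
      prob a * prob b"
      unfolding D(6) D'(6) by simp
    moreover have "(\<lambda>\<omega>. (\<lambda>D\<in>\<D>. emeasure (N \<omega>) D, \<lambda>D\<in>\<D>'. emeasure (N \<omega>) D)) -` (S \<times> S') \<inter> space M = a \<inter> b"
      unfolding D(6) D'(6) by auto
    ultimately show ?thesis by simp
  qed
  have "indep_set (noise_cylinders V \<union> null_sets M) (noise_cylinders V' \<union> null_sets M)"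
  proof (rule indep_setI)
    fix a b assume a: "a \<in> noise_cylinders V \<union> null_sets M" and b: "b \<in> noise_cylinders V' \<union> null_sets M"
    have ev: "a \<in> events" "b \<in> events"
      using a b noise_cylinders_events by auto
    consider "a \<in> null_sets M" | "b \<in> null_sets M" | "a \<in> noise_cylinders V" "b \<in> noise_cylinders V'"
      using a b by blast
    then show "prob (a \<inter> b) = prob a * prob b"
    proof cases
      case 1
      then have "a \<inter> b \<in> null_sets M" using ev by (intro null_set_Int2) auto
      with 1 show ?thesis by (simp add: measure_eq_0_null_sets)
    next
      case 2
      then have "a \<inter> b \<in> null_sets M" using ev by (intro null_set_Int1) auto
      with 2 show ?thesis by (simp add: measure_eq_0_null_sets)
    qed (use cyl in auto)
  qed (use noise_cylinders_events in auto)
  then have ind: "indep_set (sigma_sets (space M) (noise_cylinders V \<union> null_sets M))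
      (sigma_sets (space M) (noise_cylinders V' \<union> null_sets M))"
    by (intro indep_set_sigma_sets Int_stable_noise_cylinders)
  have sub: "sets (noise_on U) \<subseteq> sigma_sets (space M) (noise_cylinders U \<union> null_sets M)" for U
    unfolding sets_noise_on
  proof (rule sigma_sets_mono', safe)
    fix B E assume "B \<in> sets \<mu>" "B \<subseteq> U" "E \<in> sets (borel :: ennreal measure)"
    then have "{\<omega>\<in>space M. emeasure (N \<omega>) B \<in> E} \<in> noise_cylinders U"
      unfolding noise_cylinders_def
      by (intro CollectI exI[of _ "{B}"] exI[of _ "\<lambda>_. E"]) auto
    moreover assume "{\<omega>\<in>space M. emeasure (N \<omega>) B \<in> E} \<notin> null_sets M"
    ultimately show "{\<omega>\<in>space M. emeasure (N \<omega>) B \<in> E} \<in> noise_cylinders U" by simp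
  qed
  show ?thesis
    using indep_setD[OF ind] sub A A' by blast
qed

lemma indep_var_noise_on:
  assumes VV: "V \<inter> V' = {}" and f: "f \<in> measurable (noise_on V) S" and g: "g \<in> measurable (noise_on V') T"
  shows "indep_var S f T g"
  unfolding indep_var_eq
proof (intro conjI measurable_noise_onD[OF f] measurable_noise_onD[OF g])
  have f': "sigma_sets (space M) {f -` A \<inter> space M |A. A \<in> sets S} \<subseteq> sets (noise_on V)"
    using measurable_sets[OF f] by (intro sets.sigma_sets_subset[of _ "noise_on V", simplified]) auto
  have g': "sigma_sets (space M) {g -` A \<inter> space M |A. A \<in> sets T} \<subseteq> sets (noise_on V')"
    using measurable_sets[OF g] by (intro sets.sigma_sets_subset[of _ "noise_on V'", simplified]) auto
  show "indep_set (sigma_sets (space M) {f -` A \<inter> space M |A. A \<in> sets S})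
     (sigma_sets (space M) {g -` A \<inter> space M |A. A \<in> sets T})"
  proof (rule indep_setI)
    fix a b
    assume "a \<in> sigma_sets (space M) {f -` A \<inter> space M |A. A \<in> sets S}"
      and "b \<in> sigma_sets (space M) {g -` A \<inter> space M |A. A \<in> sets T}"
    then show "prob (a \<inter> b) = prob a * prob b"
      using f' g' by (intro noise_on_indep[OF VV]) auto
  qed (rule subset_trans[OF f' sets_noise_on_subset] subset_trans[OF g' sets_noise_on_subset])+
qed

end

section \<open>The isometry for elementary kernels\<close>

text \<open>The squared norm is preferred to \<open>l2norm\<close>: it is additive over orthogonal
  families and disintegrates into slices by Tonelli. Values in \<open>ennreal\<close> keep infinite
  norms meaningful.\<close>

definition sqi :: "'a measure \<Rightarrow> ('a \<Rightarrow> real) \<Rightarrow> ennreal" where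
  "sqi M X = (\<integral>\<^sup>+x. ennreal ((X x)\<^sup>2) \<partial>M)"

lemma l2norm_eq: "l2norm M X = (if sqi M X = \<infinity> then \<infinity> else ennreal (sqrt (enn2real (sqi M X))))"
  by (simp add: l2norm_def sqi_def Let_def)

lemma l2norm_power2: "(l2norm M X)\<^sup>2 = sqi M X"
proof (cases "sqi M X = \<infinity>")
  case True
  then show ?thesis by (simp add: l2norm_eq power2_eq_square ennreal_top_mult)
next
  case False
  then have "(l2norm M X)\<^sup>2 = ennreal ((sqrt (enn2real (sqi M X)))\<^sup>2)"
    unfolding l2norm_eq by (simp add: ennreal_power)
  then show ?thesis using False by (simp add: less_top)
qed

lemma sqi_cong_AE: "AE x in M. X x = Y x \<Longrightarrow> sqi M X = sqi M Y"
  unfolding sqi_def by (rule nn_integral_cong_AE) auto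

lemma sqi_mono_AE: "AE x in M. \<bar>X x\<bar> \<le> \<bar>Y x\<bar> \<Longrightarrow> sqi M X \<le> sqi M Y"
  unfolding sqi_def by (rule nn_integral_mono_AE) (auto simp: abs_le_square_iff intro!: ennreal_leI)

lemma sqi_minus_commute: "sqi M (\<lambda>x. X x - Y x) = sqi M (\<lambda>x. Y x - X x)"
  by (simp add: sqi_def power2_commute)

lemma sqi_cmult:
  assumes "X \<in> borel_measurable M"
  shows "sqi M (\<lambda>x. c * X x) = ennreal (c\<^sup>2) * sqi M X"
  unfolding sqi_def using assms
  by (subst nn_integral_cmult[symmetric]) (auto simp: power_mult_distrib ennreal_mult')

lemma sqi_add:
  assumes [measurable]: "X \<in> borel_measurable M" "Y \<in> borel_measurable M"
  shows "sqi M (\<lambda>x. X x + Y x) \<le> 2 * sqi M X + 2 * sqi M Y"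
proof -
  have "sqi M (\<lambda>x. X x + Y x) \<le> (\<integral>\<^sup>+x. 2 * ennreal ((X x)\<^sup>2) + 2 * ennreal ((Y x)\<^sup>2) \<partial>M)"
    unfolding sqi_def
  proof (rule nn_integral_mono)
    fix x
    have "(X x + Y x)\<^sup>2 \<le> 2 * (X x)\<^sup>2 + 2 * (Y x)\<^sup>2"
      using sum_squares_bound[of "X x" "Y x"] by (simp add: power2_sum)
    then have "ennreal ((X x + Y x)\<^sup>2) \<le> ennreal (2 * (X x)\<^sup>2 + 2 * (Y x)\<^sup>2)"
      by (rule ennreal_leI)
    then show "ennreal ((X x + Y x)\<^sup>2) \<le> 2 * ennreal ((X x)\<^sup>2) + 2 * ennreal ((Y x)\<^sup>2)"
      by (simp add: ennreal_mult')
  qed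
  also have "\<dots> = 2 * sqi M X + 2 * sqi M Y"
    unfolding sqi_def by (simp add: nn_integral_add nn_integral_cmult)
  finally show ?thesis .
qed

lemma sqi_diff:
  assumes [measurable]: "X \<in> borel_measurable M" "Y \<in> borel_measurable M"
  shows "sqi M (\<lambda>x. X x - Y x) \<le> 2 * sqi M X + 2 * sqi M Y"
proof -
  have "sqi M (\<lambda>x. - Y x) = sqi M Y" by (simp add: sqi_def)
  then show ?thesis using sqi_add[of X M "\<lambda>x. - Y x"] by simp
qed

lemma sqi_triangle:
  assumes [measurable]: "X \<in> borel_measurable M" "Y \<in> borel_measurable M" "Z \<in> borel_measurable M"
  shows "sqi M (\<lambda>x. X x - Z x) \<le> 2 * sqi M (\<lambda>x. X x - Y x) + 2 * sqi M (\<lambda>x. Y x - Z x)"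
  using sqi_add[of "\<lambda>x. X x - Y x" M "\<lambda>x. Y x - Z x"] by simp

text \<open>Cauchy-Schwarz. It serves to show finiteness and to bound errors that are chosen after
  \<open>I\<close> is fixed, so the factor \<open>card I\<close> is harmless.\<close>

lemma sqi_sum:
  assumes "finite I" and [measurable]: "\<And>i. i \<in> I \<Longrightarrow> X i \<in> borel_measurable M"
  shows "sqi M (\<lambda>x. \<Sum>i\<in>I. X i x) \<le> of_nat (card I) * (\<Sum>i\<in>I. sqi M (X i))"
proof -
  have "sqi M (\<lambda>x. \<Sum>i\<in>I. X i x) \<le> (\<integral>\<^sup>+x. of_nat (card I) * (\<Sum>i\<in>I. ennreal ((X i x)\<^sup>2)) \<partial>M)"
    unfolding sqi_def
  proof (rule nn_integral_mono)
    fix x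
    have "(\<Sum>i\<in>I. X i x)\<^sup>2 \<le> real (card I) * (\<Sum>i\<in>I. (X i x)\<^sup>2)"
      using Cauchy_Schwarz_ineq_sum[of "\<lambda>_. 1" "\<lambda>i. X i x" I] by simp
    then have "ennreal ((\<Sum>i\<in>I. X i x)\<^sup>2) \<le> ennreal (real (card I) * (\<Sum>i\<in>I. (X i x)\<^sup>2))"
      by (rule ennreal_leI)
    then show "ennreal ((\<Sum>i\<in>I. X i x)\<^sup>2) \<le> of_nat (card I) * (\<Sum>i\<in>I. ennreal ((X i x)\<^sup>2))"
      by (simp add: ennreal_mult' sum_nonneg ennreal_of_nat_eq_real_of_nat)
  qed
  also have "\<dots> = of_nat (card I) * (\<Sum>i\<in>I. sqi M (X i))"
    unfolding sqi_def
    by (subst nn_integral_cmult, simp, subst nn_integral_sum) simp_all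
  finally show ?thesis .
qed

lemma square_integrable_iff: "square_integrable M X \<longleftrightarrow> X \<in> borel_measurable M \<and> sqi M X < \<infinity>"
proof -
  have "l2norm M X < \<infinity> \<longleftrightarrow> sqi M X < \<infinity>"
    by (auto simp: l2norm_eq less_top[symmetric])
  then show ?thesis by (simp add: square_integrable_def)
qed

lemma integrable_power2_iff:
  "X \<in> borel_measurable M \<Longrightarrow> integrable M (\<lambda>x. (X x)\<^sup>2) \<longleftrightarrow> sqi M X < \<infinity>"
  by (simp add: integrable_iff_bounded sqi_def)

lemma sqi_eq_integral: "integrable M (\<lambda>x. (X x)\<^sup>2) \<Longrightarrow> sqi M X = ennreal (\<integral>x. (X x)\<^sup>2 \<partial>M)"
  unfolding sqi_def by (rule nn_integral_eq_integral) auto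

lemma integrable_mult_L2:
  fixes X Y :: "'a \<Rightarrow> real"
  assumes X[measurable]: "X \<in> borel_measurable M" and Y[measurable]: "Y \<in> borel_measurable M"
    and "sqi M X < \<infinity>" "sqi M Y < \<infinity>"
  shows "integrable M (\<lambda>x. X x * Y x)"
proof (rule Bochner_Integration.integrable_bound)
  show "integrable M (\<lambda>x. (X x)\<^sup>2 + (Y x)\<^sup>2)"
    using assms by (simp add: integrable_power2_iff)
  show "AE x in M. norm (X x * Y x) \<le> norm ((X x)\<^sup>2 + (Y x)\<^sup>2)"
  proof (rule AE_I2)
    fix x
    have "\<bar>X x * Y x\<bar> \<le> (X x)\<^sup>2 + (Y x)\<^sup>2"
      using sum_squares_bound[of "\<bar>X x\<bar>" "\<bar>Y x\<bar>"] abs_ge_zero[of "X x * Y x"]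
      by (simp only: abs_mult power2_abs)
    then show "norm (X x * Y x) \<le> norm ((X x)\<^sup>2 + (Y x)\<^sup>2)" by simp
  qed
qed simp

section \<open>Elementary kernels, their integrals and second moments\<close>

definition elementary_sets :: "'a measure \<Rightarrow> nat \<Rightarrow> 'k set \<Rightarrow> ('k \<Rightarrow> nat \<Rightarrow> 'a set) \<Rightarrow> bool" where
  "elementary_sets \<mu> n K A \<longleftrightarrow> finite K \<and>
     (\<forall>k\<in>K. (\<forall>i<n. A k i \<in> sets \<mu> \<and> emeasure \<mu> (A k i) < \<infinity>) \<and> disjoint_family_on (A k) {..<n})"

text \<open>Unlike in a step kernel, every term has sets of its own, disjoint only within the term.
  The class is thereby closed under restriction to a region and under differences of two
  restrictions, without a common partition.\<close>

definition elementary_kernel ::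
  "nat \<Rightarrow> 'k set \<Rightarrow> ('k \<Rightarrow> real) \<Rightarrow> ('k \<Rightarrow> nat \<Rightarrow> 'a set) \<Rightarrow> (nat \<Rightarrow> 'a) \<Rightarrow> real" where
  "elementary_kernel n K c A x = (\<Sum>k\<in>K. c k * (\<Prod>i<n. indicator (A k i) (x i)))"

definition elementary_integral ::
  "'a measure \<Rightarrow> ('w \<Rightarrow> 'a measure) \<Rightarrow> nat \<Rightarrow> 'k set \<Rightarrow> ('k \<Rightarrow> real) \<Rightarrow> ('k \<Rightarrow> nat \<Rightarrow> 'a set) \<Rightarrow> 'w \<Rightarrow> real"
  where
  "elementary_integral \<mu> N n K c A \<omega> = (\<Sum>k\<in>K. c k * (\<Prod>i<n. compensated \<mu> N (A k i) \<omega>))"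

lemma measurable_permute:
  assumes "\<pi> permutes {..<n}"
  shows "(\<lambda>x. \<lambda>i\<in>{..<n}. x (\<pi> i)) \<in> measurable (tensor_measure \<mu> n) (tensor_measure \<mu> n)"
  using permutes_in_image[OF assms]
  by (intro measurable_restrict measurable_component_singleton) auto

lemma measurable_elementary_kernel:
  assumes "elementary_sets \<mu> n K A"
  shows "elementary_kernel n K c A \<in> borel_measurable (tensor_measure \<mu> n)"
  unfolding elementary_kernel_def[abs_def]
proof (intro borel_measurable_sum borel_measurable_times borel_measurable_const borel_measurable_prod)
  fix k i assume "k \<in> K" and i: "i \<in> {..<n}"
  then have "A k i \<in> sets \<mu>" using assms by (auto simp: elementary_sets_def)
  then show "(\<lambda>x. indicator (A k i) (x i) :: real) \<in> borel_measurable (tensor_measure \<mu> n)"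
    by (intro measurable_compose[OF measurable_component_singleton[OF i]] borel_measurable_indicator)
qed

context poisson_noise
begin

sublocale tensor: product_sigma_finite "\<lambda>_::nat. \<mu>"
  by (rule product_sigma_finite.intro) (rule mu.sigma_finite_measure_axioms)

text \<open>Boxes suffice: the preimage of a box is the box whose sides are permuted by the inverse,
  and the product of their measures does not change.\<close>

lemma distr_permute:
  assumes p: "\<pi> permutes {..<n}"
  shows "distr (tensor_measure \<mu> n) (tensor_measure \<mu> n) (\<lambda>x. \<lambda>i\<in>{..<n}. x (\<pi> i)) = tensor_measure \<mu> n"
proof (rule tensor.PiM_eqI)
  fix A :: "nat \<Rightarrow> 'a set" assume A: "\<And>i. i \<in> {..<n} \<Longrightarrow> A i \<in> sets \<mu>"
  let ?p = "\<lambda>x. \<lambda>i\<in>{..<n}. x (\<pi> i)"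
  have p': "inv \<pi> i < n" if "i < n" for i
    using permutes_in_image[OF permutes_inv[OF p]] that by auto
  have p'': "\<pi> i < n" if "i < n" for i
    using permutes_in_image[OF p] that by auto
  have vim: "?p -` (Pi\<^sub>E {..<n} A) \<inter> space (tensor_measure \<mu> n) = Pi\<^sub>E {..<n} (\<lambda>i. A (inv \<pi> i))"
  proof (intro equalityI subsetI)
    fix x assume x: "x \<in> ?p -` (Pi\<^sub>E {..<n} A) \<inter> space (tensor_measure \<mu> n)"
    then have *: "x (\<pi> i) \<in> A i" if "i < n" for i using that by (auto simp: PiE_iff)
    have "x i \<in> A (inv \<pi> i)" if "i < n" for i
      using *[OF p'[OF that]] by (simp add: permutes_inverses[OF p])
    then show "x \<in> Pi\<^sub>E {..<n} (\<lambda>i. A (inv \<pi> i))"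
      using x by (auto simp: PiE_iff space_PiM)
  next
    fix x assume x: "x \<in> Pi\<^sub>E {..<n} (\<lambda>i. A (inv \<pi> i))"
    then have "x (\<pi> i) \<in> A i" if "i < n" for i
      using p''[OF that] permutes_inverses(2)[OF p, of i] x by (auto simp: PiE_iff dest: bspec[of _ _ "\<pi> i"])
    moreover have "x i \<in> space \<mu>" if "i < n" for i
      using x that A[THEN sets.sets_into_space] p'[OF that] by (auto simp: PiE_iff)
    ultimately show "x \<in> ?p -` (Pi\<^sub>E {..<n} A) \<inter> space (tensor_measure \<mu> n)"
      using x by (auto simp: PiE_iff space_PiM)
  qed
  have "emeasure (distr (tensor_measure \<mu> n) (tensor_measure \<mu> n) ?p) (Pi\<^sub>E {..<n} A) =
      emeasure (tensor_measure \<mu> n) (Pi\<^sub>E {..<n} (\<lambda>i. A (inv \<pi> i)))"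
    using A by (subst emeasure_distr[OF measurable_permute[OF p]]) (auto simp: vim)
  also have "\<dots> = (\<Prod>i<n. emeasure \<mu> (A (inv \<pi> i)))"
    using A p' by (subst tensor.emeasure_PiM) auto
  also have "\<dots> = (\<Prod>i<n. emeasure \<mu> (A i))"
    using prod.permute[OF permutes_inv[OF p], of "\<lambda>i. emeasure \<mu> (A i)"] by (simp add: comp_def)
  finally show "emeasure (distr (tensor_measure \<mu> n) (tensor_measure \<mu> n) ?p) (Pi\<^sub>E {..<n} A) =
      (\<Prod>i<n. emeasure \<mu> (A i))" .
qed simp_all

lemma nn_integral_permute:
  assumes p: "\<pi> permutes {..<n}" and f: "f \<in> borel_measurable (tensor_measure \<mu> n)"
  shows "(\<integral>\<^sup>+x. f (\<lambda>i\<in>{..<n}. x (\<pi> i)) \<partial>tensor_measure \<mu> n) = (\<integral>\<^sup>+x. f x \<partial>tensor_measure \<mu> n)"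
  using nn_integral_distr[OF measurable_permute[OF p], of f \<mu>] f by (simp add: distr_permute[OF p])

lemma sqi_permute:
  assumes p: "\<pi> permutes {..<n}" and f[measurable]: "f \<in> borel_measurable (tensor_measure \<mu> n)"
  shows "sqi (tensor_measure \<mu> n) (\<lambda>x. f (\<lambda>i\<in>{..<n}. x (\<pi> i))) = sqi (tensor_measure \<mu> n) f"
  unfolding sqi_def by (rule nn_integral_permute[OF p]) simp

lemma integral_tensor_indicator:
  assumes "\<And>i. i < n \<Longrightarrow> A i \<in> sets \<mu> \<and> emeasure \<mu> (A i) < \<infinity>"
  shows "integrable (tensor_measure \<mu> n) (\<lambda>x. \<Prod>i<n. indicator (A i) (x i) :: real)"
    and "(\<integral>x. (\<Prod>i<n. indicator (A i) (x i)) \<partial>tensor_measure \<mu> n) = (\<Prod>i<n. measure \<mu> (A i))"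
proof -
  have int: "integrable \<mu> (indicator (A i) :: 'a \<Rightarrow> real)" if "i \<in> {..<n}" for i
    using assms[of i] that by auto
  show "integrable (tensor_measure \<mu> n) (\<lambda>x. \<Prod>i<n. indicator (A i) (x i) :: real)"
    using int by (intro tensor.product_integrable_prod) auto
  have "(\<integral>x. (\<Prod>i<n. indicator (A i) (x i)) \<partial>tensor_measure \<mu> n) = (\<Prod>i<n. \<integral>x. indicator (A i) x \<partial>\<mu> :: real)"
    by (rule tensor.product_integral_prod[OF _ int]) auto
  also have "\<dots> = (\<Prod>i<n. measure \<mu> (A i))"
    using assms by (intro prod.cong) auto
  finally show "(\<integral>x. (\<Prod>i<n. indicator (A i) (x i)) \<partial>tensor_measure \<mu> n) = (\<Prod>i<n. measure \<mu> (A i))" .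
qed

text \<open>Reindexing the second product moves the permutation from the coordinates to the sets,
  where it appears as its inverse.\<close>

lemma integral_elementary_permute:
  assumes p: "\<pi> permutes {..<n}"
    and A: "\<And>i. i < n \<Longrightarrow> A i \<in> sets \<mu> \<and> emeasure \<mu> (A i) < \<infinity>"
    and A': "\<And>i. i < n \<Longrightarrow> A' i \<in> sets \<mu> \<and> emeasure \<mu> (A' i) < \<infinity>"
  shows "integrable (tensor_measure \<mu> n) (\<lambda>x. (\<Prod>i<n. indicator (A i) (x i)) *
      (\<Prod>i<n. indicator (A' i) ((\<lambda>i\<in>{..<n}. x (\<pi> i)) i)) :: real)"
    and "(\<integral>x. (\<Prod>i<n. indicator (A i) (x i)) *
      (\<Prod>i<n. indicator (A' i) ((\<lambda>i\<in>{..<n}. x (\<pi> i)) i)) \<partial>tensor_measure \<mu> n) =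
      (\<Prod>i<n. measure \<mu> (A i \<inter> A' (inv \<pi> i)))"
proof -
  have p': "inv \<pi> i < n" if "i < n" for i
    using permutes_in_image[OF permutes_inv[OF p]] that by auto
  have eq: "(\<Prod>i<n. indicator (A i) (x i)) *
      (\<Prod>i<n. indicator (A' i) ((\<lambda>i\<in>{..<n}. x (\<pi> i)) i)) =
      (\<Prod>i<n. indicator (A i \<inter> A' (inv \<pi> i)) (x i) :: real)" for x
  proof -
    have "(\<Prod>i<n. indicator (A' i) ((\<lambda>i\<in>{..<n}. x (\<pi> i)) i)) =
        (\<Prod>i<n. indicator (A' (inv \<pi> (\<pi> i))) (x (\<pi> i)) :: real)"
      by (intro prod.cong) (auto simp: permutes_inverses[OF p])
    also have "\<dots> = (\<Prod>i<n. indicator (A' (inv \<pi> i)) (x i))"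
      using prod.permute[OF p, of "\<lambda>i. indicator (A' (inv \<pi> i)) (x i) :: real"] by (simp add: comp_def)
    finally show ?thesis
      by (simp add: prod.distrib[symmetric] indicator_inter_arith)
  qed
  have fin: "A i \<inter> A' (inv \<pi> i) \<in> sets \<mu> \<and> emeasure \<mu> (A i \<inter> A' (inv \<pi> i)) < \<infinity>" if "i < n" for i
  proof
    show "A i \<inter> A' (inv \<pi> i) \<in> sets \<mu>" using A[OF that] A'[OF p'[OF that]] by auto
    have "emeasure \<mu> (A i \<inter> A' (inv \<pi> i)) \<le> emeasure \<mu> (A i)"
      using A[OF that] by (intro emeasure_mono) auto
    then show "emeasure \<mu> (A i \<inter> A' (inv \<pi> i)) < \<infinity>" using A[OF that] by (auto intro: le_less_trans)
  qed
  show "integrable (tensor_measure \<mu> n) (\<lambda>x. (\<Prod>i<n. indicator (A i) (x i)) *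
      (\<Prod>i<n. indicator (A' i) ((\<lambda>i\<in>{..<n}. x (\<pi> i)) i)) :: real)"
    unfolding eq by (rule integral_tensor_indicator(1)[OF fin])
  show "(\<integral>x. (\<Prod>i<n. indicator (A i) (x i)) *
      (\<Prod>i<n. indicator (A' i) ((\<lambda>i\<in>{..<n}. x (\<pi> i)) i)) \<partial>tensor_measure \<mu> n) =
      (\<Prod>i<n. measure \<mu> (A i \<inter> A' (inv \<pi> i)))"
    unfolding eq by (rule integral_tensor_indicator(2)[OF fin])
qed

lemma measurable_elementary_integral:
  assumes "elementary_sets \<mu> n K A"
  shows "elementary_integral \<mu> N n K c A \<in> borel_measurable M"
  unfolding elementary_integral_def[abs_def] using assms
  by (intro borel_measurable_sum borel_measurable_times borel_measurable_const borel_measurable_prod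
      measurable_compensated) (auto simp: elementary_sets_def)

lemma integrable_elementary_kernel_mult:
  assumes "elementary_sets \<mu> n K A" "elementary_sets \<mu> n K' A'" "\<pi> permutes {..<n}"
  shows "integrable (tensor_measure \<mu> n) (\<lambda>x. elementary_kernel n K c A x *
    elementary_kernel n K' c' A' (\<lambda>i\<in>{..<n}. x (\<pi> i)))"
proof -
  have "integrable (tensor_measure \<mu> n) (\<lambda>x. (c k * c' k') * ((\<Prod>i<n. indicator (A k i) (x i)) *
      (\<Prod>i<n. indicator (A' k' i) ((\<lambda>i\<in>{..<n}. x (\<pi> i)) i))))" if "k \<in> K" "k' \<in> K'" for k k'
    using assms that
    by (intro integrable_mult_right integral_elementary_permute) (auto simp: elementary_sets_def)
  then show ?thesis
    unfolding elementary_kernel_def sum_product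
    by (intro Bochner_Integration.integrable_sum) (simp add: mult_ac)
qed

lemma integrable_elementary_integral_mult:
  assumes "elementary_sets \<mu> n K A" "elementary_sets \<mu> n' K' A'"
  shows "integrable M (\<lambda>\<omega>. elementary_integral \<mu> N n K c A \<omega> * elementary_integral \<mu> N n' K' c' A' \<omega>)"
proof -
  have "integrable M (\<lambda>\<omega>. (c k * c' k') * ((\<Prod>i<n. compensated \<mu> N (A k i) \<omega>) *
      (\<Prod>i<n'. compensated \<mu> N (A' k' i) \<omega>)))" if "k \<in> K" "k' \<in> K'" for k k'
    using assms that
    by (intro integrable_mult_right expectation_elementary) (auto simp: elementary_sets_def)
  then show ?thesis
    unfolding elementary_integral_def sum_product
    by (intro Bochner_Integration.integrable_sum) (simp add: mult_ac)
qed

text \<open>Bilinear extension of \<open>expectation_elementary\<close>. The integral of the kernels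
  produces \<open>inv \<pi>\<close> where the expectation has \<open>\<pi>\<close>, which is
  immaterial after summing over all permutations. Integrals of different orders are
  orthogonal.\<close>

lemma elementary_isometry:
  assumes E: "elementary_sets \<mu> n K A" and E': "elementary_sets \<mu> n' K' A'"
  shows "expectation (\<lambda>\<omega>. elementary_integral \<mu> N n K c A \<omega> * elementary_integral \<mu> N n' K' c' A' \<omega>) =
    (if n = n' then \<Sum>\<pi> | \<pi> permutes {..<n}. \<integral>x. elementary_kernel n K c A x *
      elementary_kernel n K' c' A' (\<lambda>i\<in>{..<n}. x (\<pi> i)) \<partial>tensor_measure \<mu> n else 0)"
proof -
  have "expectation (\<lambda>\<omega>. elementary_integral \<mu> N n K c A \<omega> * elementary_integral \<mu> N n' K' c' A' \<omega>) =
      expectation (\<lambda>\<omega>. \<Sum>k\<in>K. \<Sum>k'\<in>K'. (c k * c' k') * ((\<Prod>i<n. compensated \<mu> N (A k i) \<omega>) *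
      (\<Prod>i<n'. compensated \<mu> N (A' k' i) \<omega>)))"
    unfolding elementary_integral_def sum_product by (simp add: mult_ac)
  also have "\<dots> = (\<Sum>k\<in>K. \<Sum>k'\<in>K'. (c k * c' k') * expectation (\<lambda>\<omega>. (\<Prod>i<n. compensated \<mu> N (A k i) \<omega>) *
      (\<Prod>i<n'. compensated \<mu> N (A' k' i) \<omega>)))"
  proof -
    have int: "integrable M (\<lambda>\<omega>. (c k * c' k') * ((\<Prod>i<n. compensated \<mu> N (A k i) \<omega>) *
      (\<Prod>i<n'. compensated \<mu> N (A' k' i) \<omega>)))" if "k \<in> K" "k' \<in> K'" for k k'
      using E E' that
      by (intro integrable_mult_right expectation_elementary) (auto simp: elementary_sets_def)
    show ?thesis
      using int by (simp add: Bochner_Integration.integral_sum Bochner_Integration.integrable_sum)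
  qed
  also have "\<dots> = (\<Sum>k\<in>K. \<Sum>k'\<in>K'. (c k * c' k') *
      (if n = n' then \<Sum>\<pi> | \<pi> permutes {..<n}. \<Prod>i<n. measure \<mu> (A k i \<inter> A' k' (\<pi> i)) else 0))"
    using E E' by (intro sum.cong refl arg_cong2[where f = "(*)"] expectation_elementary(2))
      (auto simp: elementary_sets_def)
  also have "\<dots> = (if n = n' then \<Sum>\<pi> | \<pi> permutes {..<n}. \<integral>x. elementary_kernel n K c A x *
      elementary_kernel n K' c' A' (\<lambda>i\<in>{..<n}. x (\<pi> i)) \<partial>tensor_measure \<mu> n else 0)"
  proof (cases "n = n'")
    case True
    have "(\<integral>x. elementary_kernel n K c A x *
        elementary_kernel n K' c' A' (\<lambda>i\<in>{..<n}. x (\<pi> i)) \<partial>tensor_measure \<mu> n) =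
        (\<Sum>k\<in>K. \<Sum>k'\<in>K'. (c k * c' k') * (\<Prod>i<n. measure \<mu> (A k i \<inter> A' k' (inv \<pi> i))))"
      if p: "\<pi> permutes {..<n}" for \<pi>
    proof -
      have int: "integrable (tensor_measure \<mu> n) (\<lambda>x. (c k * c' k') * ((\<Prod>i<n. indicator (A k i) (x i)) *
          (\<Prod>i<n. indicator (A' k' i) ((\<lambda>i\<in>{..<n}. x (\<pi> i)) i))))" if "k \<in> K" "k' \<in> K'" for k k'
        using E E' that p True
        by (intro integrable_mult_right integral_elementary_permute) (auto simp: elementary_sets_def)
      have "(\<integral>x. elementary_kernel n K c A x *
          elementary_kernel n K' c' A' (\<lambda>i\<in>{..<n}. x (\<pi> i)) \<partial>tensor_measure \<mu> n) =
        (\<integral>x. (\<Sum>k\<in>K. \<Sum>k'\<in>K'. (c k * c' k') * ((\<Prod>i<n. indicator (A k i) (x i)) *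
          (\<Prod>i<n. indicator (A' k' i) ((\<lambda>i\<in>{..<n}. x (\<pi> i)) i)))) \<partial>tensor_measure \<mu> n)"
        unfolding elementary_kernel_def sum_product by (simp only: mult_ac)
      also have "\<dots> = (\<Sum>k\<in>K. \<Sum>k'\<in>K'. (\<integral>x. (c k * c' k') * ((\<Prod>i<n. indicator (A k i) (x i)) *
          (\<Prod>i<n. indicator (A' k' i) ((\<lambda>i\<in>{..<n}. x (\<pi> i)) i))) \<partial>tensor_measure \<mu> n))"
        by (subst Bochner_Integration.integral_sum,
            intro Bochner_Integration.integrable_sum int, assumption+,
            intro sum.cong refl Bochner_Integration.integral_sum int)
      also have "\<dots> = (\<Sum>k\<in>K. \<Sum>k'\<in>K'. (c k * c' k') * (\<Prod>i<n. measure \<mu> (A k i \<inter> A' k' (inv \<pi> i))))"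
        unfolding integral_mult_right_zero
        using E E' p True
        by (intro sum.cong refl arg_cong2[where f = "(*)"] integral_elementary_permute(2))
          (auto simp: elementary_sets_def)
      finally show ?thesis .
    qed
    then have "(\<Sum>\<pi> | \<pi> permutes {..<n}. \<integral>x. elementary_kernel n K c A x *
        elementary_kernel n K' c' A' (\<lambda>i\<in>{..<n}. x (\<pi> i)) \<partial>tensor_measure \<mu> n) =
      (\<Sum>\<pi> | \<pi> permutes {..<n}.
        \<Sum>k\<in>K. \<Sum>k'\<in>K'. (c k * c' k') * (\<Prod>i<n. measure \<mu> (A k i \<inter> A' k' (inv \<pi> i))))"
      by (intro sum.cong) auto
    also have "\<dots> = (\<Sum>\<pi> | \<pi> permutes {..<n}.
        \<Sum>k\<in>K. \<Sum>k'\<in>K'. (c k * c' k') * (\<Prod>i<n. measure \<mu> (A k i \<inter> A' k' (\<pi> i))))"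
      by (rule sum_permutations_inverse[symmetric])
    also have "\<dots> = (\<Sum>k\<in>K. \<Sum>k'\<in>K'. \<Sum>\<pi> | \<pi> permutes {..<n}.
        (c k * c' k') * (\<Prod>i<n. measure \<mu> (A k i \<inter> A' k' (\<pi> i))))"
      by (subst sum.swap, intro sum.cong refl, subst sum.swap, rule refl)
    finally show ?thesis
      using True by (simp add: sum_distrib_left)
  qed simp
  finally show ?thesis .
qed

lemma sqi_elementary_finite:
  assumes E: "elementary_sets \<mu> n K A"
  shows "sqi M (elementary_integral \<mu> N n K c A) < \<infinity>"
    and "sqi (tensor_measure \<mu> n) (elementary_kernel n K c A) < \<infinity>"
proof -
  have "integrable M (\<lambda>\<omega>. (elementary_integral \<mu> N n K c A \<omega>)\<^sup>2)"
    using integrable_elementary_integral_mult[OF E E] by (simp add: power2_eq_square)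
  then show "sqi M (elementary_integral \<mu> N n K c A) < \<infinity>"
    by (simp add: integrable_power2_iff measurable_elementary_integral[OF E])
  have "integrable (tensor_measure \<mu> n) (\<lambda>x. (elementary_kernel n K c A x)\<^sup>2)"
  proof (rule Bochner_Integration.integrable_cong[THEN iffD1, OF refl])
    show "integrable (tensor_measure \<mu> n) (\<lambda>x. elementary_kernel n K c A x *
        elementary_kernel n K c A (\<lambda>i\<in>{..<n}. x (id i)))"
      by (rule integrable_elementary_kernel_mult[OF E E permutes_id])
    show "elementary_kernel n K c A x * elementary_kernel n K c A (\<lambda>i\<in>{..<n}. x (id i)) =
        (elementary_kernel n K c A x)\<^sup>2" for x
      by (simp add: elementary_kernel_def power2_eq_square)
  qed
  then show "sqi (tensor_measure \<mu> n) (elementary_kernel n K c A) < \<infinity>"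
    by (simp add: integrable_power2_iff measurable_elementary_kernel[OF E])
qed

text \<open>
  Twice \<open>E S\<^sup>2\<close> is \<open>\<Sum>\<^sub>\<pi> 2 \<integral> g (g \<circ> \<pi>)\<close>, and \<open>2 g (g \<circ> \<pi>) = g\<^sup>2 + (g \<circ> \<pi>)\<^sup>2 - (g \<circ> \<pi> - g)\<^sup>2\<close>.
\<close>

lemma sqi_elementary_integral:
  fixes c :: "'k \<Rightarrow> real"
  assumes E: "elementary_sets \<mu> n K A"
  defines "g \<equiv> elementary_kernel n K c A"
  shows "2 * sqi M (elementary_integral \<mu> N n K c A) +
      (\<Sum>\<pi> | \<pi> permutes {..<n}. sqi (tensor_measure \<mu> n) (\<lambda>x. g (\<lambda>i\<in>{..<n}. x (\<pi> i)) - g x)) =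
    2 * fact n * sqi (tensor_measure \<mu> n) g"
proof -
  let ?T = "tensor_measure \<mu> n"
  let ?p = "\<lambda>\<pi> x. \<lambda>i\<in>{..<n}. x (\<pi> i)"
  let ?S = "elementary_integral \<mu> N n K c A"
  have g[measurable]: "g \<in> borel_measurable ?T"
    unfolding g_def by (rule measurable_elementary_kernel[OF E])
  have fin: "sqi ?T g < \<infinity>" unfolding g_def by (rule sqi_elementary_finite(2)[OF E])
  have int_g: "integrable ?T (\<lambda>x. (g x)\<^sup>2)" using fin by (simp add: integrable_power2_iff)
  have int_S: "integrable M (\<lambda>\<omega>. (?S \<omega>)\<^sup>2)"
    using sqi_elementary_finite(1)[OF E] by (simp add: integrable_power2_iff measurable_elementary_integral[OF E])
  have pi: "integrable ?T (\<lambda>x. (g (?p \<pi> x) - g x)\<^sup>2) \<and>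
      (\<integral>x. (g (?p \<pi> x) - g x)\<^sup>2 \<partial>?T) = 2 * (\<integral>x. (g x)\<^sup>2 \<partial>?T) - 2 * (\<integral>x. g x * g (?p \<pi> x) \<partial>?T)"
    if p: "\<pi> permutes {..<n}" for \<pi>
  proof -
    have [measurable]: "(\<lambda>x. g (?p \<pi> x)) \<in> borel_measurable ?T"
      by (rule measurable_compose[OF measurable_permute[OF p] g])
    have "sqi ?T (\<lambda>x. g (?p \<pi> x)) = sqi ?T g" by (rule sqi_permute[OF p g])
    then have i1: "integrable ?T (\<lambda>x. (g (?p \<pi> x))\<^sup>2)" and
      e1: "ennreal (\<integral>x. (g (?p \<pi> x))\<^sup>2 \<partial>?T) = ennreal (\<integral>x. (g x)\<^sup>2 \<partial>?T)"
      using fin int_g by (simp_all add: integrable_power2_iff sqi_eq_integral[symmetric])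
    from e1 have e1': "(\<integral>x. (g (?p \<pi> x))\<^sup>2 \<partial>?T) = (\<integral>x. (g x)\<^sup>2 \<partial>?T)"
      by (subst (asm) ennreal_inj) auto
    have i2: "integrable ?T (\<lambda>x. g x * g (?p \<pi> x))"
      unfolding g_def by (rule integrable_elementary_kernel_mult[OF E E p])
    have sq: "(g (?p \<pi> x) - g x)\<^sup>2 = (g (?p \<pi> x))\<^sup>2 + (g x)\<^sup>2 - 2 * (g x * g (?p \<pi> x))" for x
      by (simp add: power2_diff mult_ac)
    show ?thesis
      unfolding sq using i1 i2 int_g e1' by simp
  qed
  have "(\<Sum>\<pi> | \<pi> permutes {..<n}. sqi ?T (\<lambda>x. g (?p \<pi> x) - g x)) =
      (\<Sum>\<pi> | \<pi> permutes {..<n}. ennreal (\<integral>x. (g (?p \<pi> x) - g x)\<^sup>2 \<partial>?T))"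
    using pi by (intro sum.cong) (auto simp: sqi_eq_integral)
  also have "\<dots> = ennreal (\<Sum>\<pi> | \<pi> permutes {..<n}. (\<integral>x. (g (?p \<pi> x) - g x)\<^sup>2 \<partial>?T))"
    by (rule sum_ennreal) simp
  finally have 1: "(\<Sum>\<pi> | \<pi> permutes {..<n}. sqi ?T (\<lambda>x. g (?p \<pi> x) - g x)) =
    ennreal (\<Sum>\<pi> | \<pi> permutes {..<n}. (\<integral>x. (g (?p \<pi> x) - g x)\<^sup>2 \<partial>?T))" .
  have "(\<Sum>\<pi> | \<pi> permutes {..<n}. (\<integral>x. (g (?p \<pi> x) - g x)\<^sup>2 \<partial>?T)) =
      (\<Sum>\<pi> | \<pi> permutes {..<n}. 2 * (\<integral>x. (g x)\<^sup>2 \<partial>?T) - 2 * (\<integral>x. g x * g (?p \<pi> x) \<partial>?T))"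
    using pi by (intro sum.cong) auto
  also have "\<dots> = 2 * fact n * (\<integral>x. (g x)\<^sup>2 \<partial>?T) -
      2 * (\<Sum>\<pi> | \<pi> permutes {..<n}. \<integral>x. g x * g (?p \<pi> x) \<partial>?T)"
    by (simp add: sum_subtractf sum_distrib_left[symmetric] card_permutations[of "{..<n}" n])
  also have "(\<Sum>\<pi> | \<pi> permutes {..<n}. \<integral>x. g x * g (?p \<pi> x) \<partial>?T) = expectation (\<lambda>\<omega>. (?S \<omega>)\<^sup>2)"
    unfolding g_def power2_eq_square elementary_isometry[OF E E] by simp
  finally have 2: "(\<Sum>\<pi> | \<pi> permutes {..<n}. (\<integral>x. (g (?p \<pi> x) - g x)\<^sup>2 \<partial>?T)) =
    2 * fact n * (\<integral>x. (g x)\<^sup>2 \<partial>?T) - 2 * expectation (\<lambda>\<omega>. (?S \<omega>)\<^sup>2)" .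
  \<comment> \<open>The identity is kept in additive form, since subtraction in
    \<open>ennreal\<close> truncates.\<close>
  have "2 * sqi M ?S + (\<Sum>\<pi> | \<pi> permutes {..<n}. sqi ?T (\<lambda>x. g (?p \<pi> x) - g x)) =
      ennreal (2 * expectation (\<lambda>\<omega>. (?S \<omega>)\<^sup>2)) +
      ennreal (\<Sum>\<pi> | \<pi> permutes {..<n}. (\<integral>x. (g (?p \<pi> x) - g x)\<^sup>2 \<partial>?T))"
    unfolding 1 sqi_eq_integral[OF int_S] by (simp add: ennreal_mult')
  also have "\<dots> = ennreal (2 * fact n * (\<integral>x. (g x)\<^sup>2 \<partial>?T))"
    by (subst ennreal_plus[symmetric]) (auto simp: 2[symmetric] intro!: sum_nonneg, simp add: 2)
  also have "\<dots> = 2 * fact n * sqi ?T g"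
    unfolding sqi_eq_integral[OF int_g]
    by (simp add: ennreal_mult' ennreal_of_nat_eq_real_of_nat[of "fact n", simplified])
  finally show ?thesis .
qed

end

section \<open>Lower bound for the Malliavin derivative\<close>

lemma finite_injective_indices: "finite (injective_indices n p)"
  unfolding injective_indices_def
  by (rule finite_subset[of _ "{..<n} \<rightarrow>\<^sub>E {..<p}"]) (auto intro!: finite_PiE)

lemma elementary_sets_step:
  assumes A: "\<forall>i<p. A i \<in> sets \<mu> \<and> emeasure \<mu> (A i) < \<infinity>" and disj: "disjoint_family_on A {..<p}"
  shows "elementary_sets \<mu> n (injective_indices n p) (\<lambda>j i. A (j i))"
  unfolding elementary_sets_def
proof (intro conjI ballI allI impI finite_injective_indices)
  fix j assume "j \<in> injective_indices n p"
  then have inj: "inj_on j {..<n}" and j: "\<And>i. i < n \<Longrightarrow> j i < p"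
    by (auto simp: injective_indices_def PiE_iff)
  show "A (j i) \<in> sets \<mu>" "emeasure \<mu> (A (j i)) < \<infinity>" if "i < n" for i
    using A j[OF that] by auto
  show "disjoint_family_on (\<lambda>i. A (j i)) {..<n}"
    unfolding disjoint_family_on_def
  proof (intro ballI impI)
    fix i k assume "i \<in> {..<n}" "k \<in> {..<n}" "i \<noteq> k"
    then have "j i \<noteq> j k" "j i < p" "j k < p" using inj j by (auto dest: inj_onD)
    then show "A (j i) \<inter> A (j k) = {}" using disj by (auto simp: disjoint_family_on_def)
  qed
qed

lemma l2norm_tendsto_0_sqi:
  assumes "(\<lambda>k. l2norm M (X k)) \<longlonglongrightarrow> 0" "0 < \<epsilon>"
  shows "eventually (\<lambda>k. sqi M (X k) \<le> ennreal \<epsilon>) sequentially"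
proof -
  have "eventually (\<lambda>k. l2norm M (X k) < ennreal (sqrt \<epsilon>)) sequentially"
    using assms by (intro order_tendstoD(2)) auto
  then show ?thesis
  proof eventually_elim
    case (elim k)
    then have "(l2norm M (X k))\<^sup>2 \<le> (ennreal (sqrt \<epsilon>))\<^sup>2"
      by (intro power_mono) auto
    then show ?case using assms(2) by (simp add: l2norm_power2 ennreal_power)
  qed
qed

text \<open>The approximating sequences in the definition of the multiple integral enter only
  through this lemma, which picks one member that is good for the kernel and the integral at
  once.\<close>

lemma multiple_integral_approx:
  assumes J: "is_multiple_integral M \<mu> N n f J" and "0 < \<epsilon>"
  obtains K :: "(nat \<Rightarrow> nat) set" and c A where "elementary_sets \<mu> n K A"
    "sqi (tensor_measure \<mu> n) (\<lambda>x. f x - elementary_kernel n K c A x) \<le> ennreal \<epsilon>"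
    "sqi M (\<lambda>\<omega>. J \<omega> - elementary_integral \<mu> N n K c A \<omega>) \<le> ennreal \<epsilon>"
proof -
  from J obtain p A c where A: "\<And>k. (\<forall>i<p k. A k i \<in> sets \<mu> \<and> emeasure \<mu> (A k i) < \<infinity>) \<and>
             disjoint_family_on (A k) {..<p k}"
    and 1: "(\<lambda>k. l2norm (tensor_measure \<mu> n) (\<lambda>x. f x - step_kernel n (p k) (A k) (c k) x)) \<longlonglongrightarrow> 0"
    and 2: "(\<lambda>k. l2norm M (\<lambda>\<omega>. J \<omega> - step_integral \<mu> N n (p k) (A k) (c k) \<omega>)) \<longlonglongrightarrow> 0"
    unfolding is_multiple_integral_def by blast
  from eventually_conj[OF l2norm_tendsto_0_sqi[OF 1 \<open>0 < \<epsilon>\<close>] l2norm_tendsto_0_sqi[OF 2 \<open>0 < \<epsilon>\<close>]]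
  obtain k where "sqi (tensor_measure \<mu> n) (\<lambda>x. f x - step_kernel n (p k) (A k) (c k) x) \<le> ennreal \<epsilon>"
    "sqi M (\<lambda>\<omega>. J \<omega> - step_integral \<mu> N n (p k) (A k) (c k) \<omega>) \<le> ennreal \<epsilon>"
    by (auto dest: eventually_happens)
  then show thesis
    using A[of k] by (intro that[OF elementary_sets_step[of "p k" "A k"]])
      (auto simp: elementary_kernel_def elementary_integral_def step_kernel_def step_integral_def)
qed

text \<open>The order \<open>r i\<close> is kept apart from the index \<open>i\<close>: it is
  \<open>n\<close> in the expansion of \<open>F\<close>, but \<open>n - 1\<close> in that of its
  derivative.\<close>

lemma multiple_integral_approx_family:
  fixes r :: "'i \<Rightarrow> nat"
  assumes J: "\<And>i. i \<in> I \<Longrightarrow> is_multiple_integral M \<mu> N (r i) (h i) (J i)" and "0 < \<epsilon>"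
  obtains K :: "'i \<Rightarrow> (nat \<Rightarrow> nat) set" and c A where
    "\<forall>i\<in>I. elementary_sets \<mu> (r i) (K i) (A i)"
    "\<forall>i\<in>I.
      sqi (tensor_measure \<mu> (r i)) (\<lambda>x. h i x - elementary_kernel (r i) (K i) (c i) (A i) x) \<le> ennreal \<epsilon>"
    "\<forall>i\<in>I. sqi M (\<lambda>\<omega>. J i \<omega> - elementary_integral \<mu> N (r i) (K i) (c i) (A i) \<omega>) \<le> ennreal \<epsilon>"
proof -
  define good where "good i = (\<lambda>(K :: (nat \<Rightarrow> nat) set, c, A). elementary_sets \<mu> (r i) K A \<and>
    sqi (tensor_measure \<mu> (r i)) (\<lambda>x. h i x - elementary_kernel (r i) K c A x) \<le> ennreal \<epsilon> \<and>
    sqi M (\<lambda>\<omega>. J i \<omega> - elementary_integral \<mu> N (r i) K c A \<omega>) \<le> ennreal \<epsilon>)" for i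
  have "\<exists>t. good i t" if i: "i \<in> I" for i
  proof (rule multiple_integral_approx[OF J[OF i] \<open>0 < \<epsilon>\<close>])
    fix K :: "(nat \<Rightarrow> nat) set" and c A
    assume "elementary_sets \<mu> (r i) K A"
      "sqi (tensor_measure \<mu> (r i)) (\<lambda>x. h i x - elementary_kernel (r i) K c A x) \<le> ennreal \<epsilon>"
      "sqi M (\<lambda>\<omega>. J i \<omega> - elementary_integral \<mu> N (r i) K c A \<omega>) \<le> ennreal \<epsilon>"
    then have "good i (K, c, A)" by (simp add: good_def)
    then show "\<exists>t. good i t" ..
  qed
  then obtain t where t: "\<And>i. i \<in> I \<Longrightarrow> good i (t i)"
    using bchoice[of I good] by blast
  show thesis
    by (rule that[of "\<lambda>i. fst (t i)" "\<lambda>i. snd (snd (t i))" "\<lambda>i. fst (snd (t i))"])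
      (use t in \<open>simp_all add: good_def split_beta\<close>)
qed

lemma sqi_sum_orthogonal:
  assumes "finite I"
    and X[measurable]: "\<And>i. i \<in> I \<Longrightarrow> X i \<in> borel_measurable M"
    and fin: "\<And>i. i \<in> I \<Longrightarrow> sqi M (X i) < \<infinity>"
    and orth: "\<And>i j. i \<in> I \<Longrightarrow> j \<in> I \<Longrightarrow> i \<noteq> j \<Longrightarrow> (\<integral>x. X i x * X j x \<partial>M) = 0"
  shows "sqi M (\<lambda>x. \<Sum>i\<in>I. X i x) = (\<Sum>i\<in>I. sqi M (X i))"
proof -
  have int: "integrable M (\<lambda>x. X i x * X j x)" if "i \<in> I" "j \<in> I" for i j
    using that fin by (intro integrable_mult_L2) auto
  have sq: "(\<Sum>i\<in>I. X i x)\<^sup>2 = (\<Sum>i\<in>I. \<Sum>j\<in>I. X i x * X j x)" for x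
    by (simp add: power2_eq_square sum_product)
  have "integrable M (\<lambda>x. (\<Sum>i\<in>I. X i x)\<^sup>2)"
    unfolding sq by (intro Bochner_Integration.integrable_sum int)
  then have "sqi M (\<lambda>x. \<Sum>i\<in>I. X i x) = ennreal (\<integral>x. (\<Sum>i\<in>I. X i x)\<^sup>2 \<partial>M)"
    by (rule sqi_eq_integral)
  also have "(\<integral>x. (\<Sum>i\<in>I. X i x)\<^sup>2 \<partial>M) = (\<Sum>i\<in>I. \<Sum>j\<in>I. (\<integral>x. X i x * X j x \<partial>M))"
    unfolding sq
    by (subst Bochner_Integration.integral_sum,
        intro Bochner_Integration.integrable_sum int, assumption+,
        intro sum.cong refl Bochner_Integration.integral_sum int)
  also have "\<dots> = (\<Sum>i\<in>I. \<Sum>j\<in>I. if j = i then (\<integral>x. (X i x)\<^sup>2 \<partial>M) else 0)"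
    using orth by (intro sum.cong refl) (auto simp: power2_eq_square)
  also have "\<dots> = (\<Sum>i\<in>I. \<integral>x. (X i x)\<^sup>2 \<partial>M)"
    using assms(1) by simp
  also have "ennreal \<dots> = (\<Sum>i\<in>I. ennreal (\<integral>x. (X i x)\<^sup>2 \<partial>M))"
    by (rule sum_ennreal[symmetric]) simp
  also have "\<dots> = (\<Sum>i\<in>I. sqi M (X i))"
    using int by (intro sum.cong refl sqi_eq_integral[symmetric]) (simp add: power2_eq_square)
  finally show ?thesis .
qed

context poisson_noise
begin

text \<open>The sum over permutations in \<open>sqi_elementary_integral\<close> is nonnegative and
  is dropped, so the bound covers kernels without symmetry.\<close>

lemma sqi_elementary_integral_le:
  assumes E: "elementary_sets \<mu> n K A"
  shows "sqi M (elementary_integral \<mu> N n K c A) \<le> fact n * sqi (tensor_measure \<mu> n) (elementary_kernel n K c A)"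
proof -
  have "2 * sqi M (elementary_integral \<mu> N n K c A) \<le>
      2 * (fact n * sqi (tensor_measure \<mu> n) (elementary_kernel n K c A))"
    unfolding mult.assoc[symmetric] sqi_elementary_integral[OF E, symmetric] by simp
  then show ?thesis by (subst (asm) ennreal_mult_le_mult_iff) auto
qed

text \<open>With \<open>d\<close> the squared distance of \<open>g\<close> to the symmetric
  \<open>f\<close>, each of the \<open>n!\<close> defects in \<open>sqi_elementary_integral\<close>
  is at most \<open>4 * d\<close>. Returning from \<open>g\<close> to \<open>f\<close> costs another
  \<open>2 * d\<close>, hence the 6.\<close>

lemma sqi_elementary_integral_ge:
  fixes c :: "'k \<Rightarrow> real"
  assumes E: "elementary_sets \<mu> n K A"
    and sym: "symmetric_kernel \<mu> n f" and f[measurable]: "f \<in> borel_measurable (tensor_measure \<mu> n)"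
  defines "g \<equiv> elementary_kernel n K c A"
  shows "fact n * sqi (tensor_measure \<mu> n) f \<le>
    2 * sqi M (elementary_integral \<mu> N n K c A) + 6 * fact n * sqi (tensor_measure \<mu> n) (\<lambda>x. f x - g x)"
proof -
  let ?T = "tensor_measure \<mu> n"
  let ?p = "\<lambda>\<pi> x. \<lambda>i\<in>{..<n}. x (\<pi> i)"
  let ?S = "elementary_integral \<mu> N n K c A"
  let ?d = "sqi ?T (\<lambda>x. f x - g x)"
  have g[measurable]: "g \<in> borel_measurable ?T"
    unfolding g_def by (rule measurable_elementary_kernel[OF E])
  have "sqi ?T (\<lambda>x. g (?p \<pi> x) - g x) \<le> 4 * ?d" if p: "\<pi> permutes {..<n}" for \<pi>
  proof -
    have [measurable]: "(\<lambda>x. g (?p \<pi> x)) \<in> borel_measurable ?T"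
      by (rule measurable_compose[OF measurable_permute[OF p] g])
    have "sqi ?T (\<lambda>x. g (?p \<pi> x) - g x) \<le> 2 * sqi ?T (\<lambda>x. g (?p \<pi> x) - f x) + 2 * ?d"
      by (rule sqi_triangle) auto
    \<comment> \<open>Symmetry replaces \<open>f x\<close> by its value at the permuted point; then
      the whole difference is permuted, which preserves the norm.\<close>
    also have "sqi ?T (\<lambda>x. g (?p \<pi> x) - f x) = sqi ?T (\<lambda>x. (\<lambda>x. g x - f x) (?p \<pi> x))"
      using sym p unfolding symmetric_kernel_def
      by (intro sqi_cong_AE) (auto elim!: allE[of _ \<pi>])
    also have "\<dots> = sqi ?T (\<lambda>x. g x - f x)"
      by (rule sqi_permute[OF p]) simp
    also have "\<dots> = ?d" by (rule sqi_minus_commute)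
    also have "2 * ?d + 2 * ?d = 4 * ?d" by (simp add: distrib_right[symmetric])
    finally show ?thesis .
  qed
  then have "(\<Sum>\<pi> | \<pi> permutes {..<n}. sqi ?T (\<lambda>x. g (?p \<pi> x) - g x)) \<le>
      (\<Sum>\<pi> | \<pi> permutes {..<n}. 4 * ?d)"
    by (intro sum_mono) auto
  also have "\<dots> = fact n * (4 * ?d)"
    by (simp add: card_permutations[of "{..<n}" n])
  finally have "2 * fact n * sqi ?T g \<le> 2 * sqi M ?S + fact n * (4 * ?d)"
    unfolding g_def sqi_elementary_integral[OF E, symmetric] by (intro add_left_mono) simp
  moreover
  have "sqi ?T f \<le> 2 * ?d + 2 * sqi ?T g"
    using sqi_add[of "\<lambda>x. f x - g x" ?T g] by simp
  then have "fact n * sqi ?T f \<le> fact n * (2 * ?d + 2 * sqi ?T g)"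
    by (rule mult_left_mono) simp
  then have "fact n * sqi ?T f \<le> fact n * (2 * ?d) + 2 * fact n * sqi ?T g"
    by (simp only: distrib_left mult_ac)
  ultimately have "fact n * sqi ?T f \<le> fact n * (2 * ?d) + (2 * sqi M ?S + fact n * (4 * ?d))"
    by (blast intro: order_trans add_left_mono)
  also have "\<dots> = 2 * sqi M ?S + (fact n * (2 * ?d) + fact n * (4 * ?d))"
    by (simp only: add_ac)
  also have "fact n * (2 * ?d) + fact n * (4 * ?d) = 6 * fact n * ?d"
  proof -
    have "fact n * (2 * ?d) + fact n * (4 * ?d) = fact n * ((2 + 4) * ?d)"
      by (simp only: distrib_left distrib_right)
    then show ?thesis by (simp add: mult_ac)
  qed
  finally show ?thesis .
qed

text \<open>Injectivity of \<open>r\<close> makes the approximating elementary integrals orthogonal,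
  so their squared norms add up. The 4 is the product of the 2 in
  \<open>sqi_elementary_integral_ge\<close> and the 2 lost in passing from the elementary integrals
  to the \<open>J i\<close>.\<close>

lemma multiple_integral_sum_ge:
  fixes r :: "'i \<Rightarrow> nat"
  assumes fin: "finite I" and inj: "inj_on r I"
    and J: "\<And>i. i \<in> I \<Longrightarrow> is_multiple_integral M \<mu> N (r i) (h i) (J i)"
    and sym: "\<And>i. i \<in> I \<Longrightarrow> symmetric_kernel \<mu> (r i) (h i)"
  shows "(\<Sum>i\<in>I. ennreal ((a i)\<^sup>2) * (fact (r i) * sqi (tensor_measure \<mu> (r i)) (h i))) \<le>
    4 * sqi M (\<lambda>\<omega>. \<Sum>i\<in>I. a i * J i \<omega>)"
proof (rule ennreal_le_epsilon)
  fix e :: real assume e: "0 < e"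
  let ?T = "\<lambda>i. tensor_measure \<mu> (r i)"
  \<comment> \<open>The total coefficient of \<open>\<delta>\<close>: 6 times the factorial from the
    kernels, and 2 times 2 times \<open>card I\<close> from the integrals. Dividing by
    \<open>C + 1\<close> also covers \<open>C = 0\<close>.\<close>
  define C where "C = (\<Sum>i\<in>I. (a i)\<^sup>2 * (6 * fact (r i) + 4 * real (card I)))"
  have C: "0 \<le> C" unfolding C_def by (intro sum_nonneg mult_nonneg_nonneg add_nonneg_nonneg) auto
  define \<delta> where "\<delta> = e / (C + 1)"
  have \<delta>: "0 < \<delta>" "C * \<delta> \<le> e"
    using C e by (auto simp: \<delta>_def field_simps)
  obtain K :: "'i \<Rightarrow> (nat \<Rightarrow> nat) set" and c A where fam: "\<forall>i\<in>I. elementary_sets \<mu> (r i) (K i) (A i)"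
    "\<forall>i\<in>I. sqi (?T i) (\<lambda>x. h i x - elementary_kernel (r i) (K i) (c i) (A i) x) \<le> ennreal \<delta>"
    "\<forall>i\<in>I. sqi M (\<lambda>\<omega>. J i \<omega> - elementary_integral \<mu> N (r i) (K i) (c i) (A i) \<omega>) \<le> ennreal \<delta>"
    by (rule multiple_integral_approx_family[OF J \<delta>(1)])
  note E = fam(1)[rule_format] and g = fam(2)[rule_format] and S = fam(3)[rule_format]
  define S' where "S' i = elementary_integral \<mu> N (r i) (K i) (c i) (A i)" for i
  have S'_meas[measurable]: "S' i \<in> borel_measurable M" if "i \<in> I" for i
    unfolding S'_def by (rule measurable_elementary_integral[OF E[OF that]])
  have J_meas[measurable]: "J i \<in> borel_measurable M" if "i \<in> I" for i
    using J[OF that] by (simp add: is_multiple_integral_def square_integrable_iff)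
  have h_meas: "h i \<in> borel_measurable (?T i)" if "i \<in> I" for i
    using J[OF that] by (simp add: is_multiple_integral_def square_integrable_iff)
  have ge: "fact (r i) * sqi (?T i) (h i) \<le> 2 * sqi M (S' i) + 6 * fact (r i) * ennreal \<delta>" if "i \<in> I" for i
    unfolding S'_def
    using sqi_elementary_integral_ge[OF E sym h_meas, OF that that that, of "c i"] g[OF that]
    by (meson add_left_mono mult_left_mono order_trans zero_le)
  have orth: "sqi M (\<lambda>\<omega>. \<Sum>i\<in>I. a i * S' i \<omega>) = (\<Sum>i\<in>I. sqi M (\<lambda>\<omega>. a i * S' i \<omega>))"
  proof (rule sqi_sum_orthogonal[OF fin])
    fix i assume i: "i \<in> I"
    show "(\<lambda>\<omega>. a i * S' i \<omega>) \<in> borel_measurable M" using i by measurable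
    show "sqi M (\<lambda>\<omega>. a i * S' i \<omega>) < \<infinity>"
      using i sqi_elementary_finite(1)[OF E[OF i], of "c i"]
      by (auto simp: sqi_cmult S'_def[symmetric] ennreal_mult_less_top)
    fix j assume j: "j \<in> I" "i \<noteq> j"
    then have "r i \<noteq> r j" using inj i by (auto dest: inj_onD)
    then have "expectation (\<lambda>\<omega>. S' i \<omega> * S' j \<omega>) = 0"
      unfolding S'_def elementary_isometry[OF E[OF i] E[OF j(1)]] by simp
    moreover have "(\<lambda>\<omega>. a i * S' i \<omega> * (a j * S' j \<omega>)) = (\<lambda>\<omega>. (a i * a j) * (S' i \<omega> * S' j \<omega>))"
      by (simp add: mult_ac)
    ultimately show "expectation (\<lambda>\<omega>. a i * S' i \<omega> * (a j * S' j \<omega>)) = 0"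
      by simp
  qed
  have "sqi M (\<lambda>\<omega>. \<Sum>i\<in>I. a i * S' i \<omega>) \<le>
      2 * sqi M (\<lambda>\<omega>. \<Sum>i\<in>I. a i * J i \<omega>) + 2 * sqi M (\<lambda>\<omega>. \<Sum>i\<in>I. a i * (J i \<omega> - S' i \<omega>))"
    using sqi_diff[of "\<lambda>\<omega>. \<Sum>i\<in>I. a i * J i \<omega>" M "\<lambda>\<omega>. \<Sum>i\<in>I. a i * (J i \<omega> - S' i \<omega>)"]
    by (simp add: sum_subtractf[symmetric] right_diff_distrib)
  also have "sqi M (\<lambda>\<omega>. \<Sum>i\<in>I. a i * (J i \<omega> - S' i \<omega>)) \<le>
      of_nat (card I) * (\<Sum>i\<in>I. sqi M (\<lambda>\<omega>. a i * (J i \<omega> - S' i \<omega>)))"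
    by (rule sqi_sum[OF fin]) measurable
  also have "(\<Sum>i\<in>I. sqi M (\<lambda>\<omega>. a i * (J i \<omega> - S' i \<omega>))) \<le> (\<Sum>i\<in>I. ennreal ((a i)\<^sup>2) * ennreal \<delta>)"
    using S by (intro sum_mono) (simp add: sqi_cmult S'_def[symmetric] mult_left_mono)
  finally have main: "sqi M (\<lambda>\<omega>. \<Sum>i\<in>I. a i * S' i \<omega>) \<le>
      2 * sqi M (\<lambda>\<omega>. \<Sum>i\<in>I. a i * J i \<omega>) +
      2 * (of_nat (card I) * (\<Sum>i\<in>I. ennreal ((a i)\<^sup>2) * ennreal \<delta>))"
    by (simp add: add_left_mono mult_left_mono)
  have "(\<Sum>i\<in>I. ennreal ((a i)\<^sup>2) * (fact (r i) * sqi (?T i) (h i))) \<le>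
      (\<Sum>i\<in>I. ennreal ((a i)\<^sup>2) * (2 * sqi M (S' i) + 6 * fact (r i) * ennreal \<delta>))"
    by (intro sum_mono mult_left_mono ge) auto
  also have "\<dots> = 2 * (\<Sum>i\<in>I. sqi M (\<lambda>\<omega>. a i * S' i \<omega>)) + (\<Sum>i\<in>I. ennreal ((a i)\<^sup>2) * (6 * fact (r i) * ennreal \<delta>))"
    by (simp add: sqi_cmult sum_distrib_left distrib_left sum.distrib mult_ac cong: sum.cong)
  also have "\<dots> \<le> 2 * (2 * sqi M (\<lambda>\<omega>. \<Sum>i\<in>I. a i * J i \<omega>) +
      2 * (of_nat (card I) * (\<Sum>i\<in>I. ennreal ((a i)\<^sup>2) * ennreal \<delta>))) +
      (\<Sum>i\<in>I. ennreal ((a i)\<^sup>2) * (6 * fact (r i) * ennreal \<delta>))"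
    unfolding orth[symmetric] by (intro add_right_mono mult_left_mono main) simp
  also have "\<dots> = 4 * sqi M (\<lambda>\<omega>. \<Sum>i\<in>I. a i * J i \<omega>) +
      (4 * (of_nat (card I) * (\<Sum>i\<in>I. ennreal ((a i)\<^sup>2) * ennreal \<delta>)) +
      (\<Sum>i\<in>I. ennreal ((a i)\<^sup>2) * (6 * fact (r i) * ennreal \<delta>)))"
    by (simp only: distrib_left mult.assoc[symmetric] add.assoc) simp
  also have "4 * (of_nat (card I) * (\<Sum>i\<in>I. ennreal ((a i)\<^sup>2) * ennreal \<delta>)) +
      (\<Sum>i\<in>I. ennreal ((a i)\<^sup>2) * (6 * fact (r i) * ennreal \<delta>)) = ennreal (C * \<delta>)"
  proof -
    have fact: "(fact k :: ennreal) = ennreal (fact k)" for k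
      using ennreal_of_nat_eq_real_of_nat[of "fact k"] by simp
    have "4 * (of_nat (card I) * (\<Sum>i\<in>I. ennreal ((a i)\<^sup>2) * ennreal \<delta>)) =
        ennreal (4 * (real (card I) * (\<Sum>i\<in>I. (a i)\<^sup>2 * \<delta>)))"
      using \<delta> by (simp add: ennreal_mult' ennreal_of_nat_eq_real_of_nat sum_nonneg sum_ennreal[symmetric])
    moreover have "(\<Sum>i\<in>I. ennreal ((a i)\<^sup>2) * (6 * fact (r i) * ennreal \<delta>)) =
        ennreal (\<Sum>i\<in>I. (a i)\<^sup>2 * (6 * fact (r i) * \<delta>))"
      unfolding fact using \<delta> by (simp add: ennreal_mult' sum_ennreal[symmetric])
    moreover have "4 * (real (card I) * (\<Sum>i\<in>I. (a i)\<^sup>2 * \<delta>)) + (\<Sum>i\<in>I. (a i)\<^sup>2 * (6 * fact (r i) * \<delta>)) = C * \<delta>"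
      unfolding C_def by (simp add: sum_distrib_left sum_distrib_right sum.distrib[symmetric] algebra_simps)
    moreover have "0 \<le> 4 * (real (card I) * (\<Sum>i\<in>I. (a i)\<^sup>2 * \<delta>))" "0 \<le> (\<Sum>i\<in>I. (a i)\<^sup>2 * (6 * fact (r i) * \<delta>))"
      using \<delta> by (auto intro!: sum_nonneg mult_nonneg_nonneg)
    ultimately show ?thesis by (simp add: ennreal_plus[symmetric] del: ennreal_plus)
  qed
  also have "ennreal (C * \<delta>) \<le> ennreal e" using \<delta>(2) by (rule ennreal_leI)
  finally show "(\<Sum>i\<in>I. ennreal ((a i)\<^sup>2) * (fact (r i) * sqi (?T i) (h i))) \<le>
      4 * sqi M (\<lambda>\<omega>. \<Sum>i\<in>I. a i * J i \<omega>) + ennreal e"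
    by (simp add: add_left_mono)
qed

section \<open>Slices in the last coordinate and the derivative\<close>

lemma nn_integral_tensor_Suc:
  assumes f: "f \<in> borel_measurable (tensor_measure \<mu> (Suc n))"
  shows "(\<integral>\<^sup>+x. f x \<partial>tensor_measure \<mu> (Suc n)) = (\<integral>\<^sup>+\<xi>. (\<integral>\<^sup>+x. f (x(n := \<xi>)) \<partial>tensor_measure \<mu> n) \<partial>\<mu>)"
  using tensor.product_nn_integral_insert_rev[of "{..<n}" n f] f by (simp add: lessThan_Suc)

lemma measurable_slice_pair:
  "(\<lambda>p. (snd p)(n := fst p)) \<in> measurable (\<mu> \<Otimes>\<^sub>M tensor_measure \<mu> n) (tensor_measure \<mu> (Suc n))"
proof -
  have "(\<lambda>p. (snd p)(n := fst p)) \<in> measurable (\<mu> \<Otimes>\<^sub>M tensor_measure \<mu> n) (PiM (insert n {..<n}) (\<lambda>_. \<mu>))"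
    by (rule measurable_fun_upd[where J = "{..<n}"]) auto
  then show ?thesis by (simp add: lessThan_Suc)
qed

lemma measurable_slice:
  assumes "\<xi> \<in> space \<mu>"
  shows "(\<lambda>x. x(n := \<xi>)) \<in> measurable (tensor_measure \<mu> n) (tensor_measure \<mu> (Suc n))"
  using measurable_compose[OF measurable_Pair1'[OF assms] measurable_slice_pair] by simp

lemma measurable_nn_integral_slice:
  assumes "f \<in> borel_measurable (tensor_measure \<mu> (Suc n))"
  shows "(\<lambda>\<xi>. \<integral>\<^sup>+x. f (x(n := \<xi>)) \<partial>tensor_measure \<mu> n) \<in> borel_measurable \<mu>"
proof -
  interpret T: sigma_finite_measure "tensor_measure \<mu> n"
    by (rule tensor.sigma_finite) simp
  have "(\<lambda>p. f ((snd p)(n := fst p))) \<in> borel_measurable (\<mu> \<Otimes>\<^sub>M tensor_measure \<mu> n)"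
    by (rule measurable_compose[OF measurable_slice_pair assms])
  from T.borel_measurable_nn_integral_fst[OF this] show ?thesis by simp
qed

lemma AE_tensor_Suc:
  assumes "AE x in tensor_measure \<mu> (Suc n). P x"
  shows "AE \<xi> in \<mu>. AE x in tensor_measure \<mu> n. P (x(n := \<xi>))"
proof -
  \<comment> \<open>\<open>P\<close> need not be measurable, so a measurable null set containing its
    failures is sliced instead.\<close>
  from assms obtain Z where Z: "{x \<in> space (tensor_measure \<mu> (Suc n)). \<not> P x} \<subseteq> Z"
    "emeasure (tensor_measure \<mu> (Suc n)) Z = 0" and Z_sets[measurable]: "Z \<in> sets (tensor_measure \<mu> (Suc n))"
    by (rule AE_E)
  have "(\<integral>\<^sup>+\<xi>. (\<integral>\<^sup>+x. indicator Z (x(n := \<xi>)) \<partial>tensor_measure \<mu> n) \<partial>\<mu>) = 0"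
    using nn_integral_tensor_Suc[of "indicator Z" n] Z(2) by simp
  then have "AE \<xi> in \<mu>. (\<integral>\<^sup>+x. indicator Z (x(n := \<xi>)) \<partial>tensor_measure \<mu> n) = 0"
    by (subst (asm) nn_integral_0_iff_AE) (auto intro!: measurable_nn_integral_slice)
  then show ?thesis using AE_space
  proof eventually_elim
    case (elim \<xi>)
    note slice = measurable_slice[OF elim(2), of n]
    have "AE x in tensor_measure \<mu> n. indicator Z (x(n := \<xi>)) = (0 :: ennreal)"
      using elim(1) by (subst (asm) nn_integral_0_iff_AE) (auto intro!: measurable_compose[OF slice])
    then show ?case using AE_space
    proof eventually_elim
      case (elim x)
      then have "x(n := \<xi>) \<notin> Z" "x(n := \<xi>) \<in> space (tensor_measure \<mu> (Suc n))"
        using measurable_space[OF slice] by (auto simp: indicator_def split: if_splits)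
      then show ?case using Z(1) by blast
    qed
  qed
qed

text \<open>A permutation of the first \<open>n\<close> indices fixes index \<open>n\<close>, hence
  is a permutation of \<open>n + 1\<close> indices that commutes with inserting
  \<open>\<xi>\<close>. There are finitely many, so one null set of \<open>\<xi>\<close> serves all
  of them.\<close>

lemma symmetric_kernel_slice:
  assumes sym: "symmetric_kernel \<mu> (Suc n) f"
  shows "AE \<xi> in \<mu>. symmetric_kernel \<mu> n (\<lambda>x. f (x(n := \<xi>)))"
proof -
  have "AE \<xi> in \<mu>. AE x in tensor_measure \<mu> n. f ((\<lambda>i\<in>{..<n}. x (\<pi> i))(n := \<xi>)) = f (x(n := \<xi>))"
    if p: "\<pi> permutes {..<n}" for \<pi>
  proof -
    have "\<pi> permutes {..<Suc n}" using p by (rule permutes_subset) auto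
    then have "AE x in tensor_measure \<mu> (Suc n). f (\<lambda>i\<in>{..<Suc n}. x (\<pi> i)) = f x"
      using sym by (simp add: symmetric_kernel_def)
    note AE = AE_tensor_Suc[OF this]
    have eq: "(\<lambda>i\<in>{..<Suc n}. (x(n := \<xi>)) (\<pi> i)) = (\<lambda>i\<in>{..<n}. x (\<pi> i))(n := \<xi>)" for x \<xi>
    proof
      fix i
      have "\<pi> n = n" using p by (simp add: permutes_not_in)
      moreover have "\<pi> i < n" if "i < n" using permutes_in_image[OF p] that by auto
      ultimately show "(\<lambda>i\<in>{..<Suc n}. (x(n := \<xi>)) (\<pi> i)) i = ((\<lambda>i\<in>{..<n}. x (\<pi> i))(n := \<xi>)) i"
        by (cases "i < n"; cases "i = n") auto
    qed
    show ?thesis using AE unfolding eq .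
  qed
  then have "AE \<xi> in \<mu>. \<forall>\<pi>\<in>{\<pi>. \<pi> permutes {..<n}}.
      AE x in tensor_measure \<mu> n. f ((\<lambda>i\<in>{..<n}. x (\<pi> i))(n := \<xi>)) = f (x(n := \<xi>))"
    by (intro AE_finite_allI finite_permutations) auto
  then show ?thesis
    by eventually_elim (auto simp: symmetric_kernel_def)
qed

text \<open>\<open>multiple_integral_sum_ge\<close> is applied with coefficients \<open>n\<close> to
  a partial sum close to \<open>D \<xi>\<close>; the 8 is its 4 times the 2 from
  \<open>sqi_diff\<close>. The expansion of \<open>F\<close> is returned as well, because both
  conclusions must concern the same kernels \<open>f\<close>.\<close>

lemma malliavin_derivative_ge:
  assumes D: "is_malliavin_derivative M \<mu> N F D"
  obtains f where "dom_kernels M \<mu> N F f"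
    "AE \<xi> in \<mu>. \<forall>m. (\<Sum>n=1..m. ennreal ((real n)\<^sup>2) *
       (fact (n - 1) * sqi (tensor_measure \<mu> (n - 1)) (\<lambda>x. f n (x(n - 1 := \<xi>))))) \<le> 8 * sqi M (D \<xi>)"
proof -
  from D obtain f where f: "dom_kernels M \<mu> N F f"
    and AE: "AE \<xi> in \<mu>. square_integrable M (D \<xi>) \<and>
      (\<exists>J. (\<forall>n\<ge>1. is_multiple_integral M \<mu> N (n - 1) (\<lambda>x. f n (x(n - 1 := \<xi>))) (J n)) \<and>
               (\<lambda>m. l2norm M (\<lambda>\<omega>. D \<xi> \<omega> - (\<Sum>n=1..m. real n * J n \<omega>))) \<longlonglongrightarrow> 0)"
    unfolding is_malliavin_derivative_def by blast
  have "AE \<xi> in \<mu>. n \<ge> 1 \<longrightarrow> symmetric_kernel \<mu> (n - 1) (\<lambda>x. f n (x(n - 1 := \<xi>)))" for n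
  proof (cases n)
    case (Suc k)
    have "symmetric_kernel \<mu> (Suc k) (f (Suc k))"
      using f by (simp add: dom_kernels_def chaos_expansion_def)
    from symmetric_kernel_slice[OF this] show ?thesis by eventually_elim (simp add: Suc)
  qed simp
  then have "AE \<xi> in \<mu>. \<forall>n. n \<ge> 1 \<longrightarrow> symmetric_kernel \<mu> (n - 1) (\<lambda>x. f n (x(n - 1 := \<xi>)))"
    by (subst AE_all_countable) blast
  with AE have "AE \<xi> in \<mu>. \<forall>m. (\<Sum>n=1..m. ennreal ((real n)\<^sup>2) *
       (fact (n - 1) * sqi (tensor_measure \<mu> (n - 1)) (\<lambda>x. f n (x(n - 1 := \<xi>))))) \<le> 8 * sqi M (D \<xi>)"
  proof eventually_elim
    case (elim \<xi>)
    then obtain J where J: "\<And>n. n \<ge> 1 \<Longrightarrow> is_multiple_integral M \<mu> N (n - 1) (\<lambda>x. f n (x(n - 1 := \<xi>))) (J n)"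
      and lim: "(\<lambda>m. l2norm M (\<lambda>\<omega>. D \<xi> \<omega> - (\<Sum>n=1..m. real n * J n \<omega>))) \<longlonglongrightarrow> 0"
      and D_meas[measurable]: "D \<xi> \<in> borel_measurable M"
      by (auto simp: square_integrable_def)
    have J_meas[measurable]: "J n \<in> borel_measurable M" if "n \<ge> 1" for n
      using J[OF that] by (simp add: is_multiple_integral_def square_integrable_def)
    let ?t = "\<lambda>n. ennreal ((real n)\<^sup>2) *
       (fact (n - 1) * sqi (tensor_measure \<mu> (n - 1)) (\<lambda>x. f n (x(n - 1 := \<xi>))))"
    show ?case
    proof
      fix m
      show "(\<Sum>n=1..m. ?t n) \<le> 8 * sqi M (D \<xi>)"
      proof (rule ennreal_le_epsilon)
        \<comment> \<open>The remainder of the series enters with factor \<open>4 * 2\<close>, so it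
          is taken below \<open>e / 8\<close>; the partial sum goes up to some
          \<open>k \<ge> m\<close>, and the added terms are nonnegative.\<close>
        fix e :: real assume "0 < e"
        then have "eventually (\<lambda>k. sqi M (\<lambda>\<omega>. D \<xi> \<omega> - (\<Sum>n=1..k. real n * J n \<omega>)) \<le> ennreal (e / 8)) sequentially"
          by (intro l2norm_tendsto_0_sqi[OF lim]) simp
        from eventually_conj[OF this eventually_ge_at_top[of m]] obtain k
          where k: "sqi M (\<lambda>\<omega>. D \<xi> \<omega> - (\<Sum>n=1..k. real n * J n \<omega>)) \<le> ennreal (e / 8)" "m \<le> k"
          by (auto dest: eventually_happens)
        let ?S = "\<lambda>\<omega>. \<Sum>n=1..k. real n * J n \<omega>"
        have [measurable]: "?S \<in> borel_measurable M"
          by (intro borel_measurable_sum borel_measurable_times J_meas) auto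
        have "(\<Sum>n=1..m. ?t n) \<le> (\<Sum>n=1..k. ?t n)"
          using k(2) by (intro sum_mono2) auto
        also have "\<dots> \<le> 4 * sqi M ?S"
          using J elim(2) by (intro multiple_integral_sum_ge) (auto intro!: inj_onI)
        also have "sqi M ?S \<le> 2 * sqi M (D \<xi>) + 2 * sqi M (\<lambda>\<omega>. D \<xi> \<omega> - ?S \<omega>)"
          using sqi_diff[of "D \<xi>" M "\<lambda>\<omega>. D \<xi> \<omega> - ?S \<omega>"] by simp
        also have "sqi M (\<lambda>\<omega>. D \<xi> \<omega> - ?S \<omega>) \<le> ennreal (e / 8)" by (rule k(1))
        finally have "(\<Sum>n=1..m. ?t n) \<le> 4 * (2 * sqi M (D \<xi>) + 2 * ennreal (e / 8))"
          by (simp add: add_left_mono mult_left_mono)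
        also have "\<dots> = 8 * sqi M (D \<xi>) + 8 * ennreal (e / 8)"
          by (simp add: distrib_left mult.assoc[symmetric])
        also have "8 * ennreal (e / 8) = ennreal e"
          using \<open>0 < e\<close> ennreal_mult'[of 8 "e / 8"] by simp
        finally show "(\<Sum>n=1..m. ?t n) \<le> 8 * sqi M (D \<xi>) + ennreal e" .
      qed
    qed
  qed
  with f show thesis by (rule that)
qed

end

section \<open>Restricting kernels to a region\<close>

lemma emeasure_subset_finite:
  assumes "emeasure M A < \<infinity>" "A \<in> sets M" "B \<subseteq> A"
  shows "emeasure M B < \<infinity>"
  using emeasure_mono[OF assms(3,2)] assms(1) by (rule le_less_trans)

lemma disjoint_family_on_shrink:
  assumes "disjoint_family_on A I" "T \<subseteq> I" "\<And>i. B i \<subseteq> A i"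
  shows "disjoint_family_on B T"
  unfolding disjoint_family_on_def
proof (intro ballI impI)
  fix i j assume "i \<in> T" "j \<in> T" "i \<noteq> j"
  then have "A i \<inter> A j = {}" using assms(1,2) by (auto simp: disjoint_family_on_def)
  then show "B i \<inter> B j = {}" using assms(3)[of i] assms(3)[of j] by blast
qed

lemma sum_Times_bool:
  fixes f :: "'a \<times> bool \<Rightarrow> real"
  shows "(\<Sum>p\<in>K \<times> UNIV. f p) = (\<Sum>k\<in>K. f (k, True) + f (k, False))"
proof -
  have "(\<Sum>p\<in>K \<times> UNIV. f p) = (\<Sum>k\<in>K. \<Sum>b\<in>UNIV. f (k, b))"
    by (simp add: sum.cartesian_product)
  then show ?thesis by (simp add: UNIV_bool add.commute)
qed

lemma sqi_pythagoras:
  assumes [measurable]: "P \<in> borel_measurable M" "Q \<in> borel_measurable M"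
    and fin: "sqi M P < \<infinity>" "sqi M Q < \<infinity>" and orth: "(\<integral>x. P x * Q x \<partial>M) = 0"
  shows "sqi M (\<lambda>x. P x + Q x) = sqi M P + sqi M Q"
proof -
  have int: "integrable M (\<lambda>x. (P x)\<^sup>2)" "integrable M (\<lambda>x. (Q x)\<^sup>2)" "integrable M (\<lambda>x. P x * Q x)"
    using fin by (simp_all add: integrable_power2_iff integrable_mult_L2)
  have sq: "(P x + Q x)\<^sup>2 = (P x)\<^sup>2 + (Q x)\<^sup>2 + 2 * (P x * Q x)" for x
    by (simp add: power2_sum mult.assoc)
  have "integrable M (\<lambda>x. (P x + Q x)\<^sup>2)"
    unfolding sq using int by simp
  moreover have "(\<integral>x. (P x + Q x)\<^sup>2 \<partial>M) = (\<integral>x. (P x)\<^sup>2 \<partial>M) + (\<integral>x. (Q x)\<^sup>2 \<partial>M)"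
    unfolding sq using int orth by simp
  ultimately show ?thesis
    using int by (simp add: sqi_eq_integral)
qed

lemma elementary_sets_restrict:
  assumes "elementary_sets \<mu> n K A" "V \<in> sets \<mu>"
  shows "elementary_sets \<mu> n K (\<lambda>k i. A k i \<inter> V)"
  unfolding elementary_sets_def
proof (intro conjI ballI allI impI)
  show "finite K" using assms(1) by (simp add: elementary_sets_def)
  fix k assume k: "k \<in> K"
  show "disjoint_family_on (\<lambda>i. A k i \<inter> V) {..<n}"
    by (rule disjoint_family_on_shrink[of "A k" "{..<n}"]) (use assms(1) k in \<open>auto simp: elementary_sets_def\<close>)
  fix i assume i: "i < n"
  have A: "A k i \<in> sets \<mu>" "emeasure \<mu> (A k i) < \<infinity>"
    using assms(1) k i by (auto simp: elementary_sets_def)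
  then show "A k i \<inter> V \<in> sets \<mu>" using assms(2) by auto
  show "emeasure \<mu> (A k i \<inter> V) < \<infinity>"
    by (rule emeasure_subset_finite[OF A(2,1)]) auto
qed

context poisson_noise
begin

section \<open>Conditioning on the noise in a region\<close>

lemma compensated_split:
  assumes A: "A \<in> sets \<mu>" "emeasure \<mu> A < \<infinity>" and V: "V \<in> sets \<mu>"
  shows "AE \<omega> in M. compensated \<mu> N A \<omega> = compensated \<mu> N (A \<inter> V) \<omega> + compensated \<mu> N (A - V) \<omega>"
proof -
  let ?B = "\<lambda>b. if b then A \<inter> V else A - V"
  have "?B b \<in> sets \<mu> \<and> emeasure \<mu> (?B b) < \<infinity>" for b
    using A V emeasure_subset_finite[OF A(2,1)] by auto
  then have "AE \<omega> in M. compensated \<mu> N (\<Union>b\<in>UNIV. ?B b) \<omega> = (\<Sum>b\<in>UNIV. compensated \<mu> N (?B b) \<omega>)"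
    by (intro compensated_UN) (auto simp: disjoint_family_on_def)
  moreover have "(\<Union>b\<in>UNIV. ?B b) = A" by auto
  ultimately show ?thesis by (simp add: UNIV_bool add.commute)
qed

lemma sqi_prod_compensated:
  assumes "finite T" "\<And>i. i \<in> T \<Longrightarrow> B i \<in> sets \<mu> \<and> emeasure \<mu> (B i) < \<infinity>" "disjoint_family_on B T"
  shows "sqi M (\<lambda>\<omega>. \<Prod>i\<in>T. compensated \<mu> N (B i) \<omega>) < \<infinity>"
    and "integrable M (\<lambda>\<omega>. \<Prod>i\<in>T. compensated \<mu> N (B i) \<omega>)"
    and "expectation (\<lambda>\<omega>. \<Prod>i\<in>T. compensated \<mu> N (B i) \<omega>) = (if T = {} then 1 else 0)"
proof -
  have "(\<lambda>\<omega>. \<Prod>i\<in>T. compensated \<mu> N (B i) \<omega>) \<in> borel_measurable M"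
    using assms(2) by (intro borel_measurable_prod measurable_compensated) auto
  moreover have "integrable M (\<lambda>\<omega>. (\<Prod>i\<in>T. compensated \<mu> N (B i) \<omega>)\<^sup>2)"
    using expectation_prod_compensated(1)[of T T B] assms by (simp add: power2_eq_square)
  ultimately show "sqi M (\<lambda>\<omega>. \<Prod>i\<in>T. compensated \<mu> N (B i) \<omega>) < \<infinity>"
    by (simp add: integrable_power2_iff)
  show "integrable M (\<lambda>\<omega>. \<Prod>i\<in>T. compensated \<mu> N (B i) \<omega>)"
    using expectation_prod_compensated(1)[of T "{}" B] assms by simp
  show "expectation (\<lambda>\<omega>. \<Prod>i\<in>T. compensated \<mu> N (B i) \<omega>) = (if T = {} then 1 else 0)"
    using expectation_prod_compensated(2)[of T "{}" B] assms by auto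
qed

text \<open>Splitting every count into its parts inside and outside \<open>V\<close> expands the
  product over the set \<open>T\<close> of coordinates taken inside. Unless \<open>T\<close> is
  everything, the outside factor has mean 0 and is independent of the rest, so that term
  vanishes.\<close>

lemma expectation_mult_prod_restrict:
  fixes A :: "nat \<Rightarrow> 'a set"
  assumes V: "V \<in> sets \<mu>" and H: "H \<in> borel_measurable (noise_on V)" and fin: "sqi M H < \<infinity>"
    and A: "\<And>i. i < n \<Longrightarrow> A i \<in> sets \<mu> \<and> emeasure \<mu> (A i) < \<infinity>" and disj: "disjoint_family_on A {..<n}"
  shows "expectation (\<lambda>\<omega>. H \<omega> * (\<Prod>i<n. compensated \<mu> N (A i) \<omega>)) =
    expectation (\<lambda>\<omega>. H \<omega> * (\<Prod>i<n. compensated \<mu> N (A i \<inter> V) \<omega>))"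
proof -
  let ?X = "compensated \<mu> N"
  have H_meas[measurable]: "H \<in> borel_measurable M" by (rule measurable_noise_onD[OF H])
  have AV: "A i \<inter> V \<in> sets \<mu> \<and> emeasure \<mu> (A i \<inter> V) < \<infinity>"
    and AV': "A i - V \<in> sets \<mu> \<and> emeasure \<mu> (A i - V) < \<infinity>" if "i < n" for i
    using A[OF that] V emeasure_subset_finite[of \<mu> "A i"] by auto
  have disjV: "disjoint_family_on (\<lambda>i. A i \<inter> V) T" "disjoint_family_on (\<lambda>i. A i - V) T"
    if "T \<subseteq> {..<n}" for T
    by (rule disjoint_family_on_shrink[OF disj that], blast)+
  have summand: "integrable M (\<lambda>\<omega>. H \<omega> * (\<Prod>i\<in>T. ?X (A i \<inter> V) \<omega>) * (\<Prod>i\<in>{..<n} - T. ?X (A i - V) \<omega>)) \<and>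
    expectation (\<lambda>\<omega>. H \<omega> * (\<Prod>i\<in>T. ?X (A i \<inter> V) \<omega>) * (\<Prod>i\<in>{..<n} - T. ?X (A i - V) \<omega>)) =
      (if T = {..<n} then expectation (\<lambda>\<omega>. H \<omega> * (\<Prod>i<n. ?X (A i \<inter> V) \<omega>)) else 0)"
    if T: "T \<subseteq> {..<n}" for T
  proof -
    let ?P = "\<lambda>\<omega>. H \<omega> * (\<Prod>i\<in>T. ?X (A i \<inter> V) \<omega>)"
    let ?Q = "\<lambda>\<omega>. \<Prod>i\<in>{..<n} - T. ?X (A i - V) \<omega>"
    have finT: "finite T" using T finite_subset by auto
    have P: "?P \<in> borel_measurable (noise_on V)"
      using T AV by (intro borel_measurable_times H borel_measurable_prod measurable_compensated_noise_on) auto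
    have Q: "?Q \<in> borel_measurable (noise_on (- V))"
      using AV' by (intro borel_measurable_prod measurable_compensated_noise_on) auto
    have prodT: "(\<lambda>\<omega>. \<Prod>i\<in>T. ?X (A i \<inter> V) \<omega>) \<in> borel_measurable M"
      using T AV by (intro borel_measurable_prod measurable_compensated) auto
    have intP: "integrable M ?P"
      using T AV finT disjV(1)[OF T]
      by (intro integrable_mult_L2 H_meas fin prodT sqi_prod_compensated(1)) auto
    have Tc: "disjoint_family_on (\<lambda>i. A i - V) ({..<n} - T)" by (rule disjV(2)) auto
    have intQ: "integrable M ?Q"
      using AV' by (intro sqi_prod_compensated(2) Tc) auto
    have EQ: "expectation ?Q = (if {..<n} - T = {} then 1 else 0)"
      using AV' by (intro sqi_prod_compensated(3) Tc) auto
    have ind: "indep_var borel ?P borel ?Q"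
      by (rule indep_var_noise_on[OF _ P Q]) auto
    have "expectation (\<lambda>\<omega>. ?P \<omega> * ?Q \<omega>) = expectation ?P * expectation ?Q"
      by (rule indep_var_lebesgue_integral[OF ind intP intQ])
    then show ?thesis
      using indep_var_integrable[OF ind intP intQ] T by (auto simp: EQ)
  qed
  have "AE \<omega> in M. \<forall>i\<in>{..<n}. ?X (A i) \<omega> = ?X (A i \<inter> V) \<omega> + ?X (A i - V) \<omega>"
    using A V by (intro AE_finite_allI compensated_split) auto
  then have "AE \<omega> in M. H \<omega> * (\<Prod>i<n. ?X (A i) \<omega>) =
    (\<Sum>T\<in>Pow {..<n}. H \<omega> * (\<Prod>i\<in>T. ?X (A i \<inter> V) \<omega>) * (\<Prod>i\<in>{..<n} - T. ?X (A i - V) \<omega>))"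
  proof eventually_elim
    case (elim \<omega>)
    then have "(\<Prod>i<n. ?X (A i) \<omega>) = (\<Prod>i<n. ?X (A i \<inter> V) \<omega> + ?X (A i - V) \<omega>)"
      by (intro prod.cong) auto
    also have "\<dots> = (\<Sum>T\<in>Pow {..<n}. (\<Prod>i\<in>T. ?X (A i \<inter> V) \<omega>) * (\<Prod>i\<in>{..<n} - T. ?X (A i - V) \<omega>))"
      by (rule prod_add) simp
    finally show ?case by (simp add: sum_distrib_left mult.assoc)
  qed
  then have "expectation (\<lambda>\<omega>. H \<omega> * (\<Prod>i<n. ?X (A i) \<omega>)) =
    expectation (\<lambda>\<omega>. \<Sum>T\<in>Pow {..<n}. H \<omega> * (\<Prod>i\<in>T. ?X (A i \<inter> V) \<omega>) * (\<Prod>i\<in>{..<n} - T. ?X (A i - V) \<omega>))"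
  proof (rule integral_cong_AE[rotated 2])
    show "(\<lambda>\<omega>. H \<omega> * (\<Prod>i<n. ?X (A i) \<omega>)) \<in> borel_measurable M"
      using A by (intro borel_measurable_times H_meas borel_measurable_prod measurable_compensated) auto
    show "(\<lambda>\<omega>. \<Sum>T\<in>Pow {..<n}. H \<omega> * (\<Prod>i\<in>T. ?X (A i \<inter> V) \<omega>) * (\<Prod>i\<in>{..<n} - T. ?X (A i - V) \<omega>))
        \<in> borel_measurable M"
      using summand by (intro borel_measurable_sum borel_measurable_integrable) auto
  qed
  also have "\<dots> = (\<Sum>T\<in>Pow {..<n}. if T = {..<n} then expectation (\<lambda>\<omega>. H \<omega> * (\<Prod>i<n. ?X (A i \<inter> V) \<omega>)) else 0)"
    using summand by (subst Bochner_Integration.integral_sum) auto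
  also have "\<dots> = expectation (\<lambda>\<omega>. H \<omega> * (\<Prod>i<n. ?X (A i \<inter> V) \<omega>))"
    by simp
  finally show ?thesis .
qed

lemma measurable_elementary_integral_restrict:
  assumes "elementary_sets \<mu> n K A" "V \<in> sets \<mu>"
  shows "elementary_integral \<mu> N n K c (\<lambda>k i. A k i \<inter> V) \<in> borel_measurable (noise_on V)"
  unfolding elementary_integral_def[abs_def] using assms
  by (intro borel_measurable_sum borel_measurable_times borel_measurable_const borel_measurable_prod
      measurable_compensated_noise_on) (auto simp: elementary_sets_def)

lemma expectation_mult_elementary_restrict:
  assumes V: "V \<in> sets \<mu>" and H: "H \<in> borel_measurable (noise_on V)" and fin: "sqi M H < \<infinity>"
    and E: "elementary_sets \<mu> n K A"
  shows "expectation (\<lambda>\<omega>. H \<omega> * elementary_integral \<mu> N n K c A \<omega>) =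
    expectation (\<lambda>\<omega>. H \<omega> * elementary_integral \<mu> N n K c (\<lambda>k i. A k i \<inter> V) \<omega>)"
proof -
  have H_meas[measurable]: "H \<in> borel_measurable M" by (rule measurable_noise_onD[OF H])
  have lin: "expectation (\<lambda>\<omega>. H \<omega> * elementary_integral \<mu> N n K c B \<omega>) =
      (\<Sum>k\<in>K. c k * expectation (\<lambda>\<omega>. H \<omega> * (\<Prod>i<n. compensated \<mu> N (B k i) \<omega>)))"
    if B: "elementary_sets \<mu> n K B" for B
  proof -
    have int: "integrable M (\<lambda>\<omega>. H \<omega> * (\<Prod>i<n. compensated \<mu> N (B k i) \<omega>))" if "k \<in> K" for k
    proof (rule integrable_mult_L2[OF H_meas _ fin])
      show "(\<lambda>\<omega>. \<Prod>i<n. compensated \<mu> N (B k i) \<omega>) \<in> borel_measurable M"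
        using B that by (intro borel_measurable_prod measurable_compensated) (auto simp: elementary_sets_def)
      show "sqi M (\<lambda>\<omega>. \<Prod>i<n. compensated \<mu> N (B k i) \<omega>) < \<infinity>"
        using B that by (intro sqi_prod_compensated(1)) (auto simp: elementary_sets_def)
    qed
    have "(\<lambda>\<omega>. H \<omega> * elementary_integral \<mu> N n K c B \<omega>) =
        (\<lambda>\<omega>. \<Sum>k\<in>K. c k * (H \<omega> * (\<Prod>i<n. compensated \<mu> N (B k i) \<omega>)))"
      by (simp add: elementary_integral_def sum_distrib_left mult_ac)
    then show ?thesis
      using int by (simp add: Bochner_Integration.integral_sum)
  qed
  have "expectation (\<lambda>\<omega>. H \<omega> * (\<Prod>i<n. compensated \<mu> N (A k i) \<omega>)) =
      expectation (\<lambda>\<omega>. H \<omega> * (\<Prod>i<n. compensated \<mu> N (A k i \<inter> V) \<omega>))" if "k \<in> K" for k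
    using E that by (intro expectation_mult_prod_restrict[OF V H fin]) (auto simp: elementary_sets_def)
  then show ?thesis
    unfolding lin[OF E] lin[OF elementary_sets_restrict[OF E V]] by simp
qed

text \<open>Conditioning a finite chaos on the noise in \<open>V\<close> restricts its kernels to \<open>V\<close>.\<close>

lemma sqi_diff_restrict_le:
  fixes c :: "'i \<Rightarrow> 'k \<Rightarrow> real" and r :: "'i \<Rightarrow> nat"
  assumes V: "V \<in> sets \<mu>" and F: "F \<in> borel_measurable (noise_on V)" and finF: "sqi M F < \<infinity>"
    and I: "finite I" and E: "\<And>i. i \<in> I \<Longrightarrow> elementary_sets \<mu> (r i) (K i) (A i)"
  shows "sqi M (\<lambda>\<omega>. F \<omega> - (a + (\<Sum>i\<in>I. elementary_integral \<mu> N (r i) (K i) (c i) (\<lambda>k j. A i k j \<inter> V) \<omega>))) \<le>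
    sqi M (\<lambda>\<omega>. F \<omega> - (a + (\<Sum>i\<in>I. elementary_integral \<mu> N (r i) (K i) (c i) (A i) \<omega>)))"
proof -
  define S where "S i = elementary_integral \<mu> N (r i) (K i) (c i) (A i)" for i
  define S' where "S' i = elementary_integral \<mu> N (r i) (K i) (c i) (\<lambda>k j. A i k j \<inter> V)" for i
  \<comment> \<open>\<open>P\<close> is measurable for the noise in \<open>V\<close>, and
    \<open>Q\<close> is orthogonal to every square-integrable variable of that kind. Since
    \<open>P + Q\<close> is the error before restriction, Pythagoras gives the inequality.\<close>
  define P where "P \<omega> = F \<omega> - (a + (\<Sum>i\<in>I. S' i \<omega>))" for \<omega>
  define Q where "Q \<omega> = (\<Sum>i\<in>I. S' i \<omega> - S i \<omega>)" for \<omega>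
  note E' = elementary_sets_restrict[OF E V]
  have S[measurable]: "S i \<in> borel_measurable M" and S'[measurable]: "S' i \<in> borel_measurable M"
    if "i \<in> I" for i
    unfolding S_def S'_def using E[OF that] E'[OF that] by (auto intro: measurable_elementary_integral)
  have finS: "sqi M (S i) < \<infinity>" and finS': "sqi M (S' i) < \<infinity>" if "i \<in> I" for i
    unfolding S_def S'_def
    by (rule sqi_elementary_finite(1)[OF E[OF that]], rule sqi_elementary_finite(1)[OF E'[OF that]])
  have F_meas[measurable]: "F \<in> borel_measurable M" by (rule measurable_noise_onD[OF F])
  have P_noise: "P \<in> borel_measurable (noise_on V)"
    unfolding P_def[abs_def] S'_def
    by (intro borel_measurable_diff borel_measurable_add borel_measurable_sum borel_measurable_const F
        measurable_elementary_integral_restrict E V)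
  have P_meas: "P \<in> borel_measurable M" by (rule measurable_noise_onD[OF P_noise])
  have Q_meas: "Q \<in> borel_measurable M" unfolding Q_def[abs_def] by measurable
  have fin_sum: "sqi M (\<lambda>\<omega>. \<Sum>i\<in>I. Y i \<omega>) < \<infinity>"
    if "\<And>i. i \<in> I \<Longrightarrow> Y i \<in> borel_measurable M" "\<And>i. i \<in> I \<Longrightarrow> sqi M (Y i) < \<infinity>" for Y
  proof -
    have "sqi M (\<lambda>\<omega>. \<Sum>i\<in>I. Y i \<omega>) \<le> of_nat (card I) * (\<Sum>i\<in>I. sqi M (Y i))"
      by (rule sqi_sum[OF I that(1)])
    also have "\<dots> < \<infinity>" using that(2) I by (simp add: ennreal_mult_less_top of_nat_less_top)
    finally show ?thesis .
  qed
  have fin_diff: "sqi M (\<lambda>\<omega>. Y \<omega> - Z \<omega>) < \<infinity>"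
    if "Y \<in> borel_measurable M" "Z \<in> borel_measurable M" "sqi M Y < \<infinity>" "sqi M Z < \<infinity>" for Y Z
    using sqi_diff[OF that(1,2)] that(3,4)
    by (auto simp: ennreal_mult_less_top intro: le_less_trans)
  have finQ: "sqi M Q < \<infinity>"
    unfolding Q_def[abs_def] using finS finS' by (intro fin_sum fin_diff) measurable
  have finP: "sqi M P < \<infinity>"
  proof -
    have "sqi M (\<lambda>\<omega>. a) < \<infinity>" by (simp add: sqi_def emeasure_space_1 ennreal_mult_less_top)
    then have "sqi M (\<lambda>\<omega>. F \<omega> - a) < \<infinity>" using finF by (intro fin_diff) auto
    moreover have "sqi M (\<lambda>\<omega>. \<Sum>i\<in>I. S' i \<omega>) < \<infinity>"
      by (rule fin_sum[OF S' finS'])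
    ultimately have "sqi M (\<lambda>\<omega>. (F \<omega> - a) - (\<Sum>i\<in>I. S' i \<omega>)) < \<infinity>"
      by (rule fin_diff[rotated 2]) measurable
    then show ?thesis by (simp add: P_def[abs_def] diff_diff_eq)
  qed
  have intS: "integrable M (\<lambda>\<omega>. P \<omega> * S i \<omega>)" "integrable M (\<lambda>\<omega>. P \<omega> * S' i \<omega>)" if "i \<in> I" for i
    using that finS finS' by (auto intro!: integrable_mult_L2 P_meas finP)
  have "expectation (\<lambda>\<omega>. P \<omega> * Q \<omega>) = (\<Sum>i\<in>I. expectation (\<lambda>\<omega>. P \<omega> * S' i \<omega>) - expectation (\<lambda>\<omega>. P \<omega> * S i \<omega>))"
    unfolding Q_def sum_distrib_left right_diff_distrib
    using intS by (subst Bochner_Integration.integral_sum) auto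
  also have "\<dots> = 0"
    unfolding S_def S'_def
    using expectation_mult_elementary_restrict[OF V P_noise finP E]
    by (intro sum.neutral) auto
  finally have orth: "expectation (\<lambda>\<omega>. P \<omega> * Q \<omega>) = 0" .
  have "sqi M P \<le> sqi M P + sqi M Q" by simp
  also have "\<dots> = sqi M (\<lambda>\<omega>. P \<omega> + Q \<omega>)"
    by (rule sqi_pythagoras[OF P_meas Q_meas finP finQ orth, symmetric])
  also have "(\<lambda>\<omega>. P \<omega> + Q \<omega>) = (\<lambda>\<omega>. F \<omega> - (a + (\<Sum>i\<in>I. S i \<omega>)))"
    by (simp add: fun_eq_iff P_def Q_def sum_subtractf)
  finally show ?thesis by (simp add: P_def[abs_def] S_def S'_def)
qed

section \<open>The cost of shrinking the region\<close>

lemma sqi_elementary_restrict_diff: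
  assumes E: "elementary_sets \<mu> n K A" and V: "V \<in> sets \<mu>" and W: "W \<in> sets \<mu>"
  shows "sqi M (\<lambda>\<omega>. elementary_integral \<mu> N n K c (\<lambda>k i. A k i \<inter> V) \<omega> -
      elementary_integral \<mu> N n K c (\<lambda>k i. A k i \<inter> W) \<omega>) \<le>
    fact n * sqi (tensor_measure \<mu> n) (\<lambda>x. elementary_kernel n K c A x *
      ((\<Prod>i<n. indicator V (x i)) - (\<Prod>i<n. indicator W (x i))))"
    and "(\<lambda>\<omega>. elementary_integral \<mu> N n K c (\<lambda>k i. A k i \<inter> V) \<omega> -
      elementary_integral \<mu> N n K c (\<lambda>k i. A k i \<inter> W) \<omega>) =
      elementary_integral \<mu> N n (K \<times> UNIV) (\<lambda>(k, b). if b then c k else - c k)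
        (\<lambda>(k, b) i. A k i \<inter> (if b then V else W))"
    and "elementary_sets \<mu> n (K \<times> (UNIV :: bool set)) (\<lambda>(k, b) i. A k i \<inter> (if b then V else W))"
proof -
  \<comment> \<open>The difference is again an elementary integral: the Boolean tells whether a term
    is restricted to \<open>V\<close>, with sign plus, or to \<open>W\<close>, with sign
    minus.\<close>
  let ?K = "K \<times> (UNIV :: bool set)"
  let ?c = "\<lambda>(k, b). if b then c k else - c k"
  let ?A = "\<lambda>(k, b) i. A k i \<inter> (if b then V else W)"
  show E': "elementary_sets \<mu> n ?K ?A"
    using elementary_sets_restrict[OF E V] elementary_sets_restrict[OF E W]
    by (auto simp: elementary_sets_def)
  show eq: "(\<lambda>\<omega>. elementary_integral \<mu> N n K c (\<lambda>k i. A k i \<inter> V) \<omega> -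
      elementary_integral \<mu> N n K c (\<lambda>k i. A k i \<inter> W) \<omega>) = elementary_integral \<mu> N n ?K ?c ?A"
    by (simp add: fun_eq_iff elementary_integral_def sum_Times_bool sum_subtractf)
  have "elementary_kernel n ?K ?c ?A x = elementary_kernel n K c A x *
      ((\<Prod>i<n. indicator V (x i)) - (\<Prod>i<n. indicator W (x i)))" for x
    by (simp add: elementary_kernel_def sum_Times_bool sum.distrib sum_negf indicator_inter_arith prod.distrib sum_distrib_right right_diff_distrib
        sum_subtractf mult.assoc)
  then have ker: "elementary_kernel n ?K ?c ?A = (\<lambda>x. elementary_kernel n K c A x *
      ((\<Prod>i<n. indicator V (x i)) - (\<Prod>i<n. indicator W (x i))))" by blast
  show "sqi M (\<lambda>\<omega>. elementary_integral \<mu> N n K c (\<lambda>k i. A k i \<inter> V) \<omega> -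
      elementary_integral \<mu> N n K c (\<lambda>k i. A k i \<inter> W) \<omega>) \<le>
    fact n * sqi (tensor_measure \<mu> n) (\<lambda>x. elementary_kernel n K c A x *
      ((\<Prod>i<n. indicator V (x i)) - (\<Prod>i<n. indicator W (x i))))"
    unfolding eq ker[symmetric] by (rule sqi_elementary_integral_le[OF E'])
qed

text \<open>The products are indicators of powers of \<open>V\<close> and \<open>W\<close>. Where
  they differ, some coordinate lies in \<open>V - W\<close>, and it alone contributes 1 to the
  sum.\<close>

lemma prod_indicator_diff_bound:
  fixes n :: nat
  assumes "W \<subseteq> V"
  shows "((\<Prod>i<n. indicator V (x i)) - (\<Prod>i<n. indicator W (x i)) :: real)\<^sup>2 \<le>
    (\<Sum>i<n. indicator (V - W) (x i))"
    and "\<bar>(\<Prod>i<n. indicator V (x i)) - (\<Prod>i<n. indicator W (x i)) :: real\<bar> \<le> 1"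
proof -
  have prod: "(\<Prod>i<n. indicator S (x i) :: real) = of_bool (\<forall>i<n. x i \<in> S)" for S
    by (induction n) (auto simp: less_Suc_eq)
  show "\<bar>(\<Prod>i<n. indicator V (x i)) - (\<Prod>i<n. indicator W (x i)) :: real\<bar> \<le> 1"
    unfolding prod by auto
  show "((\<Prod>i<n. indicator V (x i)) - (\<Prod>i<n. indicator W (x i)) :: real)\<^sup>2 \<le>
    (\<Sum>i<n. indicator (V - W) (x i))"
  proof (cases "\<exists>i<n. x i \<in> V - W")
    case True
    then obtain i where i: "i < n" "x i \<in> V - W" by blast
    have "((\<Prod>i<n. indicator V (x i)) - (\<Prod>i<n. indicator W (x i)) :: real)\<^sup>2 \<le> 1"
      unfolding prod by auto
    also have "1 = (indicator (V - W) (x i) :: real)" using i by simp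
    also have "\<dots> \<le> (\<Sum>i<n. indicator (V - W) (x i))"
      using i by (intro member_le_sum) auto
    finally show ?thesis .
  next
    case False
    then have "(\<forall>i<n. x i \<in> V) = (\<forall>i<n. x i \<in> W)" using assms by blast
    then show ?thesis unfolding prod by (simp add: sum_nonneg)
  qed
qed

text \<open>\<open>prod_indicator_diff_bound\<close> leaves one term per coordinate. Symmetry of
  \<open>f\<close> makes each equal, via a transposition, to that of the last coordinate, which is
  the one frozen in the derivative.\<close>

lemma sqi_symmetric_restrict_diff:
  assumes f[measurable]: "f \<in> borel_measurable (tensor_measure \<mu> (Suc n))"
    and sym: "symmetric_kernel \<mu> (Suc n) f" and VW: "V \<in> sets \<mu>" "W \<in> sets \<mu>" "W \<subseteq> V"
  shows "sqi (tensor_measure \<mu> (Suc n)) (\<lambda>x. f x * ((\<Prod>i<Suc n. indicator V (x i)) - (\<Prod>i<Suc n. indicator W (x i)))) \<le>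
    of_nat (Suc n) * (\<integral>\<^sup>+\<xi>. sqi (tensor_measure \<mu> n) (\<lambda>x. f (x(n := \<xi>))) * indicator (V - W) \<xi> \<partial>\<mu>)"
proof -
  let ?T = "tensor_measure \<mu> (Suc n)"
  let ?U = "V - W"
  have U[measurable]: "?U \<in> sets \<mu>" using VW by auto
  have ind[measurable]: "(\<lambda>x. indicator ?U (x i) :: real) \<in> borel_measurable ?T" if "i < Suc n" for i
    using that by (intro measurable_compose[OF measurable_component_singleton] borel_measurable_indicator U) auto
  have ind'[measurable]: "(\<lambda>x. indicator ?U (x i) :: ennreal) \<in> borel_measurable ?T" if "i < Suc n" for i
    using that by (intro measurable_compose[OF measurable_component_singleton] borel_measurable_indicator U) auto
  have same: "sqi ?T (\<lambda>x. f x * indicator ?U (x i)) = sqi ?T (\<lambda>x. f x * indicator ?U (x n))" if "i < Suc n" for i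
  proof -
    let ?\<pi> = "Transposition.transpose i n"
    have p: "?\<pi> permutes {..<Suc n}" using that by (intro permutes_swap_id) auto
    have "sqi ?T (\<lambda>x. f x * indicator ?U (x n)) =
        sqi ?T (\<lambda>x. (\<lambda>x. f x * indicator ?U (x n)) (\<lambda>j\<in>{..<Suc n}. x (?\<pi> j)))"
      by (rule sqi_permute[OF p, symmetric]) measurable
    also have "\<dots> = sqi ?T (\<lambda>x. f x * indicator ?U (x i))"
    proof (rule sqi_cong_AE)
      have "AE x in ?T. f (\<lambda>j\<in>{..<Suc n}. x (?\<pi> j)) = f x"
        using sym p unfolding symmetric_kernel_def by blast
      then show "AE x in ?T. f (\<lambda>j\<in>{..<Suc n}. x (?\<pi> j)) * indicator ?U ((\<lambda>j\<in>{..<Suc n}. x (?\<pi> j)) n) =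
          f x * indicator ?U (x i)"
        by eventually_elim simp
    qed
    finally show ?thesis ..
  qed
  have pull: "ennreal ((f x * indicator ?U (x i))\<^sup>2) = ennreal ((f x)\<^sup>2) * indicator ?U (x i)" for x i
    by (simp add: indicator_def)
  have "sqi ?T (\<lambda>x. f x * ((\<Prod>i<Suc n. indicator V (x i)) - (\<Prod>i<Suc n. indicator W (x i)))) \<le>
      (\<integral>\<^sup>+x. (\<Sum>i<Suc n. ennreal ((f x * indicator ?U (x i))\<^sup>2)) \<partial>?T)"
    unfolding sqi_def
  proof (rule nn_integral_mono)
    fix x
    have "(f x * ((\<Prod>i<Suc n. indicator V (x i)) - (\<Prod>i<Suc n. indicator W (x i))))\<^sup>2 \<le>
        (f x)\<^sup>2 * (\<Sum>i<Suc n. indicator ?U (x i))"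
      unfolding power_mult_distrib by (intro mult_left_mono prod_indicator_diff_bound(1) VW) auto
    also have "\<dots> = (\<Sum>i<Suc n. (f x * indicator ?U (x i))\<^sup>2)"
      unfolding sum_distrib_left by (intro sum.cong) (auto simp: indicator_def)
    finally have "ennreal ((f x * ((\<Prod>i<Suc n. indicator V (x i)) - (\<Prod>i<Suc n. indicator W (x i))))\<^sup>2) \<le>
        ennreal (\<Sum>i<Suc n. (f x * indicator ?U (x i))\<^sup>2)" by (rule ennreal_leI)
    then show "ennreal ((f x * ((\<Prod>i<Suc n. indicator V (x i)) - (\<Prod>i<Suc n. indicator W (x i))))\<^sup>2) \<le>
        (\<Sum>i<Suc n. ennreal ((f x * indicator ?U (x i))\<^sup>2))"
      by (subst sum_ennreal) auto
  qed
  also have "\<dots> = (\<Sum>i<Suc n. sqi ?T (\<lambda>x. f x * indicator ?U (x i)))"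
    unfolding sqi_def
  proof (rule nn_integral_sum)
    fix i assume "i \<in> {..<Suc n}"
    then show "(\<lambda>x. ennreal ((f x * indicator ?U (x i))\<^sup>2)) \<in> borel_measurable ?T"
      using ind[of i] by measurable
  qed
  also have "\<dots> = of_nat (Suc n) * sqi ?T (\<lambda>x. f x * indicator ?U (x n))"
  proof -
    have "(\<Sum>i<Suc n. sqi ?T (\<lambda>x. f x * indicator ?U (x i))) =
        (\<Sum>i<Suc n. sqi ?T (\<lambda>x. f x * indicator ?U (x n)))"
      by (rule sum.cong[OF refl same]) simp
    then show ?thesis by (simp only: sum_constant card_lessThan)
  qed
  also have "sqi ?T (\<lambda>x. f x * indicator ?U (x n)) =
      (\<integral>\<^sup>+\<xi>. (\<integral>\<^sup>+x. ennreal ((f (x(n := \<xi>)))\<^sup>2) * indicator ?U \<xi> \<partial>tensor_measure \<mu> n) \<partial>\<mu>)"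
    unfolding sqi_def pull by (subst nn_integral_tensor_Suc) (use ind' in auto)
  also have "\<dots> = (\<integral>\<^sup>+\<xi>. sqi (tensor_measure \<mu> n) (\<lambda>x. f (x(n := \<xi>))) * indicator ?U \<xi> \<partial>\<mu>)"
  proof (rule nn_integral_cong)
    fix \<xi> assume "\<xi> \<in> space \<mu>"
    then have "(\<lambda>x. ennreal ((f (x(n := \<xi>)))\<^sup>2)) \<in> borel_measurable (tensor_measure \<mu> n)"
      by (intro measurable_compose[OF measurable_slice]) auto
    then show "(\<integral>\<^sup>+x. ennreal ((f (x(n := \<xi>)))\<^sup>2) * indicator ?U \<xi> \<partial>tensor_measure \<mu> n) =
        sqi (tensor_measure \<mu> n) (\<lambda>x. f (x(n := \<xi>))) * indicator ?U \<xi>"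
      unfolding sqi_def by (rule nn_integral_multc)
  qed
  finally show ?thesis .
qed

end

context poisson_noise
begin

lemma sqi_symmetric_restrict_diff':
  assumes f: "f \<in> borel_measurable (tensor_measure \<mu> n)" and n: "1 \<le> n"
    and sym: "symmetric_kernel \<mu> n f" and VW: "V \<in> sets \<mu>" "W \<in> sets \<mu>" "W \<subseteq> V"
  shows "sqi (tensor_measure \<mu> n) (\<lambda>x. f x * ((\<Prod>i<n. indicator V (x i)) - (\<Prod>i<n. indicator W (x i)))) \<le>
    of_nat n * (\<integral>\<^sup>+\<xi>. sqi (tensor_measure \<mu> (n - 1)) (\<lambda>x. f (x(n - 1 := \<xi>))) * indicator (V - W) \<xi> \<partial>\<mu>)"
  using sqi_symmetric_restrict_diff[of f "n - 1" V W] assms by simp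

lemma measurable_sqi_slice:
  assumes f: "f \<in> borel_measurable (tensor_measure \<mu> n)" and n: "1 \<le> n"
  shows "(\<lambda>\<xi>. sqi (tensor_measure \<mu> (n - 1)) (\<lambda>x. f (x(n - 1 := \<xi>)))) \<in> borel_measurable \<mu>"
  unfolding sqi_def using measurable_nn_integral_slice[of "\<lambda>x. ennreal ((f x)\<^sup>2)" "n - 1"] f n by simp

text \<open>The chain is: finite chaos, elementary integrals \<open>T\<close>, restriction
  \<open>TV\<close> to \<open>V\<close>, restriction \<open>TW\<close> to \<open>W\<close>. The
  constant is \<open>32 = 2 * 2 * 8\<close>: the last triangle inequality, the exchange of the
  elementary kernels for the \<open>f n\<close>, and \<open>malliavin_derivative_ge\<close>.\<close>

lemma local_approximation:
  assumes D: "is_malliavin_derivative M \<mu> N F D" and F: "F \<in> borel_measurable (noise_on V)"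
    and VW: "V \<in> sets \<mu>" "W \<in> sets \<mu>" "W \<subseteq> V"
    and bound: "AE \<xi> in \<mu>. \<xi> \<in> V - W \<longrightarrow> sqi M (D \<xi>) \<le> b \<xi>"
    and b[measurable]: "b \<in> borel_measurable \<mu>" and e: "0 < e"
  obtains G where "G \<in> borel_measurable (noise_on W)"
    "sqi M (\<lambda>\<omega>. F \<omega> - G \<omega>) \<le> 32 * (\<integral>\<^sup>+\<xi>. b \<xi> * indicator (V - W) \<xi> \<partial>\<mu>) + ennreal e"
proof -
  let ?I = "\<integral>\<^sup>+\<xi>. b \<xi> * indicator (V - W) \<xi> \<partial>\<mu>"
  let ?\<chi> = "\<lambda>n x. (\<Prod>i<n. indicator V (x i)) - (\<Prod>i<n. indicator W (x i)) :: real"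
  from malliavin_derivative_ge[OF D] obtain f where dom: "dom_kernels M \<mu> N F f"
    and slices: "AE \<xi> in \<mu>. \<forall>m. (\<Sum>n=1..m. ennreal ((real n)\<^sup>2) *
       (fact (n - 1) * sqi (tensor_measure \<mu> (n - 1)) (\<lambda>x. f n (x(n - 1 := \<xi>))))) \<le> 8 * sqi M (D \<xi>)"
    by blast
  let ?w = "\<lambda>n \<xi>. ennreal ((real n)\<^sup>2) * (fact (n - 1) * sqi (tensor_measure \<mu> (n - 1)) (\<lambda>x. f n (x(n - 1 := \<xi>))))"
  have F_meas[measurable]: "F \<in> borel_measurable M" and finF: "sqi M F < \<infinity>"
    using dom by (auto simp: dom_kernels_def square_integrable_iff)
  have f_meas[measurable]: "f n \<in> borel_measurable (tensor_measure \<mu> n)"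
    and f_sym: "symmetric_kernel \<mu> n (f n)" if "1 \<le> n" for n
    using dom that by (auto simp: dom_kernels_def chaos_expansion_def square_integrable_iff)
  from dom obtain J where J: "\<And>n. 1 \<le> n \<Longrightarrow> is_multiple_integral M \<mu> N n (f n) (J n)"
    and lim: "(\<lambda>m. l2norm M (\<lambda>\<omega>. F \<omega> - (expectation F + (\<Sum>n=1..m. J n \<omega>)))) \<longlonglongrightarrow> 0"
    by (auto simp: dom_kernels_def chaos_expansion_def)
  from e have "eventually (\<lambda>m. sqi M (\<lambda>\<omega>. F \<omega> - (expectation F + (\<Sum>n=1..m. J n \<omega>))) \<le> ennreal (e / 8)) sequentially"
    by (intro l2norm_tendsto_0_sqi[OF lim]) simp
  then obtain m where m: "sqi M (\<lambda>\<omega>. F \<omega> - (expectation F + (\<Sum>n=1..m. J n \<omega>))) \<le> ennreal (e / 8)"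
    by (auto dest: eventually_happens)
  let ?R = "{1..m}"
  \<comment> \<open>The coefficient of \<open>\<delta>\<close> in the final bound: the first summand
    comes from replacing \<open>J\<close> by \<open>T\<close>, the second from the kernels in the
    step from \<open>TV\<close> to \<open>TW\<close>. The resulting \<open>e / 2\<close> leaves
    \<open>2 * 2 * (e / 8)\<close> for the tail of the expansion.\<close>
  define C where "C = 4 * (real m)\<^sup>2 + 4 * (\<Sum>n\<in>?R. fact n)"
  have C: "0 \<le> C" unfolding C_def by (intro add_nonneg_nonneg mult_nonneg_nonneg sum_nonneg) auto
  define \<delta> where "\<delta> = e / (2 * (C + 1))"
  have \<delta>: "0 < \<delta>" "C * \<delta> \<le> e / 2"
    using C e by (auto simp: \<delta>_def field_simps)
  have J': "is_multiple_integral M \<mu> N n (f n) (J n)" if "n \<in> ?R" for n using J that by simp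
  obtain K :: "nat \<Rightarrow> (nat \<Rightarrow> nat) set" and c A where fam: "\<forall>n\<in>?R. elementary_sets \<mu> n (K n) (A n)"
    "\<forall>n\<in>?R. sqi (tensor_measure \<mu> n) (\<lambda>x. f n x - elementary_kernel n (K n) (c n) (A n) x) \<le> ennreal \<delta>"
    "\<forall>n\<in>?R. sqi M (\<lambda>\<omega>. J n \<omega> - elementary_integral \<mu> N n (K n) (c n) (A n) \<omega>) \<le> ennreal \<delta>"
    by (rule multiple_integral_approx_family[OF J' \<delta>(1)])
  note E = fam(1)[rule_format] and g = fam(2)[rule_format] and S = fam(3)[rule_format]
  define T where "T n = elementary_integral \<mu> N n (K n) (c n) (A n)" for n
  define TV where "TV n = elementary_integral \<mu> N n (K n) (c n) (\<lambda>k i. A n k i \<inter> V)" for n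
  define TW where "TW n = elementary_integral \<mu> N n (K n) (c n) (\<lambda>k i. A n k i \<inter> W)" for n
  define a where "a = expectation F"
  have T_meas[measurable]: "T n \<in> borel_measurable M" and TV_meas[measurable]: "TV n \<in> borel_measurable M"
    and TW_meas[measurable]: "TW n \<in> borel_measurable M" if "n \<in> ?R" for n
    unfolding T_def TV_def TW_def
    by (rule measurable_elementary_integral[OF E[OF that]],
        rule measurable_elementary_integral[OF elementary_sets_restrict[OF E[OF that] VW(1)]],
        rule measurable_elementary_integral[OF elementary_sets_restrict[OF E[OF that] VW(2)]])
  have J_meas[measurable]: "J n \<in> borel_measurable M" if "n \<in> ?R" for n
    using J[of n] that by (simp add: is_multiple_integral_def square_integrable_iff)
  \<comment> \<open>Measurability of \<open>F\<close> for the noise in \<open>V\<close> enters here: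
    the restriction to \<open>V\<close> is free of charge.\<close>
  have "sqi M (\<lambda>\<omega>. F \<omega> - (a + (\<Sum>n\<in>?R. TV n \<omega>))) \<le> sqi M (\<lambda>\<omega>. F \<omega> - (a + (\<Sum>n\<in>?R. T n \<omega>)))"
    unfolding T_def TV_def by (rule sqi_diff_restrict_le[OF VW(1) F finF _ E]) auto
  also have "\<dots> \<le> 2 * sqi M (\<lambda>\<omega>. F \<omega> - (a + (\<Sum>n\<in>?R. J n \<omega>))) +
      2 * sqi M (\<lambda>\<omega>. (a + (\<Sum>n\<in>?R. J n \<omega>)) - (a + (\<Sum>n\<in>?R. T n \<omega>)))"
    by (rule sqi_triangle) measurable
  also have "(\<lambda>\<omega>. (a + (\<Sum>n\<in>?R. J n \<omega>)) - (a + (\<Sum>n\<in>?R. T n \<omega>))) = (\<lambda>\<omega>. \<Sum>n\<in>?R. J n \<omega> - T n \<omega>)"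
    by (simp add: fun_eq_iff sum_subtractf)
  also have "sqi M (\<lambda>\<omega>. \<Sum>n\<in>?R. J n \<omega> - T n \<omega>) \<le> of_nat (card ?R) * (\<Sum>n\<in>?R. sqi M (\<lambda>\<omega>. J n \<omega> - T n \<omega>))"
    by (rule sqi_sum) auto
  also have "(\<Sum>n\<in>?R. sqi M (\<lambda>\<omega>. J n \<omega> - T n \<omega>)) \<le> (\<Sum>n\<in>?R. ennreal \<delta>)"
    unfolding T_def by (intro sum_mono S)
  also have "sqi M (\<lambda>\<omega>. F \<omega> - (a + (\<Sum>n\<in>?R. J n \<omega>))) \<le> ennreal (e / 8)"
    unfolding a_def by (rule m)
  finally have "sqi M (\<lambda>\<omega>. F \<omega> - (a + (\<Sum>n\<in>?R. TV n \<omega>))) \<le>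
      2 * ennreal (e / 8) + 2 * (of_nat m * (of_nat m * ennreal \<delta>))"
    by (simp add: add_mono mult_left_mono)
  also have "\<dots> = ennreal (e / 4 + 2 * (real m)\<^sup>2 * \<delta>)"
  proof -
    have "2 * ennreal (e / 8) = ennreal (e / 4)"
      using e ennreal_mult'[of 2 "e / 8"] by simp
    moreover have "2 * (of_nat m * (of_nat m * ennreal \<delta>)) = ennreal (2 * (real m)\<^sup>2 * \<delta>)"
      using \<delta>(1) by (simp add: ennreal_of_nat_eq_real_of_nat ennreal_mult' power2_eq_square mult.assoc)
    ultimately show ?thesis using e \<delta>(1) by simp
  qed
  finally have V_bound: "sqi M (\<lambda>\<omega>. F \<omega> - (a + (\<Sum>n\<in>?R. TV n \<omega>))) \<le> ennreal (e / 4 + 2 * (real m)\<^sup>2 * \<delta>)" .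
  have orth: "sqi M (\<lambda>\<omega>. \<Sum>n\<in>?R. TV n \<omega> - TW n \<omega>) = (\<Sum>n\<in>?R. sqi M (\<lambda>\<omega>. TV n \<omega> - TW n \<omega>))"
  proof (rule sqi_sum_orthogonal)
    fix n assume n: "n \<in> ?R"
    note El = sqi_elementary_restrict_diff(2)[OF E[OF n] VW(1,2), of "c n"]
      sqi_elementary_restrict_diff(3)[OF E[OF n] VW(1,2)]
    show "(\<lambda>\<omega>. TV n \<omega> - TW n \<omega>) \<in> borel_measurable M" using n by measurable
    show "sqi M (\<lambda>\<omega>. TV n \<omega> - TW n \<omega>) < \<infinity>"
      unfolding TV_def TW_def El(1) by (rule sqi_elementary_finite(1)[OF El(2)])
    fix k assume k: "k \<in> ?R" "n \<noteq> k"
    note Ek = sqi_elementary_restrict_diff(2)[OF E[OF k(1)] VW(1,2), of "c k"]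
      sqi_elementary_restrict_diff(3)[OF E[OF k(1)] VW(1,2)]
    have "expectation (\<lambda>\<omega>. (\<lambda>\<omega>. TV n \<omega> - TW n \<omega>) \<omega> * (\<lambda>\<omega>. TV k \<omega> - TW k \<omega>) \<omega>) = 0"
      unfolding TV_def TW_def El(1)[THEN fun_cong] Ek(1)[THEN fun_cong] elementary_isometry[OF El(2) Ek(2)] using k(2) by simp
    then show "expectation (\<lambda>\<omega>. (TV n \<omega> - TW n \<omega>) * (TV k \<omega> - TW k \<omega>)) = 0" by simp
  qed simp
  have piece: "sqi M (\<lambda>\<omega>. TV n \<omega> - TW n \<omega>) \<le>
      2 * (\<integral>\<^sup>+\<xi>. ?w n \<xi> *
        indicator (V - W) \<xi> \<partial>\<mu>) + 2 * (fact n * ennreal \<delta>)" if n: "n \<in> ?R" for n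
  proof -
    let ?T = "tensor_measure \<mu> n"
    let ?g = "elementary_kernel n (K n) (c n) (A n)"
    let ?s = "\<lambda>\<xi>. sqi (tensor_measure \<mu> (n - 1)) (\<lambda>x. f n (x(n - 1 := \<xi>)))"
    have n1: "1 \<le> n" using n by simp
    have [measurable]: "?g \<in> borel_measurable ?T" by (rule measurable_elementary_kernel[OF E[OF n]])
    have [measurable]: "f n \<in> borel_measurable ?T" by (rule f_meas[OF n1])
    have ind: "(\<lambda>x. indicator U (x i) :: real) \<in> borel_measurable ?T" if "i < n" "U \<in> sets \<mu>" for i U
      using that by (intro measurable_compose[OF measurable_component_singleton] borel_measurable_indicator) auto
    have [measurable]: "?\<chi> n \<in> borel_measurable ?T"
      by (intro borel_measurable_diff borel_measurable_prod ind VW) auto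
    have [measurable]: "?s \<in> borel_measurable \<mu>" by (rule measurable_sqi_slice[OF f_meas[OF n1] n1])
    have [measurable]: "V - W \<in> sets \<mu>" using VW by auto
    have "sqi M (\<lambda>\<omega>. TV n \<omega> - TW n \<omega>) \<le> fact n * sqi ?T (\<lambda>x. ?g x * ?\<chi> n x)"
      unfolding TV_def TW_def by (rule sqi_elementary_restrict_diff(1)[OF E[OF n] VW(1,2)])
    \<comment> \<open>The elementary kernel is neither symmetric nor tied to the derivative, so it
      is exchanged for \<open>f n\<close>; the factor \<open>?\<chi> n\<close> is at most 1 in
      modulus and does not enlarge the error.\<close>
    also have "sqi ?T (\<lambda>x. ?g x * ?\<chi> n x) = sqi ?T (\<lambda>x. f n x * ?\<chi> n x - (f n x - ?g x) * ?\<chi> n x)"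
      by (simp add: left_diff_distrib)
    also have "\<dots> \<le> 2 * sqi ?T (\<lambda>x. f n x * ?\<chi> n x) + 2 * sqi ?T (\<lambda>x. (f n x - ?g x) * ?\<chi> n x)"
      by (rule sqi_diff) measurable
    also have "sqi ?T (\<lambda>x. (f n x - ?g x) * ?\<chi> n x) \<le> sqi ?T (\<lambda>x. f n x - ?g x)"
    proof (rule sqi_mono_AE, rule AE_I2)
      fix x show "\<bar>(f n x - ?g x) * ?\<chi> n x\<bar> \<le> \<bar>f n x - ?g x\<bar>"
        unfolding abs_mult
        using mult_left_mono[OF prod_indicator_diff_bound(2)[OF VW(3), of x n], of "\<bar>f n x - ?g x\<bar>"] by simp
    qed
    also have "\<dots> \<le> ennreal \<delta>" by (rule g[OF n])
    also have "sqi ?T (\<lambda>x. f n x * ?\<chi> n x) \<le> of_nat n * (\<integral>\<^sup>+\<xi>. ?s \<xi> * indicator (V - W) \<xi> \<partial>\<mu>)"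
      by (rule sqi_symmetric_restrict_diff'[OF f_meas[OF n1] n1 f_sym[OF n1] VW])
    finally have "sqi M (\<lambda>\<omega>. TV n \<omega> - TW n \<omega>) \<le>
        fact n * (2 * (of_nat n * (\<integral>\<^sup>+\<xi>. ?s \<xi> * indicator (V - W) \<xi> \<partial>\<mu>)) + 2 * ennreal \<delta>)"
      by (simp add: add_mono mult_left_mono)
    also have "\<dots> = 2 * (of_nat n * fact n * (\<integral>\<^sup>+\<xi>. ?s \<xi> * indicator (V - W) \<xi> \<partial>\<mu>)) + 2 * (fact n * ennreal \<delta>)"
      by (simp add: distrib_left mult_ac)
    \<comment> \<open>The right-hand side is the weight \<open>?w n\<close> in the lower bound for
      the derivative.\<close>
    also have "of_nat n * fact n = ennreal ((real n)\<^sup>2) * fact (n - 1)"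
    proof -
      have "fact n = of_nat n * (fact (n - 1) :: ennreal)" using n1 fact_reduce[of n] by simp
      then show ?thesis by (simp add: power2_eq_square ennreal_mult' ennreal_of_nat_eq_real_of_nat mult.assoc)
    qed
    also have "ennreal ((real n)\<^sup>2) * fact (n - 1) * (\<integral>\<^sup>+\<xi>. ?s \<xi> * indicator (V - W) \<xi> \<partial>\<mu>) =
        (\<integral>\<^sup>+\<xi>. ennreal ((real n)\<^sup>2) * (fact (n - 1) * ?s \<xi>) * indicator (V - W) \<xi> \<partial>\<mu>)"
    proof -
      have "(\<lambda>\<xi>. ?s \<xi> * indicator (V - W) \<xi>) \<in> borel_measurable \<mu>"
        by (intro borel_measurable_times_ennreal measurable_sqi_slice[OF f_meas[OF n1] n1]
            borel_measurable_indicator) simp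
      then show ?thesis by (subst nn_integral_cmult[symmetric]) (simp_all only: mult.assoc)
    qed
    finally show ?thesis .
  qed
  have "sqi M (\<lambda>\<omega>. \<Sum>n\<in>?R. TV n \<omega> - TW n \<omega>) \<le>
    (\<Sum>n\<in>?R. 2 * (\<integral>\<^sup>+\<xi>. ?w n \<xi> *
        indicator (V - W) \<xi> \<partial>\<mu>) + 2 * (fact n * ennreal \<delta>))"
    unfolding orth by (rule sum_mono[OF piece])
  also have "\<dots> = 2 * (\<Sum>n\<in>?R. \<integral>\<^sup>+\<xi>. ?w n \<xi> *
        indicator (V - W) \<xi> \<partial>\<mu>) + 2 * (\<Sum>n\<in>?R. fact n * ennreal \<delta>)"
    by (simp add: sum.distrib sum_distrib_left)
  also have "(\<Sum>n\<in>?R. \<integral>\<^sup>+\<xi>. ?w n \<xi> *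
        indicator (V - W) \<xi> \<partial>\<mu>) =
      (\<integral>\<^sup>+\<xi>. (\<Sum>n\<in>?R. ?w n \<xi> *
        indicator (V - W) \<xi>) \<partial>\<mu>)"
  proof (rule nn_integral_sum[symmetric])
    fix n assume "n \<in> ?R"
    then have n1: "1 \<le> n" by simp
    have [measurable]: "V - W \<in> sets \<mu>" using VW by auto
    show "(\<lambda>\<xi>. ?w n \<xi> *
        indicator (V - W) \<xi>) \<in> borel_measurable \<mu>"
      by (intro borel_measurable_times_ennreal borel_measurable_const
          measurable_sqi_slice[OF f_meas[OF n1] n1] borel_measurable_indicator) simp
  qed
  \<comment> \<open>The hypothesis on the derivative is used here, and only on
    \<open>V - W\<close>.\<close>
  also have "\<dots> \<le> (\<integral>\<^sup>+\<xi>. 8 * (b \<xi> * indicator (V - W) \<xi>) \<partial>\<mu>)"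
  proof (rule nn_integral_mono_AE)
    show "AE \<xi> in \<mu>. (\<Sum>n\<in>?R. ?w n \<xi> *
        indicator (V - W) \<xi>) \<le> 8 * (b \<xi> * indicator (V - W) \<xi>)"
      using slices bound
    proof eventually_elim
      case (elim \<xi>)
      show ?case
      proof (cases "\<xi> \<in> V - W")
        case True
        then have "8 * sqi M (D \<xi>) \<le> 8 * b \<xi>" using elim by (intro mult_left_mono) auto
        then show ?thesis using elim True by (auto intro: order_trans)
      qed simp
    qed
  qed
  also have "\<dots> = 8 * ?I"
    using VW by (intro nn_integral_cmult) auto
  finally have VW_bound: "sqi M (\<lambda>\<omega>. \<Sum>n\<in>?R. TV n \<omega> - TW n \<omega>) \<le> 2 * (8 * ?I) + 2 * (\<Sum>n\<in>?R. fact n * ennreal \<delta>)"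
    by (simp add: add_mono mult_left_mono)
  define G where "G \<omega> = a + (\<Sum>n\<in>?R. TW n \<omega>)" for \<omega>
  show thesis
  proof (rule that)
    show "G \<in> borel_measurable (noise_on W)"
      unfolding G_def[abs_def] TW_def
      by (intro borel_measurable_add borel_measurable_const borel_measurable_sum
          measurable_elementary_integral_restrict E VW)
    have "sqi M (\<lambda>\<omega>. F \<omega> - G \<omega>) \<le> 2 * sqi M (\<lambda>\<omega>. F \<omega> - (a + (\<Sum>n\<in>?R. TV n \<omega>))) +
        2 * sqi M (\<lambda>\<omega>. (a + (\<Sum>n\<in>?R. TV n \<omega>)) - G \<omega>)"
      unfolding G_def by (rule sqi_triangle) measurable
    also have "(\<lambda>\<omega>. (a + (\<Sum>n\<in>?R. TV n \<omega>)) - G \<omega>) = (\<lambda>\<omega>. \<Sum>n\<in>?R. TV n \<omega> - TW n \<omega>)"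
      by (simp add: fun_eq_iff G_def sum_subtractf)
    finally have "sqi M (\<lambda>\<omega>. F \<omega> - G \<omega>) \<le> 2 * ennreal (e / 4 + 2 * (real m)\<^sup>2 * \<delta>) +
        2 * (2 * (8 * ?I) + 2 * (\<Sum>n\<in>?R. fact n * ennreal \<delta>))"
      using V_bound VW_bound by (meson add_mono mult_left_mono order_trans zero_le)
    also have "\<dots> = 32 * ?I + (2 * ennreal (e / 4 + 2 * (real m)\<^sup>2 * \<delta>) + 4 * (\<Sum>n\<in>?R. fact n * ennreal \<delta>))"
      by (simp add: distrib_left mult.assoc[symmetric] add_ac)
    also have "2 * ennreal (e / 4 + 2 * (real m)\<^sup>2 * \<delta>) + 4 * (\<Sum>n\<in>?R. fact n * ennreal \<delta>) = ennreal (e / 2 + C * \<delta>)"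
    proof -
      have fact: "(fact k :: ennreal) = ennreal (fact k)" for k
        using ennreal_of_nat_eq_real_of_nat[of "fact k"] by simp
      have "2 * ennreal (e / 4 + 2 * (real m)\<^sup>2 * \<delta>) = ennreal (2 * (e / 4 + 2 * (real m)\<^sup>2 * \<delta>))"
        using e \<delta>(1) by (subst ennreal_mult') auto
      moreover have "4 * (\<Sum>n\<in>?R. fact n * ennreal \<delta>) = ennreal (4 * (\<Sum>n\<in>?R. fact n * \<delta>))"
        unfolding fact using \<delta>(1)
        by (simp add: ennreal_mult' sum_nonneg sum_ennreal[symmetric])
      moreover have "2 * (e / 4 + 2 * (real m)\<^sup>2 * \<delta>) + 4 * (\<Sum>n\<in>?R. fact n * \<delta>) = e / 2 + C * \<delta>"
        unfolding C_def sum_distrib_right[symmetric] by (simp add: algebra_simps)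
      moreover have "0 \<le> 2 * (e / 4 + 2 * (real m)\<^sup>2 * \<delta>)" "0 \<le> 4 * (\<Sum>n\<in>?R. fact n * \<delta>)"
        using e \<delta>(1) by (auto intro!: sum_nonneg)
      ultimately show ?thesis by (simp only: ennreal_plus[symmetric])
    qed
    also have "ennreal (e / 2 + C * \<delta>) \<le> ennreal e" using \<delta>(2) by (intro ennreal_leI) simp
    finally show "sqi M (\<lambda>\<omega>. F \<omega> - G \<omega>) \<le> 32 * ?I + ennreal e" by (simp add: add_left_mono)
  qed
qed

end

section \<open>Ergodicity of stationary fields that are approximable by local noise\<close>

text \<open>\<open>W y R\<close> stands for the information within distance \<open>R\<close> of
  \<open>y\<close>. In \<open>approx\<close> the radius must not depend on \<open>y\<close>, because
  an event and its far shift are approximated with the same radius; closeness in probability is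
  enough for events.\<close>

locale locally_approximable_field = prob_space M
  for M :: "'w measure" +
  fixes X :: "real \<Rightarrow> 'w \<Rightarrow> real" and W :: "real \<Rightarrow> real \<Rightarrow> 'w measure"
  assumes X_measurable [measurable]: "X x \<in> borel_measurable M"
    and stationary: "strictly_stationary M X"
    and space_W: "space (W y R) = space M"
    and sets_W: "sets (W y R) \<subseteq> events"
    and W_mono: "\<bar>y - y'\<bar> + R \<le> R' \<Longrightarrow> sets (W y R) \<subseteq> sets (W y' R')"
    and W_indep: "R + R' < \<bar>y - y'\<bar> \<Longrightarrow> A \<in> sets (W y R) \<Longrightarrow> A' \<in> sets (W y' R') \<Longrightarrow>
      prob (A \<inter> A') = prob A * prob A'"
    and approx: "0 < \<delta> \<Longrightarrow> 0 < \<epsilon> \<Longrightarrow>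
      \<exists>R. \<forall>y. \<exists>F\<in>borel_measurable (W y R). prob {\<omega>\<in>space M. \<delta> < \<bar>X y \<omega> - F \<omega>\<bar>} \<le> \<epsilon>"
begin

abbreviation path_space :: "(real \<Rightarrow> real) measure" where
  "path_space \<equiv> PiM UNIV (\<lambda>_. borel)"

definition path_event :: "(real \<Rightarrow> real) set \<Rightarrow> real \<Rightarrow> 'w set" where
  "path_event B y = {\<omega>\<in>space M. (\<lambda>x. X (x + y) \<omega>) \<in> B}"

text \<open>One radius serves all shifts of the event. In this form the property passes to
  complements and countable unions, so it only has to be checked on half-lines of single
  coordinates.\<close>

definition locally_approximable :: "(real \<Rightarrow> real) set \<Rightarrow> bool" where
  "locally_approximable B \<longleftrightarrow> B \<in> sets path_space \<and>
     (\<forall>\<epsilon>>0. \<exists>R. \<forall>y. \<exists>A\<in>sets (W y R). prob (sym_diff (path_event B y) A) \<le> \<epsilon>)"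

lemma space_path_space [simp]: "space path_space = UNIV"
  by (simp add: space_PiM)

lemma measurable_path: "(\<lambda>\<omega> x. X (x + y) \<omega>) \<in> measurable M path_space"
  by (rule measurable_PiM_single') auto

lemma path_event_vimage: "path_event B y = (\<lambda>\<omega> x. X (x + y) \<omega>) -` B \<inter> space M"
  by (auto simp: path_event_def)

lemma path_event_events: "B \<in> sets path_space \<Longrightarrow> path_event B y \<in> events"
  unfolding path_event_vimage by (rule measurable_sets[OF measurable_path])

lemma prob_finite_dim_shift:
  assumes "finite J" "\<And>j. j \<in> J \<Longrightarrow> A j \<in> sets borel"
  shows "emeasure M {\<omega>\<in>space M. \<forall>j\<in>J. X (j + y) \<omega> \<in> A j} = emeasure M {\<omega>\<in>space M. \<forall>j\<in>J. X j \<omega> \<in> A j}"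
proof -
  have *: "emeasure (distr M (PiM J (\<lambda>_. borel)) (\<lambda>\<omega>. \<lambda>x\<in>J. Y x \<omega>)) (Pi\<^sub>E J A) =
      emeasure M {\<omega>\<in>space M. \<forall>j\<in>J. Y j \<omega> \<in> A j}"
    if Y: "\<And>x. Y x \<in> borel_measurable M" for Y :: "real \<Rightarrow> 'w \<Rightarrow> real"
  proof -
    have "(\<lambda>\<omega>. \<lambda>x\<in>J. Y x \<omega>) \<in> measurable M (PiM J (\<lambda>_. borel))"
      by (rule measurable_restrict) (rule Y)
    moreover have "Pi\<^sub>E J A \<in> sets (PiM J (\<lambda>_. borel))"
      using assms by (intro sets_PiM_I_finite) auto
    moreover have "(\<lambda>\<omega>. \<lambda>x\<in>J. Y x \<omega>) -` (Pi\<^sub>E J A) \<inter> space M = {\<omega>\<in>space M. \<forall>j\<in>J. Y j \<omega> \<in> A j}"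
      by (auto simp: PiE_iff)
    ultimately show ?thesis by (simp add: emeasure_distr)
  qed
  have "distr M (PiM J (\<lambda>_. borel)) (\<lambda>\<omega>. \<lambda>x\<in>J. X (x + y) \<omega>) =
        distr M (PiM J (\<lambda>_. borel)) (\<lambda>\<omega>. \<lambda>x\<in>J. X x \<omega>)"
    using stationary assms(1) unfolding strictly_stationary_def by blast
  then show ?thesis using *[of "\<lambda>x. X (x + y)"] *[of X] by simp
qed

text \<open>Stationarity speaks of finite-dimensional laws; these determine the law on the product
  sigma-field.\<close>

lemma distr_path_shift:
  "distr M path_space (\<lambda>\<omega> x. X (x + y) \<omega>) = distr M path_space (\<lambda>\<omega> x. X x \<omega>)"
proof (rule measure_eqI_PiM_infinite)
  show "finite_measure (distr M path_space (\<lambda>\<omega> x. X (x + y) \<omega>))"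
    by (rule finite_measure_distr[OF measurable_path])
  fix A :: "real \<Rightarrow> real set" and J :: "real set"
  assume J: "finite J" "J \<subseteq> UNIV" "\<And>i. i \<in> J \<Longrightarrow> A i \<in> sets borel"
  have emb: "prod_emb UNIV (\<lambda>_. borel) J (Pi\<^sub>E J A) = {f. \<forall>j\<in>J. f j \<in> A j}"
    by (auto simp: prod_emb_def PiE_iff)
  have sets: "prod_emb UNIV (\<lambda>_. borel) J (Pi\<^sub>E J A) \<in> sets path_space"
    using J by (intro sets_PiM_I) auto
  have *: "emeasure (distr M path_space (\<lambda>\<omega> x. X (x + z) \<omega>)) (prod_emb UNIV (\<lambda>_. borel) J (Pi\<^sub>E J A)) =
      emeasure M {\<omega>\<in>space M. \<forall>j\<in>J. X (j + z) \<omega> \<in> A j}" for z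
    by (subst emeasure_distr[OF measurable_path sets]) (auto simp: emb intro!: arg_cong[where f = "emeasure M"])
  show "emeasure (distr M path_space (\<lambda>\<omega> x. X (x + y) \<omega>)) (prod_emb UNIV (\<lambda>_. borel) J (Pi\<^sub>E J A)) =
      emeasure (distr M path_space (\<lambda>\<omega> x. X x \<omega>)) (prod_emb UNIV (\<lambda>_. borel) J (Pi\<^sub>E J A))"
    using *[of y] *[of 0] prob_finite_dim_shift[where J = J and A = A and y = y] J(1,3) by simp
qed simp_all

lemma prob_path_event_shift:
  assumes "B \<in> sets path_space"
  shows "prob (path_event B y) = prob (path_event B 0)"
proof -
  have "prob (path_event B z) = measure (distr M path_space (\<lambda>\<omega> x. X x \<omega>)) B" for z
    unfolding path_event_vimage distr_path_shift[of z, symmetric]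
    by (rule measure_distr[OF measurable_path assms, symmetric])
  then show ?thesis by simp
qed

section \<open>The locally approximable events form the whole product sigma-field\<close>

lemma locally_approximableD:
  "locally_approximable B \<Longrightarrow> 0 < \<epsilon> \<Longrightarrow>
    \<exists>R. \<forall>y. \<exists>A\<in>sets (W y R). prob (sym_diff (path_event B y) A) \<le> \<epsilon>"
  by (simp add: locally_approximable_def)

lemma locally_approximable_compl:
  assumes "locally_approximable B"
  shows "locally_approximable (- B)"
  unfolding locally_approximable_def
proof (intro conjI allI impI)
  have B: "B \<in> sets path_space" using assms by (simp add: locally_approximable_def)
  show "- B \<in> sets path_space" using sets.compl_sets[OF B] by (simp add: Compl_eq_Diff_UNIV)
  fix \<epsilon> :: real assume "0 < \<epsilon>"
  then obtain R where R: "\<And>y. \<exists>A\<in>sets (W y R). prob (sym_diff (path_event B y) A) \<le> \<epsilon>"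
    using locally_approximableD[OF assms] by blast
  show "\<exists>R. \<forall>y. \<exists>A\<in>sets (W y R). prob (sym_diff (path_event (- B) y) A) \<le> \<epsilon>"
  proof (intro exI[of _ R] allI)
    fix y
    obtain A where A: "A \<in> sets (W y R)" "prob (sym_diff (path_event B y) A) \<le> \<epsilon>"
      using R by blast
    have "A \<subseteq> space M" using A(1) sets_W sets.sets_into_space by blast
    then have "(path_event (- B) y - (space M - A)) \<union> ((space M - A) - path_event (- B) y) =
        (path_event B y - A) \<union> (A - path_event B y)"
      by (auto simp: path_event_def)
    moreover have "space M - A \<in> sets (W y R)"
      using sets.compl_sets[OF A(1)] by (simp add: space_W)
    ultimately show "\<exists>A\<in>sets (W y R). prob (sym_diff (path_event (- B) y) A) \<le> \<epsilon>"
      using A(2) by (intro bexI[of _ "space M - A"]) simp_all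
  qed
qed

lemma locally_approximable_empty: "locally_approximable {}"
  unfolding locally_approximable_def by (auto simp: path_event_def intro!: exI[of _ 0] bexI[of _ "{}"])

text \<open>The part of the union missed by the first \<open>m\<close> sets has small probability at
  position 0, hence by stationarity at every \<open>y\<close>; finitely many sets remain to be
  approximated.\<close>

lemma locally_approximable_UN:
  fixes B :: "nat \<Rightarrow> (real \<Rightarrow> real) set"
  assumes "\<And>n. locally_approximable (B n)"
  shows "locally_approximable (\<Union>n. B n)"
  unfolding locally_approximable_def
proof (intro conjI allI impI)
  have B[measurable]: "B n \<in> sets path_space" for n
    using assms by (simp add: locally_approximable_def)
  show UB: "(\<Union>n. B n) \<in> sets path_space" by (intro sets.countable_UN) auto
  fix \<epsilon> :: real assume \<epsilon>: "0 < \<epsilon>"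
  define T where "T m = (\<Union>n. B n) - (\<Union>n<m. B n)" for m
  have T: "T m \<in> sets path_space" for m
    unfolding T_def by (intro sets.Diff UB sets.countable_UN' B) auto
  have "(\<lambda>m. prob (path_event (T m) 0)) \<longlonglongrightarrow> prob (\<Inter>m. path_event (T m) 0)"
  proof (rule finite_Lim_measure_decseq)
    show "range (\<lambda>m. path_event (T m) 0) \<subseteq> events" using path_event_events[OF T] by blast
    show "decseq (\<lambda>m. path_event (T m) 0)"
      by (auto simp: decseq_def path_event_def T_def)
  qed
  moreover have "(\<Inter>m. path_event (T m) 0) = {}"
    by (auto simp: path_event_def T_def)
  ultimately have "(\<lambda>m. prob (path_event (T m) 0)) \<longlonglongrightarrow> 0" by simp
  then have "eventually (\<lambda>m. prob (path_event (T m) 0) < \<epsilon> / 2) sequentially"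
    using \<epsilon> by (intro order_tendstoD(2)) auto
  then obtain m where m: "prob (path_event (T m) 0) < \<epsilon> / 2"
    by (auto dest: eventually_happens)
  \<comment> \<open>The \<open>m\<close> errors together get half of \<open>\<epsilon>\<close>, the
    tail \<open>T m\<close> the other half; adding 1 covers \<open>m = 0\<close>.\<close>
  define \<eta> where "\<eta> = \<epsilon> / (2 * (real m + 1))"
  have \<eta>: "0 < \<eta>" "real m * \<eta> \<le> \<epsilon> / 2"
    using \<epsilon> by (auto simp: \<eta>_def field_simps)
  have "\<forall>n. \<exists>R. \<forall>y. \<exists>A\<in>sets (W y R). prob (sym_diff (path_event (B n) y) A) \<le> \<eta>"
    using locally_approximableD[OF assms \<eta>(1)] by blast
  then obtain R where R: "\<And>n y. \<exists>A\<in>sets (W y (R n)). prob (sym_diff (path_event (B n) y) A) \<le> \<eta>"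
    by metis
  \<comment> \<open>A common bound for the first \<open>m\<close> radii; absolute values, because
    nothing forces the radii to be nonnegative.\<close>
  define r where "r = (\<Sum>n<m. \<bar>R n\<bar>)"
  have r: "R n \<le> r" if "n < m" for n
  proof -
    have "\<bar>R n\<bar> \<le> r" unfolding r_def using that by (intro member_le_sum) auto
    then show ?thesis by simp
  qed
  show "\<exists>R. \<forall>y. \<exists>A\<in>sets (W y R). prob (sym_diff (path_event (\<Union>n. B n) y) A) \<le> \<epsilon>"
  proof (intro exI[of _ r] allI)
    fix y
    from R[of y] obtain A where A: "\<And>n. A n \<in> sets (W y (R n))"
      and A_prob: "\<And>n. prob ((path_event (B n) y - A n) \<union> (A n - path_event (B n) y)) \<le> \<eta>"
      by metis
    have A_ev: "A n \<in> events" for n using A sets_W by blast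
    have A_r: "A n \<in> sets (W y r)" if "n < m" for n
      using W_mono[of y y "R n" r] A[of n] r[OF that] by auto
    let ?D = "\<lambda>n. (path_event (B n) y - A n) \<union> (A n - path_event (B n) y)"
    have D: "?D n \<in> events" for n
      using path_event_events[OF B] A_ev by auto
    let ?A = "\<Union>n<m. A n"
    have A': "?A \<in> sets (W y r)"
      using A_r by (intro sets.countable_UN') auto
    have "prob (sym_diff (path_event (\<Union>n. B n) y) ?A) \<le>
        prob (path_event (T m) y \<union> (\<Union>n<m. ?D n))"
    proof (rule finite_measure_mono)
      show "(path_event (\<Union>n. B n) y - ?A) \<union> (?A - path_event (\<Union>n. B n) y) \<subseteq>
          path_event (T m) y \<union> (\<Union>n<m. ?D n)"
        by (auto simp: path_event_def T_def)
      show "path_event (T m) y \<union> (\<Union>n<m. ?D n) \<in> events"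
        using D path_event_events[OF T] by (intro sets.Un sets.countable_UN') auto
    qed
    also have "\<dots> \<le> prob (path_event (T m) y) + prob (\<Union>n<m. ?D n)"
      using D path_event_events[OF T] by (intro measure_Un_le sets.countable_UN') auto
    also have "prob (\<Union>n<m. ?D n) \<le> (\<Sum>n<m. prob (?D n))"
      using D by (intro measure_UNION_le) auto
    also have "\<dots> \<le> (\<Sum>n<m. \<eta>)" by (intro sum_mono A_prob)
    also have "\<dots> \<le> \<epsilon> / 2" using \<eta>(2) by simp
    also have "prob (path_event (T m) y) \<le> \<epsilon> / 2"
      using m prob_path_event_shift[OF T, of m y] by simp
    finally show "\<exists>A\<in>sets (W y r). prob (sym_diff (path_event (\<Union>n. B n) y) A) \<le> \<epsilon>"
      using A' by (intro bexI[of _ ?A]) simp_all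
  qed
qed

lemma coordinate_sets:
  assumes "A \<in> sets borel"
  shows "{f. f x \<in> A} \<in> sets path_space"
proof -
  have "(\<lambda>f. f x) -` A \<inter> space path_space \<in> sets path_space"
    using assms by (intro measurable_sets[OF measurable_component_singleton]) auto
  then show ?thesis by (simp add: vimage_def)
qed

text \<open>Let \<open>F\<close> be within \<open>d\<close> of the coordinate. Then comparing
  \<open>F\<close> with \<open>a + d\<close> instead of the coordinate with \<open>a\<close> errs
  only if the coordinate lies in the half-open interval from \<open>a\<close>, excluded, to
  \<open>a + 2 * d\<close>. These intervals shrink to the empty set, so an atom of the law at
  \<open>a\<close> does no harm, and stationarity makes the bound uniform in
  \<open>y\<close>.\<close>

lemma locally_approximable_halfline: "locally_approximable {f. f x \<le> a}"
  unfolding locally_approximable_def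
proof (intro conjI allI impI)
  show "{f. f x \<le> a} \<in> sets path_space"
    using coordinate_sets[of "{..a}" x] by simp
  fix \<epsilon> :: real assume \<epsilon>: "0 < \<epsilon>"
  define d where "d n = 1 / real (Suc n)" for n
  let ?T = "\<lambda>n. {f. a < f x \<and> f x \<le> a + 2 * d n}"
  have T: "?T n \<in> sets path_space" for n
    using coordinate_sets[of "{a<..a + 2 * d n}" x] by simp
  have d_mono: "d n \<le> d m" if "m \<le> n" for m n
    using that by (simp add: d_def frac_le)
  have "(\<lambda>m. prob (path_event (?T m) 0)) \<longlonglongrightarrow> prob (\<Inter>m. path_event (?T m) 0)"
  proof (rule finite_Lim_measure_decseq)
    show "range (\<lambda>m. path_event (?T m) 0) \<subseteq> events" using T path_event_events by blast
    show "decseq (\<lambda>m. path_event (?T m) 0)"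
      unfolding decseq_def
    proof (intro allI impI)
      fix m n :: nat assume "m \<le> n"
      with d_mono[OF this] show "path_event (?T n) 0 \<subseteq> path_event (?T m) 0"
        by (auto simp: path_event_def)
    qed
  qed
  moreover have "(\<Inter>m. path_event (?T m) 0) = {}"
  proof (rule ccontr)
    assume "(\<Inter>m. path_event (?T m) 0) \<noteq> {}"
    then obtain \<omega> where \<omega>: "\<And>m. a < X x \<omega> \<and> X x \<omega> \<le> a + 2 * d m"
      by (auto simp: path_event_def)
    then have "0 < (X x \<omega> - a) / 2" by auto
    then obtain m where "d m < (X x \<omega> - a) / 2"
      using nat_approx_posE unfolding d_def by blast
    with \<omega>[of m] show False by auto
  qed
  ultimately have "(\<lambda>m. prob (path_event (?T m) 0)) \<longlonglongrightarrow> 0" by simp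
  then have "eventually (\<lambda>m. prob (path_event (?T m) 0) < \<epsilon> / 2) sequentially"
    using \<epsilon> by (intro order_tendstoD(2)) auto
  then obtain m where m: "prob (path_event (?T m) 0) < \<epsilon> / 2"
    by (auto dest: eventually_happens)
  have dm: "0 < d m" by (simp add: d_def)
  obtain R where R: "\<And>y. \<exists>F\<in>borel_measurable (W y R). prob {\<omega>\<in>space M. d m < \<bar>X y \<omega> - F \<omega>\<bar>} \<le> \<epsilon> / 2"
    using approx[OF dm, of "\<epsilon> / 2"] \<epsilon> by auto
  show "\<exists>R. \<forall>y. \<exists>A\<in>sets (W y R). prob (sym_diff (path_event {f. f x \<le> a} y) A) \<le> \<epsilon>"
  \<comment> \<open>The approximant lives within \<open>R\<close> of \<open>x + y\<close>, hence
    within \<open>\<bar>x\<bar> + R\<close> of \<open>y\<close>.\<close>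
  proof (intro exI[of _ "\<bar>x\<bar> + R"] allI)
    fix y
    from R[of "x + y"] obtain F where F: "F \<in> borel_measurable (W (x + y) R)"
      and F_prob: "prob {\<omega>\<in>space M. d m < \<bar>X (x + y) \<omega> - F \<omega>\<bar>} \<le> \<epsilon> / 2" by blast
    have F_M[measurable]: "F \<in> borel_measurable M"
      by (rule measurable_from_subalg[OF _ F]) (simp add: subalgebra_def space_W sets_W)
    let ?A = "{\<omega>\<in>space M. F \<omega> \<le> a + d m}"
    have "{\<omega>\<in>space (W (x + y) R). F \<omega> \<le> a + d m} \<in> sets (W (x + y) R)"
      using F by measurable
    then have A: "?A \<in> sets (W y (\<bar>x\<bar> + R))"
      using W_mono[of "x + y" y R "\<bar>x\<bar> + R"] by (auto simp: space_W)
    let ?E = "path_event {f. f x \<le> a} y"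
    have "prob (sym_diff ?E ?A) \<le>
        prob (path_event (?T m) y \<union> {\<omega>\<in>space M. d m < \<bar>X (x + y) \<omega> - F \<omega>\<bar>})"
    proof (rule finite_measure_mono)
      show "(?E - ?A) \<union> (?A - ?E) \<subseteq> path_event (?T m) y \<union> {\<omega>\<in>space M. d m < \<bar>X (x + y) \<omega> - F \<omega>\<bar>}"
        by (auto simp: path_event_def)
      show "path_event (?T m) y \<union> {\<omega>\<in>space M. d m < \<bar>X (x + y) \<omega> - F \<omega>\<bar>} \<in> events"
        by (intro sets.Un path_event_events T) measurable
    qed
    also have "\<dots> \<le> prob (path_event (?T m) y) + prob {\<omega>\<in>space M. d m < \<bar>X (x + y) \<omega> - F \<omega>\<bar>}"
      by (intro measure_Un_le path_event_events T) measurable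
    also have "prob (path_event (?T m) y) \<le> \<epsilon> / 2"
      using m prob_path_event_shift[OF T, of m y] by simp
    finally show "\<exists>A\<in>sets (W y (\<bar>x\<bar> + R)). prob (sym_diff ?E A) \<le> \<epsilon>"
      using A F_prob by (intro bexI[of _ ?A]) simp_all
  qed
qed

lemma locally_approximable_coordinate:
  assumes "A \<in> sets (borel :: real measure)"
  shows "locally_approximable {f. f x \<in> A}"
proof -
  have "A \<in> sigma_sets UNIV (range (\<lambda>a::real. {..a}))"
    using assms by (simp add: borel_eq_atMost)
  then show ?thesis
  proof induction
    case (Basic S)
    then show ?case using locally_approximable_halfline[of x] by auto
  next
    case Empty
    then show ?case using locally_approximable_empty by simp
  next
    case (Compl S)
    have "{f. f x \<in> UNIV - S} = - {f. f x \<in> S}" by auto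
    with locally_approximable_compl[OF Compl.IH] show ?case by simp
  next
    case (Union S)
    have "{f. f x \<in> (\<Union>i. S i)} = (\<Union>i. {f. f x \<in> S i})" by auto
    with locally_approximable_UN[OF Union.IH] show ?case by simp
  qed
qed

lemma locally_approximable_sets:
  assumes "B \<in> sets path_space"
  shows "locally_approximable B"
proof -
  have "B \<in> sigma_sets (\<Pi>\<^sub>E i\<in>UNIV. space borel)
      {{f \<in> \<Pi>\<^sub>E i\<in>UNIV. space borel. f i \<in> A} | i A. i \<in> UNIV \<and> A \<in> sets borel}"
    using assms by (simp only: sets_PiM_single)
  then have "B \<in> sigma_sets UNIV {{f. f i \<in> A} | i A. A \<in> sets borel}"
    by simp
  then show ?thesis
  proof induction
    case (Basic S)
    then show ?case using locally_approximable_coordinate by auto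
  next
    case Empty
    then show ?case by (rule locally_approximable_empty)
  next
    case (Compl S)
    with locally_approximable_compl[OF Compl.IH] show ?case by (simp add: Compl_eq_Diff_UNIV)
  next
    case (Union S)
    then show ?case by (intro locally_approximable_UN)
  qed
qed

lemma prob_diff_le_symdiff:
  assumes "A \<in> events" "E \<in> events"
  shows "\<bar>prob A - prob E\<bar> \<le> prob (sym_diff E A)"
proof -
  have "prob A \<le> prob (E \<union> (sym_diff E A))"
    using assms by (intro finite_measure_mono) auto
  also have "\<dots> \<le> prob E + prob (sym_diff E A)"
    using assms by (intro measure_Un_le) auto
  finally have 1: "prob A \<le> prob E + prob (sym_diff E A)" .
  have "prob E \<le> prob (A \<union> (sym_diff E A))"
    using assms by (intro finite_measure_mono) auto
  also have "\<dots> \<le> prob A + prob (sym_diff E A)"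
    using assms by (intro measure_Un_le) auto
  finally show ?thesis using 1 by simp
qed

theorem ergodic: "ergodic_field M X"
  unfolding ergodic_field_def
proof (intro ballI impI)
  fix B :: "(real \<Rightarrow> real) set"
  assume B: "B \<in> sets path_space"
    and inv: "\<forall>y. AE \<omega> in M. (\<lambda>x. X (x + y) \<omega>) \<in> B \<longleftrightarrow> (\<lambda>x. X x \<omega>) \<in> B"
  let ?E = "path_event B"
  define p where "p = prob (?E 0)"
  have E: "?E y \<in> events" for y by (rule path_event_events[OF B])
  have "\<bar>p - p * p\<bar> \<le> 0 + \<epsilon>" if "0 < \<epsilon>" for \<epsilon>
  proof -
    \<comment> \<open>Replacing the two events in the intersection costs \<open>2 * \<eta>\<close>,
      and replacing the two factors of the product costs \<open>\<eta>\<close> each.\<close>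
    define \<eta> where "\<eta> = \<epsilon> / 4"
    have \<eta>: "0 < \<eta>" using that by (simp add: \<eta>_def)
    obtain R where R: "\<And>y. \<exists>A\<in>sets (W y R). prob (sym_diff (?E y) A) \<le> \<eta>"
      using locally_approximableD[OF locally_approximable_sets[OF B] \<eta>] by blast
    \<comment> \<open>Any distance above \<open>2 * R\<close> separates the windows around 0 and
      \<open>y\<close>.\<close>
    define y where "y = 2 * \<bar>R\<bar> + 1"
    obtain A where A: "A \<in> sets (W 0 R)" "prob (sym_diff (?E 0) A) \<le> \<eta>" using R by blast
    obtain A' where A': "A' \<in> sets (W y R)" "prob (sym_diff (?E y) A') \<le> \<eta>" using R by blast
    have ev: "A \<in> events" "A' \<in> events" using A A' sets_W by auto
    have ind: "prob (A \<inter> A') = prob A * prob A'"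
      by (rule W_indep[OF _ A(1) A'(1)]) (simp add: y_def)
    have "prob (?E 0 \<inter> ?E y) = p"
      unfolding p_def
    proof (rule finite_measure_eq_AE)
      show "AE \<omega> in M. \<omega> \<in> ?E 0 \<inter> ?E y \<longleftrightarrow> \<omega> \<in> ?E 0"
        using inv[rule_format, of y] by eventually_elim (auto simp: path_event_def)
    qed (use E in auto)
    moreover have "\<bar>prob (A \<inter> A') - prob (?E 0 \<inter> ?E y)\<bar> \<le> 2 * \<eta>"
    proof -
      have "\<bar>prob (A \<inter> A') - prob (?E 0 \<inter> ?E y)\<bar> \<le>
          prob ((?E 0 \<inter> ?E y - A \<inter> A') \<union> (A \<inter> A' - ?E 0 \<inter> ?E y))"
        using ev E by (intro prob_diff_le_symdiff) auto
      also have "\<dots> \<le> prob ((sym_diff (?E 0) A) \<union> (sym_diff (?E y) A'))"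
        using ev E by (intro finite_measure_mono) auto
      also have "\<dots> \<le> prob (sym_diff (?E 0) A) + prob (sym_diff (?E y) A')"
        using ev E by (intro measure_Un_le) auto
      finally show ?thesis using A(2) A'(2) by simp
    qed
    moreover have "\<bar>prob A - p\<bar> \<le> \<eta>"
      using prob_diff_le_symdiff[OF ev(1) E[of 0]] A(2) by (simp add: p_def)
    moreover have "\<bar>prob A' - p\<bar> \<le> \<eta>"
      using prob_diff_le_symdiff[OF ev(2) E[of y]] A'(2) prob_path_event_shift[OF B, of y] by (simp add: p_def)
    moreover have "\<bar>prob A * prob A' - p * p\<bar> \<le> \<bar>prob A - p\<bar> + \<bar>prob A' - p\<bar>"
    proof -
      have "prob A * prob A' - p * p = (prob A - p) * prob A' + p * (prob A' - p)"
        by (simp add: algebra_simps)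
      also have "\<bar>\<dots>\<bar> \<le> \<bar>prob A - p\<bar> * prob A' + p * \<bar>prob A' - p\<bar>"
        using abs_triangle_ineq[of "(prob A - p) * prob A'" "p * (prob A' - p)"]
        by (simp add: abs_mult p_def)
      also have "\<dots> \<le> \<bar>prob A - p\<bar> * 1 + 1 * \<bar>prob A' - p\<bar>"
        by (intro add_mono mult_mono) (auto simp: p_def)
      finally show ?thesis by simp
    qed
    moreover have "\<bar>p - p * p\<bar> \<le> \<bar>prob A * prob A' - p\<bar> + \<bar>prob A * prob A' - p * p\<bar>"
      by arith
    ultimately have "\<bar>p - p * p\<bar> \<le> 2 * \<eta> + (\<eta> + \<eta>)"
      unfolding ind by linarith
    then show ?thesis by (simp add: \<eta>_def)
  qed
  then have "\<bar>p - p * p\<bar> \<le> 0" by (rule field_le_epsilon)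
  then have "p * (1 - p) = 0" by (simp add: algebra_simps)
  then have "p \<in> {0, 1}" by simp
  moreover have "p = measure M {\<omega>\<in>space M. (\<lambda>x. X x \<omega>) \<in> B}"
    by (simp add: p_def path_event_def)
  ultimately show "measure M {\<omega>\<in>space M. (\<lambda>x. X x \<omega>) \<in> B} \<in> {0, 1}" by simp
qed

end

section \<open>The convolved kernel and the noise of the theorem\<close>

lemma wave_kernel_measurable [measurable]: "wave_kernel t \<in> borel_measurable borel"
  unfolding wave_kernel_def[abs_def] by measurable

lemma wave_kernel_le_indicator: "ennreal (wave_kernel t x) \<le> indicator {-t..t} x"
proof -
  have "wave_kernel t x \<le> indicator {-t..t} x" by (auto simp: wave_kernel_def indicator_def)
  then have "ennreal (wave_kernel t x) \<le> ennreal (indicator {-t..t} x)" by (rule ennreal_leI)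
  then show ?thesis by (simp add: ennreal_indicator)
qed

lemma nn_integral_lborel_reflect:
  fixes f :: "real \<Rightarrow> ennreal"
  assumes "f \<in> borel_measurable borel"
  shows "(\<integral>\<^sup>+x. f x \<partial>lborel) = (\<integral>\<^sup>+x. f (a - x) \<partial>lborel)"
  using nn_integral_real_affine[OF assms, of "-1" a] by simp

lemma nn_integral_lborel_shift:
  fixes f :: "real \<Rightarrow> ennreal"
  assumes "f \<in> borel_measurable borel"
  shows "(\<integral>\<^sup>+x. f x \<partial>lborel) = (\<integral>\<^sup>+x. f (a + x) \<partial>lborel)"
  using nn_integral_real_affine[OF assms, of 1 a] by simp

text \<open>On the bounded interval the weight in \<open>tempered\<close> is at least
  \<open>1 / ?K\<close>, so the unweighted integral is at most \<open>?K\<close> times the finite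
  weighted one.\<close>

lemma tempered_locally_integrable:
  assumes "tempered f"
  shows "(\<integral>\<^sup>+x. f x * indicator {-c..c} x \<partial>lborel) < \<infinity>"
proof -
  from assms obtain k where f[measurable]: "f \<in> borel_measurable borel" and k: "0 < k"
    and fin: "(\<integral>\<^sup>+x. f x * ennreal ((1 + x\<^sup>2) powr (- k)) \<partial>lborel) < \<infinity>"
    by (auto simp: tempered_def)
  let ?K = "(1 + c\<^sup>2) powr k"
  have "(\<integral>\<^sup>+x. f x * indicator {-c..c} x \<partial>lborel) \<le>
      (\<integral>\<^sup>+x. ennreal ?K * (f x * ennreal ((1 + x\<^sup>2) powr (- k))) \<partial>lborel)"
  proof (rule nn_integral_mono)
    fix x :: real
    show "f x * indicator {-c..c} x \<le> ennreal ?K * (f x * ennreal ((1 + x\<^sup>2) powr (- k)))"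
    proof (cases "x \<in> {-c..c}")
      case True
      then have "\<bar>x\<bar> \<le> \<bar>c\<bar>" by auto
      then have "x\<^sup>2 \<le> c\<^sup>2" by (simp add: abs_le_square_iff)
      then have "(1 + x\<^sup>2) powr k \<le> ?K" using k by (intro powr_mono2) auto
      moreover have "0 < (1 + x\<^sup>2) powr k"
        using add_pos_nonneg[OF zero_less_one zero_le_power2[of x]] by simp
      ultimately have "1 \<le> ?K * (1 + x\<^sup>2) powr (- k)"
        by (simp add: powr_minus divide_inverse[symmetric])
      then have "1 \<le> ennreal (?K * (1 + x\<^sup>2) powr (- k))" by simp
      then have "f x * 1 \<le> f x * ennreal (?K * (1 + x\<^sup>2) powr (- k))" by (rule mult_left_mono) simp
      then show ?thesis using True by (simp add: ennreal_mult' mult_ac)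
    qed simp
  qed
  also have "\<dots> = ennreal ?K * (\<integral>\<^sup>+x. f x * ennreal ((1 + x\<^sup>2) powr (- k)) \<partial>lborel)"
    by (rule nn_integral_cmult) measurable
  also have "\<dots> < \<infinity>" using fin by (simp add: ennreal_mult_less_top)
  finally show ?thesis .
qed

text \<open>Since the wave kernel is even, this is its convolution with \<open>\<kappa>\<close>. It
  will dominate the spatial factor of the derivative bound at \<open>u = y - x\<close>, for all
  intermediate times at once.\<close>

definition smoothed :: "(real \<Rightarrow> ennreal) \<Rightarrow> real \<Rightarrow> real \<Rightarrow> ennreal" where
  "smoothed \<kappa> t u = (\<integral>\<^sup>+w. ennreal (wave_kernel t w) * \<kappa> (u + w) \<partial>lborel)"

lemma measurable_smoothed [measurable]:
  assumes [measurable]: "\<kappa> \<in> borel_measurable borel"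
  shows "smoothed \<kappa> t \<in> borel_measurable borel"
  unfolding smoothed_def[abs_def] by measurable

text \<open>By Tonelli, the integral is \<open>\<integral>\<integral> G\<^sub>t(w) G\<^sub>t(w') f(w - w') dw dw'\<close>, where \<open>f\<close> is the
  self-convolution of \<open>\<kappa>\<close>.\<close>

lemma smoothed_L2:
  assumes \<kappa>[measurable]: "\<kappa> \<in> borel_measurable borel" and f: "tempered (self_convolution \<kappa>)"
  shows "(\<integral>\<^sup>+u. (smoothed \<kappa> t u)\<^sup>2 \<partial>lborel) < \<infinity>"
proof -
  let ?g = "\<lambda>w. ennreal (wave_kernel t w)"
  let ?f = "self_convolution \<kappa>"
  let ?K = "\<integral>\<^sup>+v. ?f v * indicator {-(2*t)..2*t} v \<partial>lborel"
  have f_meas[measurable]: "?f \<in> borel_measurable borel" using f by (simp add: tempered_def)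
  have [measurable]: "?g \<in> borel_measurable borel" by measurable
  have K: "?K < \<infinity>" by (rule tempered_locally_integrable[OF f])
  have sq: "(smoothed \<kappa> t u)\<^sup>2 = (\<integral>\<^sup>+w. \<integral>\<^sup>+w'. ?g w * \<kappa> (u + w) * (?g w' * \<kappa> (u + w')) \<partial>lborel \<partial>lborel)" for u
    unfolding power2_eq_square smoothed_def
    by (simp add: nn_integral_cmult nn_integral_multc)
  have conv: "(\<integral>\<^sup>+u. \<kappa> (u + w) * \<kappa> (u + w') \<partial>lborel) = ?f (w - w')" for w w'
  proof -
    \<comment> \<open>The reflection is chosen so that the integrand takes the literal form in
      \<open>self_convolution\<close>, with argument \<open>w - w'\<close>.\<close>
    have "(\<integral>\<^sup>+u. \<kappa> (u + w) * \<kappa> (u + w') \<partial>lborel) =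
        (\<integral>\<^sup>+u. \<kappa> ((- w' - u) + w) * \<kappa> ((- w' - u) + w') \<partial>lborel)"
      by (rule nn_integral_lborel_reflect) measurable
    then show ?thesis by (simp add: self_convolution_def algebra_simps)
  qed
  have "(\<integral>\<^sup>+u. (smoothed \<kappa> t u)\<^sup>2 \<partial>lborel) =
      (\<integral>\<^sup>+w. \<integral>\<^sup>+u. \<integral>\<^sup>+w'. ?g w * \<kappa> (u + w) * (?g w' * \<kappa> (u + w')) \<partial>lborel \<partial>lborel \<partial>lborel)"
    unfolding sq by (rule lborel_pair.Fubini'[symmetric]) measurable
  also have "\<dots> = (\<integral>\<^sup>+w. \<integral>\<^sup>+w'. \<integral>\<^sup>+u. ?g w * \<kappa> (u + w) * (?g w' * \<kappa> (u + w')) \<partial>lborel \<partial>lborel \<partial>lborel)"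
    by (intro nn_integral_cong lborel_pair.Fubini'[symmetric]) measurable
  also have "\<dots> = (\<integral>\<^sup>+w. ?g w * (\<integral>\<^sup>+w'. ?g w' * ?f (w - w') \<partial>lborel) \<partial>lborel)"
  proof (rule nn_integral_cong)
    fix w
    have "(\<integral>\<^sup>+u. ?g w * \<kappa> (u + w) * (?g w' * \<kappa> (u + w')) \<partial>lborel) = ?g w * (?g w' * ?f (w - w'))" for w'
    proof -
      have "(\<integral>\<^sup>+u. ?g w * \<kappa> (u + w) * (?g w' * \<kappa> (u + w')) \<partial>lborel) =
          (\<integral>\<^sup>+u. (?g w * ?g w') * (\<kappa> (u + w) * \<kappa> (u + w')) \<partial>lborel)"
        by (simp only: mult_ac)
      also have "\<dots> = (?g w * ?g w') * (\<integral>\<^sup>+u. \<kappa> (u + w) * \<kappa> (u + w') \<partial>lborel)"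
        by (rule nn_integral_cmult) measurable
      finally show ?thesis by (simp only: conv mult.assoc)
    qed
    then show "(\<integral>\<^sup>+w'. \<integral>\<^sup>+u. ?g w * \<kappa> (u + w) * (?g w' * \<kappa> (u + w')) \<partial>lborel \<partial>lborel) =
        ?g w * (\<integral>\<^sup>+w'. ?g w' * ?f (w - w') \<partial>lborel)"
      by (simp add: nn_integral_cmult)
  qed
  also have "\<dots> \<le> (\<integral>\<^sup>+w. ?K * ?g w \<partial>lborel)"
  proof (rule nn_integral_mono)
    fix w :: real
    \<comment> \<open>Both wave kernels live on an interval of radius \<open>t\<close>, so
      \<open>w - w'\<close> stays within \<open>2 * t\<close> and only the local integral
      \<open>?K\<close> of the self-convolution matters.\<close>
    show "?g w * (\<integral>\<^sup>+w'. ?g w' * ?f (w - w') \<partial>lborel) \<le> ?K * ?g w"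
    proof (cases "\<bar>w\<bar> < t")
      case True
      have "(\<integral>\<^sup>+w'. ?g w' * ?f (w - w') \<partial>lborel) = (\<integral>\<^sup>+v. ?g (w - v) * ?f (w - (w - v)) \<partial>lborel)"
        by (rule nn_integral_lborel_reflect) measurable
      also have "\<dots> \<le> ?K"
      proof (rule nn_integral_mono)
        fix v :: real
        have "?g (w - v) \<le> indicator {-t..t} (w - v)" by (rule wave_kernel_le_indicator)
        also have "\<dots> \<le> indicator {-(2*t)..2*t} v"
          using True by (auto simp: indicator_def)
        finally have "?g (w - v) \<le> indicator {-(2*t)..2*t} v" .
        then have "?g (w - v) * ?f v \<le> indicator {-(2*t)..2*t} v * ?f v"
          by (rule mult_right_mono) simp
        then show "?g (w - v) * ?f (w - (w - v)) \<le> ?f v * indicator {-(2*t)..2*t} v"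
          by (simp add: mult.commute)
      qed
      finally have "?g w * (\<integral>\<^sup>+w'. ?g w' * ?f (w - w') \<partial>lborel) \<le> ?g w * ?K"
        by (rule mult_left_mono) simp
      then show ?thesis by (simp add: mult.commute)
    qed (simp add: wave_kernel_def)
  qed
  also have "\<dots> = ?K * (\<integral>\<^sup>+w. ?g w \<partial>lborel)" by (rule nn_integral_cmult) measurable
  also have "\<dots> < \<infinity>"
  proof -
    have "(\<integral>\<^sup>+w. ?g w \<partial>lborel) \<le> (\<integral>\<^sup>+w. indicator {-t..t} w \<partial>lborel)"
      by (intro nn_integral_mono wave_kernel_le_indicator)
    also have "\<dots> < \<infinity>" by (simp add: emeasure_lborel_Icc_eq)
    finally show ?thesis using K by (simp add: ennreal_mult_less_top)
  qed
  finally show ?thesis .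
qed

lemma smoothed_tail:
  assumes \<kappa>[measurable]: "\<kappa> \<in> borel_measurable borel" and f: "tempered (self_convolution \<kappa>)"
  shows "(\<lambda>n. \<integral>\<^sup>+u. (smoothed \<kappa> t u)\<^sup>2 * indicator {u. real n < \<bar>u\<bar>} u \<partial>lborel) \<longlonglongrightarrow> 0"
proof -
  have "(\<lambda>n. \<integral>\<^sup>+u. (smoothed \<kappa> t u)\<^sup>2 * indicator {u. real n < \<bar>u\<bar>} u \<partial>lborel) \<longlonglongrightarrow> (\<integral>\<^sup>+u. 0 \<partial>(lborel :: real measure))"
  proof (rule nn_integral_dominated_convergence)
    show "(\<integral>\<^sup>+u. (smoothed \<kappa> t u)\<^sup>2 \<partial>lborel) < \<infinity>" by (rule smoothed_L2[OF \<kappa> f])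
    show "AE u in lborel. (smoothed \<kappa> t u)\<^sup>2 * indicator {u. real n < \<bar>u\<bar>} u \<le> (smoothed \<kappa> t u)\<^sup>2" for n
      by (auto simp: indicator_def)
    show "AE u in lborel. (\<lambda>n. (smoothed \<kappa> t u)\<^sup>2 * indicator {u. real n < \<bar>u\<bar>} u) \<longlonglongrightarrow> 0"
    proof (rule AE_I2)
      fix u :: real
      obtain k where k: "\<bar>u\<bar> \<le> real k" using real_arch_simple by blast
      have "eventually (\<lambda>n. (smoothed \<kappa> t u)\<^sup>2 * indicator {u. real n < \<bar>u\<bar>} u = 0) sequentially"
        using eventually_ge_at_top[of k] by eventually_elim (use k in \<open>auto simp: indicator_def\<close>)
      then show "(\<lambda>n. (smoothed \<kappa> t u)\<^sup>2 * indicator {u. real n < \<bar>u\<bar>} u) \<longlonglongrightarrow> 0"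
        by (rule tendsto_eventually)
    qed
  qed measurable
  then show ?thesis by simp
qed

lemma (in sigma_finite_measure) nn_integral_pair_mult:
  fixes g :: "'b \<Rightarrow> ennreal" and h :: "'a \<Rightarrow> ennreal"
  assumes [measurable]: "g \<in> borel_measurable S" "h \<in> borel_measurable M"
  shows "(\<integral>\<^sup>+p. g (fst p) * h (snd p) \<partial>(S \<Otimes>\<^sub>M M)) = (\<integral>\<^sup>+x. g x \<partial>S) * (\<integral>\<^sup>+y. h y \<partial>M)"
proof -
  have "(\<integral>\<^sup>+p. g (fst p) * h (snd p) \<partial>(S \<Otimes>\<^sub>M M)) = (\<integral>\<^sup>+x. \<integral>\<^sup>+y. g x * h y \<partial>M \<partial>S)"
    by (subst nn_integral_fst[symmetric]) simp_all
  also have "\<dots> = (\<integral>\<^sup>+x. g x * (\<integral>\<^sup>+y. h y \<partial>M) \<partial>S)"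
    by (intro nn_integral_cong nn_integral_cmult) simp
  also have "\<dots> = (\<integral>\<^sup>+x. g x \<partial>S) * (\<integral>\<^sup>+y. h y \<partial>M)"
    by (rule nn_integral_multc) simp
  finally show ?thesis .
qed

section \<open>The jump measure, the noise intensity and its windows\<close>

lemma sets_jump_measureI:
  fixes \<nu> :: "real measure"
  assumes "sets \<nu> = sets (restrict_space borel (- {0}))" "B \<in> sets borel" "B \<subseteq> - {0}"
  shows "B \<in> sets \<nu>"
  using assms by (auto simp: sets_restrict_space_iff)

lemma space_jump_measure:
  fixes \<nu> :: "real measure"
  assumes "sets \<nu> = sets (restrict_space borel (- {0}))"
  shows "space \<nu> = - {0}"
  using sets_eq_imp_space_eq[OF assms] by (simp add: space_restrict_space)

lemma measurable_jump_measure: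
  fixes \<nu> :: "real measure"
  assumes "sets \<nu> = sets (restrict_space borel (- {0}))" "f \<in> measurable borel S"
  shows "f \<in> measurable \<nu> S"
  unfolding measurable_cong_sets[OF assms(1) refl] by (rule measurable_restrict_space1[OF assms(2)])

text \<open>\<open>\<nu>\<close> may be infinite near 0, but by Chebyshev the second moment bounds
  its mass on each set \<open>A n\<close> of points at distance at least \<open>1 / Suc n\<close>
  from 0.\<close>

lemma sigma_finite_jump_measure:
  fixes \<nu> :: "real measure"
  assumes sets: "sets \<nu> = sets (restrict_space borel (- {0}))"
    and fin: "(\<integral>\<^sup>+z. ennreal (\<bar>z\<bar>\<^sup>2) \<partial>\<nu>) < \<infinity>"
  shows "sigma_finite_measure \<nu>"
proof
  define A where "A n = {z :: real. 1 \<le> real (Suc n) * \<bar>z\<bar>}" for n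
  have A_borel: "A n \<in> sets borel" for n unfolding A_def by measurable
  have A: "A n \<in> sets \<nu>" for n
    by (rule sets_jump_measureI[OF sets A_borel]) (auto simp: A_def)
  have "emeasure \<nu> (A n) \<noteq> \<infinity>" for n
  proof -
    have m2: "(\<lambda>z. ennreal (\<bar>z\<bar>\<^sup>2)) \<in> borel_measurable \<nu>"
      by (rule measurable_jump_measure[OF sets]) measurable
    have "emeasure \<nu> (A n) = (\<integral>\<^sup>+z. indicator (A n) z \<partial>\<nu>)" using A by simp
    also have "\<dots> \<le> (\<integral>\<^sup>+z. ennreal ((real (Suc n))\<^sup>2) * ennreal (\<bar>z\<bar>\<^sup>2) \<partial>\<nu>)"
    proof (rule nn_integral_mono)
      fix z :: real
      show "indicator (A n) z \<le> ennreal ((real (Suc n))\<^sup>2) * ennreal (\<bar>z\<bar>\<^sup>2)"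
      proof (cases "z \<in> A n")
        case True
        then have "1\<^sup>2 \<le> (real (Suc n) * \<bar>z\<bar>)\<^sup>2" by (intro power_mono) (auto simp: A_def)
        then have "1 \<le> ennreal ((real (Suc n) * \<bar>z\<bar>)\<^sup>2)" by simp
        then show ?thesis using True by (simp only: power_mult_distrib) (simp add: ennreal_mult')
      qed simp
    qed
    also have "\<dots> = ennreal ((real (Suc n))\<^sup>2) * (\<integral>\<^sup>+z. ennreal (\<bar>z\<bar>\<^sup>2) \<partial>\<nu>)"
      by (rule nn_integral_cmult[OF m2])
    also have "\<dots> < \<infinity>" using fin by (simp add: ennreal_mult_less_top del: power2_abs)
    finally show ?thesis by simp
  qed
  moreover have "(\<Union>n. A n) = space \<nu>"
  proof (intro equalityI subsetI)
    fix z assume "z \<in> space \<nu>"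
    then have "0 < \<bar>z\<bar>" by (simp add: space_jump_measure[OF sets])
    then obtain n where "inverse (real (Suc n)) < \<bar>z\<bar>" using reals_Archimedean by blast
    then have "1 < real (Suc n) * \<bar>z\<bar>" by (simp add: field_simps)
    then show "z \<in> (\<Union>n. A n)" by (auto simp: A_def intro!: exI[of _ n])
  next
    fix z assume "z \<in> (\<Union>n. A n)"
    then show "z \<in> space \<nu>" using A sets.sets_into_space by blast
  qed
  ultimately show "\<exists>A. countable A \<and> A \<subseteq> sets \<nu> \<and> \<Union>A = space \<nu> \<and> (\<forall>a\<in>A. emeasure \<nu> a \<noteq> \<infinity>)"
    using A by (intro exI[of _ "range A"]) auto
qed

lemma sigma_finite_time: "sigma_finite_measure (restrict_space (lborel :: real measure) {0..})"
  by (rule sigma_finite_measure_restrict_space[OF sigma_finite_lborel]) simp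

lemma sigma_finite_noise_intensity:
  assumes "sigma_finite_measure \<nu>"
  shows "sigma_finite_measure (noise_intensity \<nu>)"
  unfolding noise_intensity_def
  by (intro sigma_finite_pair_measure sigma_finite_time sigma_finite_lborel assms)

text \<open>\<open>A = UNIV\<close> gives the strip \<open>V\<close> of the overview, an interval
  gives its window \<open>W\<close>; the factor \<open>- {0}\<close> is the whole space of the jump
  measure.\<close>

definition noise_window :: "real \<Rightarrow> real set \<Rightarrow> (real \<times> real \<times> real) set" where
  "noise_window t A = {0..t} \<times> A \<times> (- {0})"

lemma sets_noise_box:
  assumes sets: "sets \<nu> = sets (restrict_space borel (- {0}))"
    and "A \<in> sets borel" "B \<in> sets borel" "B \<subseteq> - {0}"
  shows "{0..s} \<times> A \<times> B \<in> sets (noise_intensity \<nu>)"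
proof -
  have "{0..s} \<in> sets (restrict_space lborel {0..})"
    by (auto simp: sets_restrict_space_iff)
  then show ?thesis
    unfolding noise_intensity_def using assms
    by (intro pair_measureI sets_jump_measureI[OF sets]) auto
qed

lemma sets_noise_window:
  assumes "sets \<nu> = sets (restrict_space borel (- {0}))" "A \<in> sets borel"
  shows "noise_window t A \<in> sets (noise_intensity \<nu>)"
  unfolding noise_window_def by (rule sets_noise_box[OF assms(1)]) (use assms(2) in auto)

lemma noise_window_disjoint: "A \<inter> A' = {} \<Longrightarrow> noise_window t A \<inter> noise_window t A' = {}"
  by (auto simp: noise_window_def)

lemma noise_window_mono: "A \<subseteq> A' \<Longrightarrow> noise_window t A \<subseteq> noise_window t A'"
  by (auto simp: noise_window_def)

text \<open>The derivative bound is assumed only strictly between times 0 and \<open>t\<close>,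
  while the strip contains both end times; these are negligible for the intensity.\<close>

lemma AE_time_interior:
  fixes \<nu> :: "real measure"
  assumes "sigma_finite_measure \<nu>"
  shows "AE \<xi> in noise_intensity \<nu>. \<xi> \<in> noise_window t UNIV \<longrightarrow> 0 < fst \<xi> \<and> fst \<xi> < t"
proof -
  let ?L = "restrict_space (lborel :: real measure) {0..}"
  interpret S: sigma_finite_measure "(lborel :: real measure) \<Otimes>\<^sub>M \<nu>"
    by (intro sigma_finite_pair_measure sigma_finite_lborel assms)
  interpret L: sigma_finite_measure ?L by (rule sigma_finite_time)
  interpret pair_sigma_finite ?L "(lborel :: real measure) \<Otimes>\<^sub>M \<nu>" ..
  have fst: "fst \<in> borel_measurable (?L \<Otimes>\<^sub>M ((lborel :: real measure) \<Otimes>\<^sub>M \<nu>))"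
    by (rule measurable_compose[OF measurable_fst, of "\<lambda>x. x"]) (rule measurable_restrict_space1, simp)
  have "AE r in (lborel :: real measure). r \<noteq> 0 \<and> r \<noteq> t"
    by (intro AE_conjI AE_lborel_singleton)
  then have AE_L: "AE r in ?L. r \<noteq> 0 \<and> r \<noteq> t"
    by (subst AE_restrict_space_iff) auto
  have "AE \<xi> in ?L \<Otimes>\<^sub>M ((lborel :: real measure) \<Otimes>\<^sub>M \<nu>). fst \<xi> \<noteq> 0 \<and> fst \<xi> \<noteq> t"
  proof (intro AE_pair_measure)
    have "fst -` (- {0, t}) \<inter> space (?L \<Otimes>\<^sub>M ((lborel :: real measure) \<Otimes>\<^sub>M \<nu>)) \<in> sets (?L \<Otimes>\<^sub>M ((lborel :: real measure) \<Otimes>\<^sub>M \<nu>))"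
      by (rule measurable_sets[OF fst]) simp
    moreover have "fst -` (- {0, t}) \<inter> space (?L \<Otimes>\<^sub>M ((lborel :: real measure) \<Otimes>\<^sub>M \<nu>)) =
        {p \<in> space (?L \<Otimes>\<^sub>M ((lborel :: real measure) \<Otimes>\<^sub>M \<nu>)). fst p \<noteq> 0 \<and> fst p \<noteq> t}"
      by auto
    ultimately show "{p \<in> space (?L \<Otimes>\<^sub>M ((lborel :: real measure) \<Otimes>\<^sub>M \<nu>)). fst p \<noteq> 0 \<and> fst p \<noteq> t}
        \<in> sets (?L \<Otimes>\<^sub>M ((lborel :: real measure) \<Otimes>\<^sub>M \<nu>))" by (simp only:)
    show "AE r in ?L. AE q in (lborel :: real measure) \<Otimes>\<^sub>M \<nu>. fst (r, q) \<noteq> 0 \<and> fst (r, q) \<noteq> t"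
      using AE_L by eventually_elim simp
  qed
  then show ?thesis
    unfolding noise_intensity_def by eventually_elim (auto simp: noise_window_def)
qed

text \<open>The dominating function does not depend on time, and strip minus window is a product
  set, so Tonelli separates time, space and jumps. All dependence on the window sits in the space
  integral.\<close>

lemma noise_window_integral:
  fixes h :: "real \<Rightarrow> ennreal" and k :: "real \<Rightarrow> ennreal"
  assumes sets: "sets \<nu> = sets (restrict_space borel (- {0}))" and sf: "sigma_finite_measure \<nu>"
    and [measurable]: "h \<in> borel_measurable borel" "k \<in> borel_measurable borel"
    and A[measurable]: "A \<in> sets borel" and t: "0 \<le> t"
  shows "(\<lambda>(r, y, z). h y * k z) \<in> borel_measurable (noise_intensity \<nu>)"
    and "(\<integral>\<^sup>+\<xi>. (case \<xi> of (r, y, z) \<Rightarrow> h y * k z) * indicator (noise_window t UNIV - noise_window t A) \<xi> \<partial>noise_intensity \<nu>) =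
      ennreal t * ((\<integral>\<^sup>+y. h y * indicator (- A) y \<partial>lborel) * (\<integral>\<^sup>+z. k z \<partial>\<nu>))"
proof -
  let ?L = "restrict_space (lborel :: real measure) {0..}"
  interpret S: sigma_finite_measure "(lborel :: real measure) \<Otimes>\<^sub>M \<nu>"
    by (intro sigma_finite_pair_measure sigma_finite_lborel sf)
  interpret nu: sigma_finite_measure \<nu> by (rule sf)
  have k_nu[measurable]: "k \<in> borel_measurable \<nu>" by (rule measurable_jump_measure[OF sets]) simp
  show "(\<lambda>(r, y, z). h y * k z) \<in> borel_measurable (noise_intensity \<nu>)"
    unfolding noise_intensity_def by measurable
  show "(\<integral>\<^sup>+\<xi>. (case \<xi> of (r, y, z) \<Rightarrow> h y * k z) * indicator (noise_window t UNIV - noise_window t A) \<xi> \<partial>noise_intensity \<nu>) =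
      ennreal t * ((\<integral>\<^sup>+y. h y * indicator (- A) y \<partial>lborel) * (\<integral>\<^sup>+z. k z \<partial>\<nu>))"
  proof -
    have ind_L[measurable]: "(indicator {0..t} :: real \<Rightarrow> ennreal) \<in> borel_measurable ?L"
      by (rule measurable_restrict_space1) simp
    have "(\<integral>\<^sup>+\<xi>. (case \<xi> of (r, y, z) \<Rightarrow> h y * k z) * indicator (noise_window t UNIV - noise_window t A) \<xi> \<partial>noise_intensity \<nu>) =
        (\<integral>\<^sup>+p. indicator {0..t} (fst p) * (\<lambda>q. (h (fst q) * indicator (- A) (fst q)) * k (snd q)) (snd p)
          \<partial>(?L \<Otimes>\<^sub>M ((lborel :: real measure) \<Otimes>\<^sub>M \<nu>)))"
      unfolding noise_intensity_def
    proof (rule nn_integral_cong)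
      fix p assume "p \<in> space (?L \<Otimes>\<^sub>M ((lborel :: real measure) \<Otimes>\<^sub>M \<nu>))"
      then have "snd (snd p) \<noteq> 0"
        by (auto simp: space_pair_measure space_jump_measure[OF sets])
      then show "(case p of (r, y, z) \<Rightarrow> h y * k z) * indicator (noise_window t UNIV - noise_window t A) p =
          indicator {0..t} (fst p) * ((h (fst (snd p)) * indicator (- A) (fst (snd p))) * k (snd (snd p)))"
        by (cases p) (auto simp: noise_window_def indicator_def)
    qed
    also have "\<dots> = (\<integral>\<^sup>+r. indicator {0..t} r \<partial>?L) *
        (\<integral>\<^sup>+q. (h (fst q) * indicator (- A) (fst q)) * k (snd q) \<partial>((lborel :: real measure) \<Otimes>\<^sub>M \<nu>))"
      by (rule S.nn_integral_pair_mult) measurable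
    also have "(\<integral>\<^sup>+q. (h (fst q) * indicator (- A) (fst q)) * k (snd q) \<partial>((lborel :: real measure) \<Otimes>\<^sub>M \<nu>)) =
        (\<integral>\<^sup>+y. h y * indicator (- A) y \<partial>lborel) * (\<integral>\<^sup>+z. k z \<partial>\<nu>)"
      by (rule nu.nn_integral_pair_mult) measurable
    also have "(\<integral>\<^sup>+r. indicator {0..t} r \<partial>?L) = (\<integral>\<^sup>+r. indicator {0..t} r * indicator {0..} r \<partial>lborel)"
      by (rule nn_integral_restrict_space) simp
    also have "\<dots> = (\<integral>\<^sup>+r. indicator {0..t} r \<partial>lborel)"
      by (rule nn_integral_cong) (auto simp: indicator_def)
    also have "\<dots> = ennreal t" using t by simp
    finally show ?thesis .
  qed
qed


text \<open>Chebyshev's inequality, in the form that turns the squared-norm estimate of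
  \<open>local_approximation\<close> into the closeness in probability asked for in
  \<open>approx\<close>.\<close>

lemma (in prob_space) prob_abs_gt_le_sqi:
  assumes X[measurable]: "X \<in> borel_measurable M" and d: "0 < \<delta>" and le: "sqi M X \<le> ennreal (\<epsilon> * \<delta>\<^sup>2)" and e: "0 \<le> \<epsilon>"
  shows "prob {\<omega>\<in>space M. \<delta> < \<bar>X \<omega>\<bar>} \<le> \<epsilon>"
proof -
  let ?A = "{\<omega>\<in>space M. \<delta> < \<bar>X \<omega>\<bar>}"
  have "emeasure M ?A = (\<integral>\<^sup>+\<omega>. indicator ?A \<omega> \<partial>M)" by simp
  also have "\<dots> \<le> (\<integral>\<^sup>+\<omega>. ennreal (1 / \<delta>\<^sup>2) * ennreal ((X \<omega>)\<^sup>2) \<partial>M)"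
  proof (rule nn_integral_mono)
    fix \<omega>
    show "indicator ?A \<omega> \<le> ennreal (1 / \<delta>\<^sup>2) * ennreal ((X \<omega>)\<^sup>2)"
    proof (cases "\<omega> \<in> ?A")
      case True
      then have "\<delta>\<^sup>2 \<le> \<bar>X \<omega>\<bar>\<^sup>2" using d by (intro power_mono) auto
      then have "1 \<le> 1 / \<delta>\<^sup>2 * (X \<omega>)\<^sup>2" using d by (simp add: field_simps)
      then have "1 \<le> ennreal (1 / \<delta>\<^sup>2 * (X \<omega>)\<^sup>2)" by simp
      then show ?thesis using True by (simp only: ennreal_mult'' zero_le_power2 indicator_simps)
    next
      case False
      then have "indicator ?A \<omega> = (0 :: ennreal)" by (rule indicator_simps(2))
      then show ?thesis by (simp only: zero_le)
    qed
  qed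
  also have "\<dots> = ennreal (1 / \<delta>\<^sup>2) * sqi M X"
    unfolding sqi_def by (rule nn_integral_cmult) measurable
  also have "\<dots> \<le> ennreal (1 / \<delta>\<^sup>2) * ennreal (\<epsilon> * \<delta>\<^sup>2)"
    by (intro mult_left_mono le) simp
  also have "\<dots> = ennreal \<epsilon>" using d e by (simp add: ennreal_mult'[symmetric])
  finally show ?thesis using e by (simp add: emeasure_eq_measure)
qed

text \<open>Turns adaptedness into measurability for the noise in the strip: every box that
  generates the filtration ends at a time \<open>s \<le> t\<close> and so lies in the strip.\<close>

lemma noise_filtration_subset:
  assumes sets: "sets \<nu> = sets (restrict_space borel (- {0}))" and "poisson_noise M (noise_intensity \<nu>) N"
  shows "sets (noise_filtration M N t) \<subseteq>
    sets (poisson_noise.noise_on M (noise_intensity \<nu>) N (noise_window t UNIV))"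
proof -
  interpret poisson_noise M "noise_intensity \<nu>" N by (rule assms(2))
  let ?G = "{{\<omega>\<in>space M. emeasure (N \<omega>) ({0..s} \<times> A \<times> B) \<in> E} | s A B E.
         0 \<le> s \<and> s \<le> t \<and> A \<in> sets borel \<and> bounded A \<and>
         B \<in> sets borel \<and> B \<subseteq> - {0} \<and> bounded (inverse ` B) \<and> E \<in> sets (borel :: ennreal measure)}
      \<union> null_sets M"
  have G: "?G \<subseteq> sets (noise_on (noise_window t UNIV))"
  proof
    fix S assume "S \<in> ?G"
    then consider "S \<in> null_sets M" | s A B E where "S = {\<omega>\<in>space M. emeasure (N \<omega>) ({0..s} \<times> A \<times> B) \<in> E}"
      "s \<le> t" "A \<in> sets borel" "B \<in> sets borel" "B \<subseteq> - {0}" "E \<in> sets (borel :: ennreal measure)"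
      by blast
    then show "S \<in> sets (noise_on (noise_window t UNIV))"
    proof cases
      case 1
      then show ?thesis unfolding sets_noise_on by (intro sigma_sets.Basic) simp
    next
      case 2
      have "{0..s} \<times> A \<times> B \<in> sets (noise_intensity \<nu>)"
        by (rule sets_noise_box[OF sets 2(3,4,5)])
      moreover have "{0..s} \<times> A \<times> B \<subseteq> noise_window t UNIV"
        using 2(2,5) by (auto simp: noise_window_def)
      ultimately show ?thesis
        using measurable_Collect_mem[OF measurable_emeasure_N_noise_on, of "{0..s} \<times> A \<times> B" "noise_window t UNIV" E] 2(1,6)
        by simp
    qed
  qed
  moreover have "?G \<subseteq> Pow (space M)"
    by (rule subset_trans[OF G]) (use sets.space_closed[of "noise_on (noise_window t UNIV)"] in simp)
  ultimately show ?thesis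
    unfolding noise_filtration_def
    by (simp only: sets_measure_of) (rule sets.sigma_sets_subset[of _ "noise_on (noise_window t UNIV)", simplified])
qed

text \<open>Substitute \<open>w = x - y'\<close> and enlarge the wave kernel from time
  \<open>t - r\<close> to \<open>t\<close>. The result depends only on \<open>y - x\<close>, which
  makes the later estimate uniform in \<open>x\<close>.\<close>

lemma malliavin_bound_smoothed:
  assumes \<kappa>[measurable]: "\<kappa> \<in> borel_measurable borel" and r: "0 < r"
  shows "(\<integral>\<^sup>+y'. ennreal (wave_kernel (t - r) (x - y')) * \<kappa> (y - y') \<partial>lborel) \<le> smoothed \<kappa> t (y - x)"
proof -
  have "(\<integral>\<^sup>+y'. ennreal (wave_kernel (t - r) (x - y')) * \<kappa> (y - y') \<partial>lborel) =
      (\<integral>\<^sup>+w. ennreal (wave_kernel (t - r) (x - (x - w))) * \<kappa> (y - (x - w)) \<partial>lborel)"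
    by (rule nn_integral_lborel_reflect) measurable
  also have "\<dots> \<le> smoothed \<kappa> t (y - x)"
    unfolding smoothed_def
  proof (rule nn_integral_mono)
    fix w :: real
    have "wave_kernel (t - r) w \<le> wave_kernel t w" using r by (simp add: wave_kernel_def)
    then have "ennreal (wave_kernel (t - r) w) * \<kappa> (y - x + w) \<le> ennreal (wave_kernel t w) * \<kappa> (y - x + w)"
      by (intro mult_right_mono ennreal_leI) auto
    then show "ennreal (wave_kernel (t - r) (x - (x - w))) * \<kappa> (y - (x - w)) \<le>
        ennreal (wave_kernel t w) * \<kappa> (y - x + w)"
      by (simp add: algebra_simps)
  qed
  finally show ?thesis .
qed

theorem lemma5p2:
  fixes M :: "'w measure"
    and \<nu> :: "real measure"
    and N :: "'w \<Rightarrow> (real \<times> real \<times> real) measure"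
    and \<kappa> :: "real \<Rightarrow> ennreal"
    and Z :: "real \<Rightarrow> real \<Rightarrow> 'w \<Rightarrow> real"
    and DZ :: "real \<Rightarrow> real \<Rightarrow> real \<times> real \<times> real \<Rightarrow> 'w \<Rightarrow> real"
    and C :: "real \<Rightarrow> real"
  assumes "prob_space M" and "complete_measure M"
    and "sets \<nu> = sets (restrict_space borel (- {0}))"
    and "(\<integral>\<^sup>+z. ennreal (\<bar>z\<bar>\<^sup>2) \<partial>\<nu>) < \<infinity>"
    and "poisson_random_measure M (noise_intensity \<nu>) N"
    and "assumption_A \<kappa>" and "assumption_B \<kappa>"
    and "\<And>t x. t \<ge> 0 \<Longrightarrow> Z t x \<in> borel_measurable (noise_filtration M N t)"
    and "\<And>t. t \<ge> 0 \<Longrightarrow> strictly_stationary M (Z t)"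
    and "\<And>t x. t \<ge> 0 \<Longrightarrow> Z t x \<in> malliavin_dom M (noise_intensity \<nu>) N"
    and "\<And>t x. t \<ge> 0 \<Longrightarrow> is_malliavin_derivative M (noise_intensity \<nu>) N (Z t x) (DZ t x)"
    and "\<And>t. t > 0 \<Longrightarrow> C t > 0"
    and "\<And>r t x y z. 0 < r \<Longrightarrow> r < t \<Longrightarrow> z \<noteq> 0 \<Longrightarrow>
           l2norm M (DZ t x (r, y, z)) \<le>
             ennreal (C t * \<bar>z\<bar>) *
               (\<integral>\<^sup>+y'. ennreal (wave_kernel (t - r) (x - y')) * \<kappa> (y - y') \<partial>lborel)"
  shows "\<forall>t>0. ergodic_field M (Z t)"
proof (intro allI impI)
  fix t :: real assume t: "0 < t"
  note sets_\<nu> = assms(3)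
  have sf: "sigma_finite_measure \<nu>" by (rule sigma_finite_jump_measure[OF assms(3,4)])
  have noise: "poisson_noise M (noise_intensity \<nu>) N"
    using assms(1,5) sigma_finite_noise_intensity[OF sf]
    by (simp add: poisson_noise_def poisson_noise_axioms_def)
  interpret poisson_noise M "noise_intensity \<nu>" N by (rule noise)
  have \<kappa>[measurable]: "\<kappa> \<in> borel_measurable borel" and f: "tempered (self_convolution \<kappa>)"
    using assms(6) by (auto simp: assumption_A_def tempered_def)
  have Z_noise: "Z t x \<in> borel_measurable (noise_on (noise_window t UNIV))" for x
  proof (rule measurable_from_subalg)
    show "subalgebra (noise_on (noise_window t UNIV)) (noise_filtration M N t)"
      using noise_filtration_subset[OF sets_\<nu> noise, of t]
      by (simp add: subalgebra_def noise_filtration_def space_measure_of_conv)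
    show "Z t x \<in> borel_measurable (noise_filtration M N t)" using assms(8) t by simp
  qed
  define V where "V = noise_window t UNIV"
  define W where "W x R = noise_window t {x - R..x + R}" for x R
  have V_sets: "V \<in> sets (noise_intensity \<nu>)" and W_sets: "W x R \<in> sets (noise_intensity \<nu>)"
    and WV: "W x R \<subseteq> V" for x R
    unfolding V_def W_def using sets_noise_window[OF sets_\<nu>] noise_window_mono by auto
  \<comment> \<open>The squared derivative bound is the product of a jump factor \<open>k z\<close>,
    integrable by the second moment of \<open>\<nu>\<close>, and a space factor
    \<open>h x y\<close>, integrable by \<open>smoothed_L2\<close>.\<close>
  define k where "k z = (ennreal (C t * \<bar>z\<bar>))\<^sup>2" for z
  define h where "h x y = (smoothed \<kappa> t (y - x))\<^sup>2" for x y
  have k_meas[measurable]: "k \<in> borel_measurable borel" unfolding k_def[abs_def] by measurable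
  have h_meas[measurable]: "h x \<in> borel_measurable borel" for x unfolding h_def[abs_def] by measurable
  have k_fin: "(\<integral>\<^sup>+z. k z \<partial>\<nu>) < \<infinity>"
  proof -
    have "(\<integral>\<^sup>+z. k z \<partial>\<nu>) = (\<integral>\<^sup>+z. ennreal ((C t)\<^sup>2) * ennreal (\<bar>z\<bar>\<^sup>2) \<partial>\<nu>)"
      unfolding k_def using assms(12)[OF t]
      by (intro nn_integral_cong) (simp add: ennreal_power power_mult_distrib ennreal_mult')
    also have "\<dots> = ennreal ((C t)\<^sup>2) * (\<integral>\<^sup>+z. ennreal (\<bar>z\<bar>\<^sup>2) \<partial>\<nu>)"
      by (rule nn_integral_cmult, rule measurable_jump_measure[OF sets_\<nu>]) measurable
    also have "\<dots> < \<infinity>" using assms(4) by (simp add: ennreal_mult_less_top del: power2_abs)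
    finally show ?thesis .
  qed
  have bound: "AE \<xi> in noise_intensity \<nu>. \<xi> \<in> V - W x R \<longrightarrow>
      sqi M (DZ t x \<xi>) \<le> (case \<xi> of (r, y, z) \<Rightarrow> h x y * k z)" for x R
    using AE_time_interior[OF sf, of t]
  proof eventually_elim
    case (elim \<xi>)
    show ?case
    proof
      assume \<xi>: "\<xi> \<in> V - W x R"
      obtain r y z where ryz: "\<xi> = (r, y, z)" by (cases \<xi>)
      then have r: "0 < r" "r < t" and z: "z \<noteq> 0"
        using elim \<xi> by (auto simp: V_def noise_window_def)
      have "l2norm M (DZ t x (r, y, z)) \<le> ennreal (C t * \<bar>z\<bar>) *
          (\<integral>\<^sup>+y'. ennreal (wave_kernel (t - r) (x - y')) * \<kappa> (y - y') \<partial>lborel)"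
        by (rule assms(13)[OF r z])
      also have "\<dots> \<le> ennreal (C t * \<bar>z\<bar>) * smoothed \<kappa> t (y - x)"
        by (intro mult_left_mono malliavin_bound_smoothed \<kappa> r) simp
      finally have "(l2norm M (DZ t x (r, y, z)))\<^sup>2 \<le> (ennreal (C t * \<bar>z\<bar>) * smoothed \<kappa> t (y - x))\<^sup>2"
        by (rule power_mono) simp
      then show "sqi M (DZ t x \<xi>) \<le> (case \<xi> of (r, y, z) \<Rightarrow> h x y * k z)"
        by (simp add: ryz l2norm_power2 h_def k_def power_mult_distrib mult.commute)
    qed
  qed
  \<comment> \<open>By translation this is the space integral outside the window of radius
    \<open>n\<close> around any \<open>x\<close>; its independence of \<open>x\<close> is the
    uniformity that \<open>approx\<close> demands.\<close>
  define T where "T n = (\<integral>\<^sup>+u. (smoothed \<kappa> t u)\<^sup>2 * indicator {u. real n < \<bar>u\<bar>} u \<partial>lborel)" for n :: nat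
  have T_lim: "T \<longlonglongrightarrow> 0" unfolding T_def[abs_def] by (rule smoothed_tail[OF \<kappa> f])
  have T_eq: "(\<integral>\<^sup>+y. h x y * indicator (- {x - real n..x + real n}) y \<partial>lborel) = T n" for x n
  proof -
    have "(\<integral>\<^sup>+y. h x y * indicator (- {x - real n..x + real n}) y \<partial>lborel) =
        (\<integral>\<^sup>+u. h x (x + u) * indicator (- {x - real n..x + real n}) (x + u) \<partial>lborel)"
      by (rule nn_integral_lborel_shift) measurable
    also have "\<dots> = T n"
      unfolding T_def h_def by (intro nn_integral_cong) (auto simp: indicator_def)
    finally show ?thesis .
  qed
  interpret locally_approximable_field M "Z t" "\<lambda>x R. noise_on (W x R)"
  proof
    show "Z t x \<in> borel_measurable M" for x by (rule measurable_noise_onD[OF Z_noise])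
    show "strictly_stationary M (Z t)" using assms(9) t by simp
    show "space (noise_on (W y R)) = space M" for y R by simp
    show "sets (noise_on (W y R)) \<subseteq> events" for y R by (rule sets_noise_on_subset)
    show "sets (noise_on (W y R)) \<subseteq> sets (noise_on (W y' R'))" if "\<bar>y - y'\<bar> + R \<le> R'" for y y' R R'
      using that unfolding W_def by (intro noise_on_mono noise_window_mono) auto
    show "prob (A \<inter> A') = prob A * prob A'"
      if "R + R' < \<bar>y - y'\<bar>" "A \<in> sets (noise_on (W y R))" "A' \<in> sets (noise_on (W y' R'))" for y y' R R' A A'
    proof (rule noise_on_indep[OF _ that(2,3)])
      show "W y R \<inter> W y' R' = {}"
        unfolding W_def using that(1) by (intro noise_window_disjoint) auto
    qed
    fix \<delta> \<epsilon> :: real assume \<delta>: "0 < \<delta>" and \<epsilon>: "0 < \<epsilon>"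
    \<comment> \<open>One \<open>e\<close> for the integral outside the window and one for the error
      term of \<open>local_approximation\<close>; Chebyshev then divides \<open>2 * e\<close> by
      \<open>\<delta>\<^sup>2\<close>.\<close>
    define e where "e = \<epsilon> * \<delta>\<^sup>2 / 2"
    have e: "0 < e" using \<delta> \<epsilon> by (simp add: e_def)
    let ?c = "32 * (ennreal t * (\<integral>\<^sup>+z. k z \<partial>\<nu>))"
    have "?c < \<infinity>" using k_fin by (simp add: ennreal_mult_less_top)
    then have "(\<lambda>n. ?c * T n) \<longlonglongrightarrow> ?c * 0"
      by (intro ennreal_tendsto_cmult T_lim) simp
    then have "eventually (\<lambda>n. ?c * T n < ennreal e) sequentially"
      using e by (intro order_tendstoD(2)) auto
    then obtain n where n: "?c * T n < ennreal e"
      by (auto dest: eventually_happens)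
    show "\<exists>R. \<forall>y. \<exists>F\<in>borel_measurable (noise_on (W y R)). prob {\<omega>\<in>space M. \<delta> < \<bar>Z t y \<omega> - F \<omega>\<bar>} \<le> \<epsilon>"
    proof (intro exI[of _ "real n"] allI)
      fix y
      note int = noise_window_integral[OF sets_\<nu> sf h_meas k_meas, of "{y - real n..y + real n}" t y]
      have deriv: "is_malliavin_derivative M (noise_intensity \<nu>) N (Z t y) (DZ t y)"
        using assms(11) t by simp
      have int_meas: "(\<lambda>(r, y', z). h y y' * k z) \<in> borel_measurable (noise_intensity \<nu>)"
        using int(1) t by simp
      obtain G where G: "G \<in> borel_measurable (noise_on (W y (real n)))"
        and le: "sqi M (\<lambda>\<omega>. Z t y \<omega> - G \<omega>) \<le>
          32 * (\<integral>\<^sup>+\<xi>. (case \<xi> of (r, y', z) \<Rightarrow> h y y' * k z) * indicator (V - W y (real n)) \<xi> \<partial>noise_intensity \<nu>) + ennreal e"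
        by (rule local_approximation[OF deriv Z_noise[folded V_def] V_sets W_sets WV bound int_meas e])
      have "(\<integral>\<^sup>+\<xi>. (case \<xi> of (r, y', z) \<Rightarrow> h y y' * k z) * indicator (V - W y (real n)) \<xi> \<partial>noise_intensity \<nu>) =
          ennreal t * (T n * (\<integral>\<^sup>+z. k z \<partial>\<nu>))"
        using int(2) t unfolding V_def W_def T_eq by simp
      then have "32 * (\<integral>\<^sup>+\<xi>. (case \<xi> of (r, y', z) \<Rightarrow> h y y' * k z) * indicator (V - W y (real n)) \<xi> \<partial>noise_intensity \<nu>) =
          ?c * T n"
        by (simp only: mult_ac)
      with le n have "sqi M (\<lambda>\<omega>. Z t y \<omega> - G \<omega>) \<le> ennreal e + ennreal e"
        by (auto intro: order_trans add_right_mono less_imp_le)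
      also have "\<dots> = ennreal (\<epsilon> * \<delta>\<^sup>2)" using e by (simp add: ennreal_plus[symmetric] e_def del: ennreal_plus)
      finally have "prob {\<omega>\<in>space M. \<delta> < \<bar>Z t y \<omega> - G \<omega>\<bar>} \<le> \<epsilon>"
        using \<epsilon> \<delta> measurable_noise_onD[OF Z_noise, of y] measurable_noise_onD[OF G]
        by (intro prob_abs_gt_le_sqi) auto
      with G show "\<exists>F\<in>borel_measurable (noise_on (W y (real n))). prob {\<omega>\<in>space M. \<delta> < \<bar>Z t y \<omega> - F \<omega>\<bar>} \<le> \<epsilon>"
        by blast
    qed
  qed
  show "ergodic_field M (Z t)" by (rule ergodic)
qed

end
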